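(* Let $\lambda>0$ and $g\in C_b(\mathbb{R}^N)$. Then the function $u\colon\mathbb{R}^N\to\mathbb{R}$ given by $$u(x):=\int_0^\infty e^{-\lambda t}P_tg(x)\,dt,\qquad x\in\mathbb{R}^N,$$ is the unique weak solution of the elliptic equation $\lambda u(x)-\mathcal{L}^{\mathrm{ou}}u(x)=g(x)$, $x\in\mathbb{R}^N$.
   Context: Setting. Let $1\le d\le N$ be integers, $A\in\mathbb{R}^{N\times N}$, $B\in\mathbb{R}^{N\times d}$ with $\mathrm{rank}(B)=d$, $b\in\mathbb{R}^d$, $Q\in\mathbb{R}^{d\times d}$ symmetric and non-negative definite, and $\nu$ a Lévy measure on $\mathbb{R}^d_0:=\mathbb{R}^d\setminus\{0\}$ (i.e. $\sigma$-finite with $\int(1\wedge|z|^2)\,\nu(dz)<\infty$). Standing assumptions: [ND]: there exist $r_0>0$, $\alpha\in(0,2)$ and a finite measure $\mu$ on the unit sphere $\mathbb{S}^{d-1}$ which is non-degenerate (there is $\eta\ge1$ with $\eta^{-1}|p|^\alpha\le\int_{\mathbb{S}^{d-1}}|p\cdot s|^\alpha\mu(ds)\le\eta|p|^\alpha$ for all $p\in\mathbb{R}^d$) such that $\nu(C)\ge\int_0^{r_0}\int_{\mathbb{S}^{d-1}}\mathbf{1}_C(r\theta)\,\mu(d\theta)\frac{dr}{r^{1+\alpha}}$ for all Borel $C\subset\mathbb{R}^d_0$; these are fixed. [K]: $\mathrm{rank}[B,AB,\dots,A^{N-1}B]=N$. Operator. For sufficiently regular $\phi\colon\mathbb{R}^N\to\mathbb{R}$,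 $\mathcal{L}^{\mathrm{ou}}\phi(x)=\mathcal{L}\phi(x)+\langle Ax,D\phi(x)\rangle$ with $$\mathcal{L}\phi(x)=\tfrac12\mathrm{Tr}(BQB^*D^2\phi(x))+\langle Bb,D\phi(x)\rangle+\int_{\mathbb{R}^d_0}\big[\phi(x+Bz)-\phi(x)-\langle D\phi(x),Bz\rangle\mathbf{1}_{B(0,1)}(z)\big]\nu(dz).$$ Semigroup. Let $\{Z_t\}_{t\ge0}$ be a Lévy process on $\mathbb{R}^d$ with $\mathbb{E}[e^{ip\cdot Z_t}]=e^{-t\Phi(p)}$, $\Phi(p)=-ib\cdot p+\frac12p\cdot Qp+\int_{\mathbb{R}^d_0}(1-e^{ip\cdot z}+ip\cdot z\mathbf{1}_{B(0,1)}(z))\nu(dz)$. For $x\in\mathbb{R}^N$ let $X_t=e^{tA}x+\int_0^te^{(t-s)A}B\,dZ_s$ and $P_t\phi(x)=\mathbb{E}[\phi(X_t)]$ for bounded Borel $\phi$. $C_b(\mathbb{R}^N)$ denotes the space of bounded uniformly continuous functions $\mathbb{R}^N\to\mathbb{R}$. Weak solution. A function $u\colon\mathbb{R}^N\to\mathbb{R}$ is a weak solution of $\lambda u-\mathcal{L}^{\mathrm{ou}}u=g$ if $u\in C_b(\mathbb{R}^N)$ and for every $\phi\in C_c^\infty(\mathbb{R}^N)$ $$\int_{\mathbb{R}^N}u(x)\big[\lambda\phi(x)-(\mathcal{L}^{\mathrm{ou}})^*\phi(x)\big]dx=\int_{\mathbb{R}^N}\phi(x)g(x)\,dx,$$ where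 $(\mathcal{L}^{\mathrm{ou}})^*\phi(x)=\mathcal{L}^*\phi(x)-\langle Ax,D\phi(x)\rangle-\mathrm{Tr}(A)\phi(x)$ and $$\mathcal{L}^*\phi(x)=\tfrac12\mathrm{Tr}(BQB^*D^2\phi(x))-\langle Bb,D\phi(x)\rangle+\int_{\mathbb{R}^d_0}\big[\phi(x-Bz)-\phi(x)+\langle D\phi(x),Bz\rangle\mathbf{1}_{B(0,1)}(z)\big]\nu(dz).$$ *)

theory Defs
  imports "HOL-Probability.Probability"
begin

section \<open>Matrices\<close>

text \<open>
  On \<^typ>\<open>real^'n^'n\<close> the library operations \<open>*\<close> and \<open>^\<close> act entrywise, so powers and the
  exponential are built from the matrix product \<open>**\<close>.
\<close>

primrec mat_pow :: "real^'n^'n \<Rightarrow> nat \<Rightarrow> real^'n^'n" where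
  "mat_pow A 0 = mat 1"
| "mat_pow A (Suc k) = A ** mat_pow A k"

definition mat_exp :: "real^'n^'n \<Rightarrow> real^'n^'n" where
  "mat_exp A = (\<Sum>k. (1 / fact k) *\<^sub>R mat_pow A k)"

text \<open>
  The block matrix \<open>[B, A B, \<dots>, A^(N-1) B]\<close> with \<open>N = CARD('n)\<close>. Its columns are indexed by pairs
  (block, column of the block); as there are exactly \<open>N\<close> blocks, the block index is taken from \<open>'n\<close>
  and enumerated as \<open>0, \<dots>, N-1\<close> by the bijection \<^term>\<open>to_nat_on (UNIV :: 'n set)\<close>.
\<close>

definition kalman_matrix :: "real^'n^'n \<Rightarrow> real^'d^'n \<Rightarrow> real^('n \<times> 'd)^'n" where
  "kalman_matrix A B =
     (\<chi> i c. (mat_pow A (to_nat_on (UNIV :: 'n set) (fst c)) ** B) $ i $ snd c)"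

section \<open>Function spaces and derivatives\<close>

definition Cb :: "(real^'n \<Rightarrow> real) set" where
  "Cb = {f. bounded (range f) \<and> uniformly_continuous_on UNIV f}"

definition partial :: "'n \<Rightarrow> (real^'n \<Rightarrow> real) \<Rightarrow> real^'n \<Rightarrow> real" where
  "partial i f x = frechet_derivative f (at x) (axis i 1)"

primrec Ck :: "nat \<Rightarrow> (real^'n \<Rightarrow> real) \<Rightarrow> bool" where
  "Ck 0 f \<longleftrightarrow> continuous_on UNIV f"
| "Ck (Suc k) f \<longleftrightarrow> (\<forall>x. f differentiable (at x)) \<and> (\<forall>i. Ck k (partial i f))"

definition Cc_infty :: "(real^'n \<Rightarrow> real) set" where
  "Cc_infty = {f. (\<forall>k. Ck k f) \<and> compact (closure {x. f x \<noteq> 0})}"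

definition grad :: "(real^'n \<Rightarrow> real) \<Rightarrow> real^'n \<Rightarrow> real^'n" where
  "grad f x = (\<chi> i. partial i f x)"

definition hessian :: "(real^'n \<Rightarrow> real) \<Rightarrow> real^'n \<Rightarrow> real^'n^'n" where
  "hessian f x = (\<chi> i j. partial i (partial j f) x)"

section \<open>Levy measures, exponents and processes\<close>

text \<open>Borel measures on \<open>\<real>\<^sup>d\<close> without the origin: the space of \<open>\<nu>\<close> is \<open>- {0}\<close>.\<close>

definition levy_measure :: "(real^'d) measure \<Rightarrow> bool" where
  "levy_measure \<nu> \<longleftrightarrow>
     sets \<nu> = sets (restrict_space borel (- {0})) \<and>
     sigma_finite_measure \<nu> \<and>
     (\<integral>\<^sup>+z. ennreal (min 1 ((norm z)\<^sup>2)) \<partial>\<nu>) < \<infinity>"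

definition nondegenerate_sphere_measure :: "real \<Rightarrow> (real^'d) measure \<Rightarrow> bool" where
  "nondegenerate_sphere_measure \<alpha> \<mu> \<longleftrightarrow>
     sets \<mu> = sets (restrict_space borel (sphere 0 1)) \<and>
     finite_measure \<mu> \<and>
     (\<exists>\<eta>\<ge>1. \<forall>p. norm p powr \<alpha> / \<eta> \<le> (\<integral>s. \<bar>p \<bullet> s\<bar> powr \<alpha> \<partial>\<mu>) \<and>
                (\<integral>s. \<bar>p \<bullet> s\<bar> powr \<alpha> \<partial>\<mu>) \<le> \<eta> * norm p powr \<alpha>)"

definition dominates_stable ::
    "(real^'d) measure \<Rightarrow> real \<Rightarrow> real \<Rightarrow> (real^'d) measure \<Rightarrow> bool" where
  "dominates_stable \<nu> r0 \<alpha> \<mu> \<longleftrightarrow>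
     (\<forall>C\<in>sets \<nu>.
        (\<integral>\<^sup>+r\<in>{0<..r0}. (\<integral>\<^sup>+\<theta>. indicator C (r *\<^sub>R \<theta>) \<partial>\<mu>) * ennreal (1 / r powr (1 + \<alpha>)) \<partial>lborel)
          \<le> emeasure \<nu> C)"

definition levy_exponent ::
    "real^'d \<Rightarrow> real^'d^'d \<Rightarrow> (real^'d) measure \<Rightarrow> real^'d \<Rightarrow> complex" where
  "levy_exponent b Q \<nu> p =
     - \<i> * of_real (b \<bullet> p) + of_real (p \<bullet> (Q *v p)) / 2 +
     (\<integral>z. 1 - exp (\<i> * of_real (p \<bullet> z)) + \<i> * of_real ((p \<bullet> z) * indicator (ball 0 1) z) \<partial>\<nu>)"

text \<open>
  Paths of an \<open>\<real>\<^sup>d\<close>-valued process on \<open>[0, \<infinity>)\<close>; processes are indexed by \<^typ>\<open>real\<close>, and values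
  at negative times are unconstrained.
\<close>

definition cadlag :: "(real \<Rightarrow> real^'d) \<Rightarrow> bool" where
  "cadlag f \<longleftrightarrow>
     (\<forall>t\<ge>0. (f \<longlongrightarrow> f t) (at_right t)) \<and> (\<forall>t>0. \<exists>l. (f \<longlongrightarrow> l) (at_left t))"

definition levy_process :: "'w measure \<Rightarrow> (real \<Rightarrow> 'w \<Rightarrow> real^'d) \<Rightarrow> bool" where
  "levy_process M Z \<longleftrightarrow>
     prob_space M \<and>
     (\<forall>t\<ge>0. Z t \<in> borel_measurable M) \<and>
     (AE \<omega> in M. Z 0 \<omega> = 0) \<and>
     (\<forall>n t. 0 \<le> t 0 \<and> (\<forall>i<n. t i \<le> t (Suc i)) \<longrightarrow>
        prob_space.indep_vars M (\<lambda>_. borel) (\<lambda>i \<omega>. Z (t (Suc i)) \<omega> - Z (t i) \<omega>) {..<n :: nat}) \<and>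
     (\<forall>s\<ge>0. \<forall>h\<ge>0. distr M borel (\<lambda>\<omega>. Z (s + h) \<omega> - Z s \<omega>) = distr M borel (Z h)) \<and>
     (\<forall>t\<ge>0. \<forall>\<epsilon>>0.
        ((\<lambda>s. measure M {\<omega>\<in>space M. norm (Z s \<omega> - Z t \<omega>) > \<epsilon>}) \<longlongrightarrow> 0) (at t within {0..})) \<and>
     (AE \<omega> in M. cadlag (\<lambda>t. Z t \<omega>))"

section \<open>Stochastic integrals of deterministic integrands\<close>

text \<open>A partition of \<open>[0, t]\<close> is given by its number \<open>k\<close> of intervals and its points \<open>p 0, \<dots>, p k\<close>.\<close>

definition is_partition :: "real \<Rightarrow> nat \<Rightarrow> (nat \<Rightarrow> real) \<Rightarrow> bool" where
  "is_partition t k p \<longleftrightarrow> p 0 = 0 \<and> p k = t \<and> (\<forall>i<k. p i \<le> p (Suc i))"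

definition riemann_sum ::
    "(real \<Rightarrow> 'w \<Rightarrow> real^'d) \<Rightarrow> (real \<Rightarrow> real^'d^'n) \<Rightarrow> nat \<Rightarrow> (nat \<Rightarrow> real) \<Rightarrow> 'w \<Rightarrow> real^'n" where
  "riemann_sum Z F k p \<omega> = (\<Sum>i<k. F (p i) *v (Z (p (Suc i)) \<omega> - Z (p i) \<omega>))"

text \<open>
  \<open>I\<close> is a version of \<open>\<integral>\<^sub>0\<^sup>t F(s) dZ\<^sub>s\<close>: along every sequence of partitions with mesh tending
  to \<open>0\<close>, the left-point sums converge to \<open>I\<close> in probability. For continuous \<open>F\<close> such an \<open>I\<close> is
  almost surely unique.
\<close>

definition is_stoch_integral ::
    "'w measure \<Rightarrow> (real \<Rightarrow> 'w \<Rightarrow> real^'d) \<Rightarrow> (real \<Rightarrow> real^'d^'n) \<Rightarrow> real \<Rightarrow> ('w \<Rightarrow> real^'n) \<Rightarrow> bool" where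
  "is_stoch_integral M Z F t I \<longleftrightarrow>
     I \<in> borel_measurable M \<and>
     (\<forall>k p. (\<forall>m :: nat. is_partition t (k m) (p m)) \<and>
            (\<forall>\<delta>>0. \<forall>\<^sub>F m in sequentially. \<forall>i<k m. p m (Suc i) - p m i < \<delta>) \<longrightarrow>
        (\<forall>\<epsilon>>0. (\<lambda>m. measure M {\<omega>\<in>space M. norm (riemann_sum Z F (k m) (p m) \<omega> - I \<omega>) > \<epsilon>})
                 \<longlonglongrightarrow> 0))"

definition stoch_integral ::
    "'w measure \<Rightarrow> (real \<Rightarrow> 'w \<Rightarrow> real^'d) \<Rightarrow> (real \<Rightarrow> real^'d^'n) \<Rightarrow> real \<Rightarrow> 'w \<Rightarrow> real^'n" where
  "stoch_integral M Z F t = (SOME I. is_stoch_integral M Z F t I)"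

section \<open>The Ornstein--Uhlenbeck process, its semigroup, and weak solutions\<close>

definition ou_process ::
    "'w measure \<Rightarrow> (real \<Rightarrow> 'w \<Rightarrow> real^'d) \<Rightarrow> real^'n^'n \<Rightarrow> real^'d^'n \<Rightarrow>
     real^'n \<Rightarrow> real \<Rightarrow> 'w \<Rightarrow> real^'n" where
  "ou_process M Z A B x t \<omega> =
     mat_exp (t *\<^sub>R A) *v x + stoch_integral M Z (\<lambda>s. mat_exp ((t - s) *\<^sub>R A) ** B) t \<omega>"

definition ou_semigroup ::
    "'w measure \<Rightarrow> (real \<Rightarrow> 'w \<Rightarrow> real^'d) \<Rightarrow> real^'n^'n \<Rightarrow> real^'d^'n \<Rightarrow>
     real \<Rightarrow> (real^'n \<Rightarrow> real) \<Rightarrow> real^'n \<Rightarrow> real" where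
  "ou_semigroup M Z A B t \<phi> x = (\<integral>\<omega>. \<phi> (ou_process M Z A B x t \<omega>) \<partial>M)"

definition levy_op_adj ::
    "real^'d^'n \<Rightarrow> real^'d \<Rightarrow> real^'d^'d \<Rightarrow> (real^'d) measure \<Rightarrow>
     (real^'n \<Rightarrow> real) \<Rightarrow> real^'n \<Rightarrow> real" where
  "levy_op_adj B b Q \<nu> \<phi> x =
     trace (B ** Q ** transpose B ** hessian \<phi> x) / 2 - (B *v b) \<bullet> grad \<phi> x +
     (\<integral>z. \<phi> (x - B *v z) - \<phi> x + (grad \<phi> x \<bullet> (B *v z)) * indicator (ball 0 1) z \<partial>\<nu>)"

definition ou_op_adj ::
    "real^'n^'n \<Rightarrow> real^'d^'n \<Rightarrow> real^'d \<Rightarrow> real^'d^'d \<Rightarrow> (real^'d) measure \<Rightarrow>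
     (real^'n \<Rightarrow> real) \<Rightarrow> real^'n \<Rightarrow> real" where
  "ou_op_adj A B b Q \<nu> \<phi> x =
     levy_op_adj B b Q \<nu> \<phi> x - (A *v x) \<bullet> grad \<phi> x - trace A * \<phi> x"

text \<open>Weak solutions \<open>u\<close> of \<open>lam u - L\<^sup>o\<^sup>u u = g\<close>, with \<open>L\<^sup>o\<^sup>u\<close> moved onto the test function.\<close>

definition weak_solution ::
    "real^'n^'n \<Rightarrow> real^'d^'n \<Rightarrow> real^'d \<Rightarrow> real^'d^'d \<Rightarrow> (real^'d) measure \<Rightarrow>
     real \<Rightarrow> (real^'n \<Rightarrow> real) \<Rightarrow> (real^'n \<Rightarrow> real) \<Rightarrow> bool" where
  "weak_solution A B b Q \<nu> lam g u \<longleftrightarrow>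
     u \<in> Cb \<and>
     (\<forall>\<phi>\<in>Cc_infty.
        (\<integral>x. u x * (lam * \<phi> x - ou_op_adj A B b Q \<nu> \<phi> x) \<partial>lborel) = (\<integral>x. \<phi> x * g x \<partial>lborel))"

end

theory Submission
  imports Defs
begin

text \<open>
  Existence: on plane waves \<open>e\<^sub>q x = exp (\<i> q \<bullet> x)\<close> the semigroup is explicit, \<open>P\<^sub>t e\<^sub>q\<close> being a scalar
  multiple of the wave with frequency \<open>exp (t A)\<^sup>* q\<close>, and the weak equation for \<open>g = e\<^sub>q\<close> is the
  fundamental theorem of calculus for \<open>t \<mapsto> e\<^bsup>- lam t\<^esup> \<integral> P\<^sub>t e\<^sub>q \<phi>\<close>. The functions \<open>g\<close> for which it holds form a
  vector space closed under bounded pointwise limits, and every bounded continuous function is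
  such a limit of trigonometric polynomials.

  Uniqueness: the difference \<open>v\<close> of two weak solutions is mollified. Since \<open>v\<close> is uniformly
  continuous, the commutator of the mollifier with the linear drift tends to \<open>0\<close> uniformly, so a
  maximum principle for the mollified function gives \<open>sup v \<le> 0\<close>.
\<close>

section \<open>Matrices\<close>

text \<open>The obstacle is low regularity: weak solutions are only uniformly continuous, while the
  operator is of second order, nonlocal and has an unbounded drift. All derivatives are therefore
  kept on a smooth factor. For bounded measurable \<open>W\<close>, \<open>shift_int f W s\<close>
  integrates \<open>W\<close> against the translate of \<open>f\<close> by \<open>s\<close>, and
  integrating \<open>W\<close> against the Levy part of the adjoint operator amounts to applying the
  Levy operator to this smooth function of \<open>s\<close>. With \<open>W\<close> a wave this
  yields the symbol, with a maximum at 0 it yields a sign, so one identity feeds both halves. The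
  drift does not commute with translations and is handled separately, as a divergence. On the
  probabilistic side the stochastic integral is picked by \<open>SOME\<close>, and its law is
  reached only through characteristic functions. Joint measurability of the semigroup in time and
  space cannot be seen from its definition; it is visible for waves and is carried through the
  approximation together with the weak equation.\<close>

lemma mat_pow_scaleR: "mat_pow (t *\<^sub>R A) k = t ^ k *\<^sub>R mat_pow A k"
  by (induction k) (auto simp: vec_eq_iff matrix_matrix_mult_def sum_distrib_left mult_ac)

lemma mat_pow_commute: "mat_pow A k ** A = A ** mat_pow A k"
  by (induction k) (auto simp: matrix_mul_assoc[symmetric])

text \<open>Geometric growth of the entries lets the exponential series of a matrix be dominated,
  entry by entry, by that of a real number. The sum of all absolute entries bounds every row sum at
  once, which is what the induction multiplies by.\<close>

lemma mat_pow_entry_bound: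
  fixes A :: "real^'n^'n"
  shows "\<bar>mat_pow A k $ i $ j\<bar> \<le> (1 + (\<Sum>i\<in>UNIV. \<Sum>l\<in>UNIV. \<bar>A $ i $ l\<bar>)) ^ k"
proof (induction k arbitrary: i j)
  case 0
  then show ?case by (simp add: mat_def)
next
  case (Suc k)
  define C where "C = 1 + (\<Sum>i\<in>UNIV. \<Sum>l\<in>UNIV. \<bar>A $ i $ l\<bar>)"
  have C0: "C \<ge> 0" unfolding C_def by (intro add_nonneg_nonneg sum_nonneg) auto
  have "\<bar>mat_pow A (Suc k) $ i $ j\<bar> \<le> (\<Sum>l\<in>UNIV. \<bar>A $ i $ l\<bar> * \<bar>mat_pow A k $ l $ j\<bar>)"
    by (simp add: matrix_matrix_mult_def) (rule order_trans[OF sum_abs], simp add: abs_mult)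
  also have "\<dots> \<le> (\<Sum>l\<in>UNIV. \<bar>A $ i $ l\<bar> * C ^ k)"
    using Suc.IH by (intro sum_mono mult_left_mono) (auto simp: C_def)
  also have "\<dots> = (\<Sum>l\<in>UNIV. \<bar>A $ i $ l\<bar>) * C ^ k" by (simp add: sum_distrib_right)
  also have "\<dots> \<le> C * C ^ k"
  proof (rule mult_right_mono)
    have "(\<Sum>l\<in>UNIV. \<bar>A $ i $ l\<bar>) \<le> (\<Sum>i\<in>UNIV. \<Sum>l\<in>UNIV. \<bar>A $ i $ l\<bar>)"
      by (rule member_le_sum[of i UNIV "\<lambda>i. \<Sum>l\<in>UNIV. \<bar>A $ i $ l\<bar>"]) (auto intro: sum_nonneg)
    then show "(\<Sum>l\<in>UNIV. \<bar>A $ i $ l\<bar>) \<le> C" by (simp add: C_def)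
  qed (use C0 in simp)
  finally show ?case by (simp add: C_def)
qed

lemma summable_mat_pow_entry:
  fixes A :: "real^'n^'n"
  shows "summable (\<lambda>k. mat_pow A k $ i $ j / fact k * t ^ k)"
proof -
  define C where "C = 1 + (\<Sum>i\<in>UNIV. \<Sum>l\<in>UNIV. \<bar>A $ i $ l\<bar>)"
  show ?thesis
  proof (rule summable_comparison_test')
    show "summable (\<lambda>k. (C * \<bar>t\<bar>) ^ k /\<^sub>R fact k)" by (rule summable_exp_generic)
    show "norm (mat_pow A k $ i $ j / fact k * t ^ k) \<le> (C * \<bar>t\<bar>) ^ k /\<^sub>R fact k" for k
      using mat_pow_entry_bound[of A k i j]
      by (auto simp: abs_mult power_mult_distrib power_abs C_def[symmetric] divide_inverse intro!: mult_right_mono)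
  qed
qed

text \<open>Each entry becomes a real power series in \<open>t\<close> converging everywhere, which
  makes termwise differentiation and evaluation at 0 available.\<close>

lemma mat_exp_scaleR_entry:
  fixes A :: "real^'n^'n"
  shows "mat_exp (t *\<^sub>R A) $ i $ j = (\<Sum>k. mat_pow A k $ i $ j / fact k * t ^ k)"
proof -
  have "(\<lambda>k. (1 / fact k) *\<^sub>R mat_pow (t *\<^sub>R A) k) sums
         (\<chi> i j. \<Sum>k. mat_pow A k $ i $ j / fact k * t ^ k)"
    unfolding sums_def
  proof (intro vec_tendstoI)
    fix i j
    show "(\<lambda>n. (\<Sum>k<n. (1 / fact k) *\<^sub>R mat_pow (t *\<^sub>R A) k) $ i $ j) \<longlonglongrightarrow>
          (\<chi> i j. \<Sum>k. mat_pow A k $ i $ j / fact k * t ^ k) $ i $ j"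
      using summable_sums[OF summable_mat_pow_entry[of A i j t]]
      by (simp add: sums_def mat_pow_scaleR mult_ac)
  qed
  then show ?thesis by (simp add: mat_exp_def sums_iff)
qed

lemma has_vector_derivative_vecI:
  fixes f :: "real \<Rightarrow> 'b::real_normed_vector ^ 'n"
  assumes "\<And>i. ((\<lambda>t. f t $ i) has_vector_derivative f' $ i) (at t within S)"
  shows "(f has_vector_derivative f') (at t within S)"
proof -
  have "((\<lambda>y. (f y - f t - (y - t) *\<^sub>R f') /\<^sub>R norm (y - t)) \<longlongrightarrow> 0) (at t within S)"
    using assms unfolding has_vector_derivative_def has_derivative_within
    by (intro vec_tendstoI) (simp add: diff_diff_eq divide_inverse)
  then show ?thesis
    unfolding has_vector_derivative_def has_derivative_within
    by (simp add: diff_diff_eq bounded_linear_scaleR_left divide_inverse)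
qed

text \<open>The factor \<open>A\<close> stands on the right so that it acts on a point before the
  flow does: differentiating a transported wave in time then produces the vector
  \<open>A *v x\<close>, the same one as in the drift term of the adjoint operator.\<close>

lemma mat_exp_has_vector_derivative:
  fixes A :: "real^'n^'n"
  shows "((\<lambda>t. mat_exp (t *\<^sub>R A)) has_vector_derivative mat_exp (t *\<^sub>R A) ** A) (at t)"
proof (intro has_vector_derivative_vecI)
  fix i j
  define c where "c l k = mat_pow A k $ i $ l / fact k" for l k
  have sm: "summable (\<lambda>k. c l k * t ^ k)" for l t
    unfolding c_def by (rule summable_mat_pow_entry)
  \<comment> \<open>Differentiation shifts the index: the factor \<open>Suc k\<close> turns
    \<open>fact (Suc k)\<close> into \<open>fact k\<close> and leaves an entry of the power
    \<open>Suc k\<close>, which is split with \<open>A\<close> on the right by commutation.\<close>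
  have d: "diffs (c j) k = (\<Sum>l\<in>UNIV. c l k * A $ l $ j)" for k
  proof -
    have "mat_pow A (Suc k) $ i $ j = (\<Sum>l\<in>UNIV. mat_pow A k $ i $ l * A $ l $ j)"
      unfolding mat_pow.simps mat_pow_commute[symmetric] by (simp add: matrix_matrix_mult_def)
    then show ?thesis
    proof -
      have f: "fact (Suc k) = (real (Suc k)) * fact k" by simp
      have "diffs (c j) k = mat_pow A (Suc k) $ i $ j / fact k"
        unfolding diffs_def c_def f by (simp del: of_nat_Suc mat_pow.simps fact_Suc)
      then show ?thesis
        using \<open>mat_pow A (Suc k) $ i $ j = _\<close> by (simp add: c_def sum_divide_distrib)
    qed
  qed
  have "((\<lambda>x. \<Sum>k. c j k * x ^ k) has_field_derivative (\<Sum>k. diffs (c j) k * t ^ k)) (at t)"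
    by (rule termdiffs_strong_converges_everywhere) (rule sm)
  moreover have "(\<Sum>k. diffs (c j) k * t ^ k) = (\<Sum>l\<in>UNIV. (\<Sum>k. c l k * t ^ k) * A $ l $ j)"
  proof -
    have "(\<lambda>k. \<Sum>l\<in>UNIV. (c l k * t ^ k) * A $ l $ j) sums (\<Sum>l\<in>UNIV. (\<Sum>k. c l k * t ^ k) * A $ l $ j)"
      by (intro sums_sum sums_mult2 summable_sums sm)
    then show ?thesis by (simp add: sums_iff d sum_distrib_right sum_distrib_left mult_ac)
  qed
  ultimately show "((\<lambda>t. mat_exp (t *\<^sub>R A) $ i $ j) has_vector_derivative (mat_exp (t *\<^sub>R A) ** A) $ i $ j) (at t)"
    by (simp add: mat_exp_scaleR_entry matrix_matrix_mult_def c_def has_real_derivative_iff_has_vector_derivative)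
qed

lemma mat_exp_0: "mat_exp (0 :: real^'n^'n) = mat 1"
proof -
  have "(\<Sum>k. mat_pow (0 :: real^'n^'n) k $ i $ j / fact k * 0 ^ k) = (mat 1 :: real^'n^'n) $ i $ j" for i j
    using powser_sums_zero[of "\<lambda>k. mat_pow (0 :: real^'n^'n) k $ i $ j / fact k"]
    by (simp add: sums_iff)
  then show ?thesis
    using mat_exp_scaleR_entry[of 0 "0::real^'n^'n"] by (simp add: vec_eq_iff)
qed

section \<open>Bilinearity and continuity of matrix products\<close>

lemma bounded_bilinear_matrix_vector_mult:
  "bounded_bilinear ((*v) :: real^'d^'n \<Rightarrow> real^'d \<Rightarrow> real^'n)"
proof -
  have "bilinear ((*v) :: real^'d^'n \<Rightarrow> real^'d \<Rightarrow> real^'n)"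
    unfolding bilinear_def
    by (auto intro!: linearI simp: matrix_vector_mult_def vec_eq_iff algebra_simps sum.distrib sum_distrib_left)
  then show ?thesis by (simp add: bilinear_conv_bounded_bilinear)
qed

lemma bounded_bilinear_matrix_matrix_mult:
  "bounded_bilinear ((**) :: real^'d^'n \<Rightarrow> real^'k^'d \<Rightarrow> real^'k^'n)"
proof -
  have "bilinear ((**) :: real^'d^'n \<Rightarrow> real^'k^'d \<Rightarrow> real^'k^'n)"
    unfolding bilinear_def
    by (auto intro!: linearI simp: matrix_matrix_mult_def vec_eq_iff algebra_simps sum.distrib sum_distrib_left)
  then show ?thesis by (simp add: bilinear_conv_bounded_bilinear)
qed

lemmas tendsto_matrix_vector_mult' =
  bounded_bilinear.tendsto[OF bounded_bilinear_matrix_vector_mult]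
lemmas continuous_on_matrix_vector_mult' =
  bounded_bilinear.continuous_on[OF bounded_bilinear_matrix_vector_mult]
lemmas continuous_on_matrix_matrix_mult' =
  bounded_bilinear.continuous_on[OF bounded_bilinear_matrix_matrix_mult]

lemma continuous_on_mat_exp:
  assumes "continuous_on S f"
  shows "continuous_on S (\<lambda>x. mat_exp (f x *\<^sub>R A))"
proof (rule continuous_on_compose2[OF _ assms])
  show "continuous_on UNIV (\<lambda>t. mat_exp (t *\<^sub>R A))"
    by (intro continuous_at_imp_continuous_on ballI has_vector_derivative_continuous[OF mat_exp_has_vector_derivative])
qed auto

text \<open>Completing the square eliminates one index at a time.\<close>

lemma psd_sum_of_squares:
  fixes Q :: "real^'d^'d"
  assumes sym: "transpose Q = Q" and psd: "\<And>p. 0 \<le> p \<bullet> (Q *v p)"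
  obtains w :: "'d \<Rightarrow> real^'d" where "\<And>i j. Q $ i $ j = (\<Sum>k\<in>UNIV. w k $ i * w k $ j)"
proof -
  \<comment> \<open>The induction runs over a set \<open>S\<close> outside which the rows of
    \<open>Q\<close> vanish; each index of \<open>S\<close> contributes one square, possibly of the
    zero vector.\<close>
  have main: "\<exists>w :: 'd \<Rightarrow> real^'d. \<forall>i j. Q $ i $ j = (\<Sum>k\<in>S. w k $ i * w k $ j)"
    if "finite S" "\<And>i j. i \<notin> S \<Longrightarrow> Q $ i $ j = 0" "transpose Q = Q" "\<And>p. 0 \<le> p \<bullet> (Q *v p)"
    for S and Q :: "real^'d^'d"
    using that
  proof (induction S arbitrary: Q rule: finite_induct)
    case empty
    then show ?case by auto
  next
    case (insert s S)
    have sy: "Q $ i $ j = Q $ j $ i" for i j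
      using insert.prems(2) by (metis transpose_def vec_lambda_beta)
    define v where "v = Q $ s"
    define q where "q = v $ s"
    have Qv: "(Q *v p) $ s = v \<bullet> p" for p
      by (simp add: v_def matrix_vector_mul_component)
    have Qax: "Q *v axis s 1 = v"
      by (simp add: vec_eq_iff matrix_vector_mult_basis column_def v_def sy)
    have quad: "(p + c *\<^sub>R axis s 1) \<bullet> (Q *v (p + c *\<^sub>R axis s 1)) = p \<bullet> (Q *v p) + 2 * c * (v \<bullet> p) + c\<^sup>2 * q" for p c
    proof -
      have "axis s 1 \<bullet> (Q *v p) = v \<bullet> p" by (simp add: inner_axis' Qv)
      moreover have "axis s 1 \<bullet> v = q" by (simp add: inner_axis' q_def)
      ultimately show ?thesis
        by (simp add: matrix_vector_right_distrib matrix_vector_mult_scaleR Qax inner_add_left inner_add_right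
            power2_eq_square algebra_simps inner_commute)
    qed
    have q0: "q \<ge> 0" using insert.prems(3)[of "axis s 1"]
      by (simp add: Qax inner_axis' q_def)
    show ?case
    proof (cases "q = 0")
      case True
      have "v \<bullet> p = 0" for p
      proof (rule ccontr)
        assume ne: "v \<bullet> p \<noteq> 0"
        \<comment> \<open>With \<open>q = 0\<close> the form is affine in \<open>c\<close>, and this
          \<open>c\<close> gives it the value -1.\<close>
        define c where "c = - (p \<bullet> (Q *v p) + 1) / (2 * (v \<bullet> p))"
        have "p \<bullet> (Q *v p) + 2 * c * (v \<bullet> p) + c\<^sup>2 * q \<ge> 0"
          using insert.prems(3)[of "p + c *\<^sub>R axis s 1"] unfolding quad .
        moreover have "2 * c * (v \<bullet> p) = - (p \<bullet> (Q *v p) + 1)" using ne by (simp add: c_def)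
        ultimately show False using True by simp
      qed
      then have "v = 0" by (metis inner_eq_zero_iff)
      then have "Q $ i $ j = 0" if "i \<notin> S" for i j
        using insert.prems(1)[of i j] that by (cases "i = s") (auto simp: v_def)
      then obtain w :: "'d \<Rightarrow> real^'d" where w: "\<forall>i j. Q $ i $ j = (\<Sum>k\<in>S. w k $ i * w k $ j)"
        using insert.IH[of Q] insert.prems by blast
      have "\<forall>i j. Q $ i $ j = (\<Sum>k\<in>insert s S. (w(s := 0)) k $ i * (w(s := 0)) k $ j)"
        using w insert.hyps by (auto intro!: sum.cong)
      then show ?thesis by blast
    next
      case False
      then have qp: "q > 0" using q0 by simp
      \<comment> \<open>The Schur complement of the pivot \<open>q\<close>. Its row \<open>s\<close>
        vanishes, so the induction hypothesis for \<open>S\<close> applies; its form at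
        \<open>p\<close> is the minimum over \<open>c\<close> of the form of \<open>Q\<close> at
        \<open>p + c *\<^sub>R axis s 1\<close>, hence nonnegative.\<close>
      define R :: "real^'d^'d" where "R = (\<chi> i j. Q $ i $ j - v $ i * v $ j / q)"
      have R1: "R $ i $ j = 0" if "i \<notin> S" for i j
        using insert.prems(1)[of i j] insert.prems(1)[of i s] that qp sy[of i s]
        by (cases "i = s") (auto simp: R_def v_def q_def)
      have R2: "transpose R = R" by (simp add: R_def transpose_def vec_eq_iff sy mult.commute)
      have Rv: "R *v p = Q *v p - ((v \<bullet> p) / q) *\<^sub>R v" for p
        by (simp add: R_def vec_eq_iff matrix_vector_mult_def inner_vec_def algebra_simps sum_subtractf sum_distrib_left sum_divide_distrib)
      have R3: "0 \<le> p \<bullet> (R *v p)" for p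
      proof -
        have "0 \<le> p \<bullet> (Q *v p) + 2 * (- (v \<bullet> p) / q) * (v \<bullet> p) + (- (v \<bullet> p) / q)\<^sup>2 * q"
          using insert.prems(3)[of "p + (- (v \<bullet> p) / q) *\<^sub>R axis s 1"] unfolding quad .
        also have "\<dots> = p \<bullet> (R *v p)"
          using qp by (simp add: Rv inner_diff_right power2_eq_square field_simps inner_commute)
        finally show ?thesis .
      qed
      obtain w :: "'d \<Rightarrow> real^'d" where w: "\<forall>i j. R $ i $ j = (\<Sum>k\<in>S. w k $ i * w k $ j)"
        using insert.IH[of R] R1 R2 R3 by blast
      define u where "u = w(s := (1 / sqrt q) *\<^sub>R v)"
      have "Q $ i $ j = (\<Sum>k\<in>insert s S. u k $ i * u k $ j)" for i j
      proof -
        have "(\<Sum>k\<in>S. u k $ i * u k $ j) = R $ i $ j"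
          using w insert.hyps by (auto simp: u_def intro!: sum.cong)
        then show ?thesis using insert.hyps qp by (simp add: u_def R_def)
      qed
      then show ?thesis by blast
    qed
  qed
  show ?thesis using main[of UNIV Q] sym psd that by auto
qed

section \<open>Test functions\<close>

lemma partial_eqI: "(f has_derivative f') (at x) \<Longrightarrow> partial i f x = f' (axis i 1)"
  unfolding partial_def using frechet_derivative_at by metis

lemma Ck_Suc_imp: "Ck (Suc k) f \<Longrightarrow> Ck k f"
proof (induction k arbitrary: f)
  case 0
  then show ?case
    by (auto intro!: differentiable_imp_continuous_on simp: differentiable_on_def)
next
  case (Suc k)
  then show ?case by auto
qed

lemma Ck_const: "Ck k (\<lambda>x. c)"
proof (induction k arbitrary: c)
  case (Suc k)
  have "partial i (\<lambda>x. c) = (\<lambda>x. 0)" for i :: 'a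
    by (rule ext, subst partial_eqI[OF has_derivative_const]) simp
  then show ?case using Suc.IH by simp
qed simp

lemma differentiable_has_frechet_derivative: "f differentiable (at x) \<Longrightarrow> (f has_derivative frechet_derivative f (at x)) (at x)"
  by (simp add: frechet_derivative_works)

lemma partial_add:
  assumes "f differentiable (at x)" "g differentiable (at x)"
  shows "partial i (\<lambda>x. f x + g x) x = partial i f x + partial i g x"
proof -
  have "((\<lambda>x. f x + g x) has_derivative (\<lambda>h. frechet_derivative f (at x) h + frechet_derivative g (at x) h)) (at x)"
    by (intro has_derivative_add differentiable_has_frechet_derivative assms)
  from partial_eqI[OF this] show ?thesis by (simp add: partial_def)
qed

lemma partial_mult:
  assumes "f differentiable (at x)" "g differentiable (at x)"
  shows "partial i (\<lambda>x. f x * g x) x = f x * partial i g x + partial i f x * g x"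
proof -
  have "((\<lambda>x. f x * g x) has_derivative (\<lambda>h. f x * frechet_derivative g (at x) h + frechet_derivative f (at x) h * g x)) (at x)"
    by (intro has_derivative_mult differentiable_has_frechet_derivative assms)
  from partial_eqI[OF this] show ?thesis by (simp add: partial_def)
qed

lemma partial_cmult:
  assumes "f differentiable (at x)"
  shows "partial i (\<lambda>x. c * f x) x = c * partial i f x"
proof -
  have "((\<lambda>x. c * f x) has_derivative (\<lambda>h. c * frechet_derivative f (at x) h)) (at x)"
    by (intro has_derivative_mult_right differentiable_has_frechet_derivative assms)
  from partial_eqI[OF this] show ?thesis by (simp add: partial_def)
qed

lemma partial_sum:
  assumes "\<And>i. i \<in> S \<Longrightarrow> f i differentiable (at x)"
  shows "partial j (\<lambda>x. \<Sum>i\<in>S. f i x) x = (\<Sum>i\<in>S. partial j (f i) x)"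
proof -
  have "((\<lambda>x. \<Sum>i\<in>S. f i x) has_derivative (\<lambda>h. \<Sum>i\<in>S. frechet_derivative (f i) (at x) h)) (at x)"
    by (intro has_derivative_sum differentiable_has_frechet_derivative assms)
  from partial_eqI[OF this] show ?thesis by (simp add: partial_def)
qed

lemma Ck_add: "Ck k f \<Longrightarrow> Ck k g \<Longrightarrow> Ck k (\<lambda>x. f x + g x)"
proof (induction k arbitrary: f g)
  case (Suc k)
  have "partial i (\<lambda>x. f x + g x) = (\<lambda>x. partial i f x + partial i g x)" for i
    using Suc.prems by (simp add: fun_eq_iff partial_add)
  then show ?case using Suc.prems by (simp add: Suc.IH)
qed (auto intro: continuous_intros)

lemma Ck_mult: "Ck k f \<Longrightarrow> Ck k g \<Longrightarrow> Ck k (\<lambda>x. f x * g x)"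
proof (induction k arbitrary: f g)
  case (Suc k)
  have "partial i (\<lambda>x. f x * g x) = (\<lambda>x. f x * partial i g x + partial i f x * g x)" for i
    using Suc.prems by (simp add: fun_eq_iff partial_mult)
  then show ?case using Suc.prems Ck_Suc_imp[OF Suc.prems(1)] Ck_Suc_imp[OF Suc.prems(2)]
    by (simp add: Ck_add Suc.IH)
qed (auto intro: continuous_intros)

lemma partial_affine:
  assumes "\<And>x. f differentiable (at x)"
  shows "partial i (\<lambda>x. f (a + c *\<^sub>R x)) x = c * partial i f (a + c *\<^sub>R x)"
    and "(\<lambda>x. f (a + c *\<^sub>R x)) differentiable (at x)"
proof -
  have D: "((\<lambda>x. f (a + c *\<^sub>R x)) has_derivative (\<lambda>h. frechet_derivative f (at (a + c *\<^sub>R x)) (c *\<^sub>R h))) (at x)"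
    by (rule has_derivative_compose[OF _ differentiable_has_frechet_derivative[OF assms]]) (auto intro!: derivative_eq_intros)
  have "linear (frechet_derivative f (at (a + c *\<^sub>R x)))"
    by (rule linear_frechet_derivative[OF assms])
  then show "partial i (\<lambda>x. f (a + c *\<^sub>R x)) x = c * partial i f (a + c *\<^sub>R x)"
    using partial_eqI[OF D, of i] by (simp add: partial_def linear_scale)
  show "(\<lambda>x. f (a + c *\<^sub>R x)) differentiable (at x)"
    using D unfolding differentiable_def by blast
qed

lemma Ck_affine: "Ck k f \<Longrightarrow> Ck k (\<lambda>x. f (a + c *\<^sub>R x))"
proof (induction k arbitrary: f)
  case 0
  have "continuous_on UNIV (\<lambda>x. a + c *\<^sub>R x)" by (intro continuous_intros)
  with 0 show ?case using continuous_on_compose2 by fastforce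
next
  case (Suc k)
  have "partial i (\<lambda>x. f (a + c *\<^sub>R x)) = (\<lambda>x. c * partial i f (a + c *\<^sub>R x))" for i
    using Suc.prems by (intro ext partial_affine) simp
  moreover have "Ck k (\<lambda>x. c * partial i f (a + c *\<^sub>R x))" for i
    using Suc.prems by (intro Ck_mult[OF Ck_const] Suc.IH) simp
  ultimately show ?case using partial_affine(2)[of f] Suc.prems by simp
qed

lemma Ck_component: "Ck k (\<lambda>x. x $ i)"
proof (cases k)
  case (Suc m)
  have D: "((\<lambda>x. x $ i) has_derivative (\<lambda>x. x $ i)) (at x)" for x :: "real^'a"
    by (rule bounded_linear_imp_has_derivative[OF bounded_linear_vec_nth])
  have "partial j (\<lambda>x. x $ i) = (\<lambda>x. axis j 1 $ i)" for j
    by (rule ext) (rule partial_eqI[OF D])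
  then show ?thesis using Suc D by (auto intro!: Ck_const simp: differentiable_def)
qed (auto intro: continuous_intros)

section \<open>Test functions and directional derivatives\<close>

lemma Cc_infty_iff: "f \<in> Cc_infty \<longleftrightarrow> (\<forall>k. Ck k f) \<and> (\<exists>r. \<forall>x. norm x > r \<longrightarrow> f x = 0)"
proof -
  have "bounded {x. f x \<noteq> 0} \<longleftrightarrow> (\<exists>r. \<forall>x. norm x > r \<longrightarrow> f x = 0)"
    unfolding bounded_iff by (metis (mono_tags, lifting) mem_Collect_eq not_le)
  then show ?thesis by (simp add: Cc_infty_def compact_closure)
qed

lemma Cc_infty_supportE:
  assumes "f \<in> Cc_infty"
  obtains r where "r > 0" "\<And>x. norm x \<ge> r \<Longrightarrow> f x = 0"
proof -
  obtain r where r: "\<forall>x. norm x > r \<longrightarrow> f x = 0" using assms Cc_infty_iff by blast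
  then show ?thesis by (intro that[of "max 0 r + 1"]) auto
qed

lemma Cc_infty_Ck: "f \<in> Cc_infty \<Longrightarrow> Ck k f"
  by (auto simp: Cc_infty_iff)

lemma Cc_infty_differentiable: "f \<in> Cc_infty \<Longrightarrow> f differentiable (at x)"
  using Cc_infty_Ck[of f "Suc 0"] by auto

lemma Cc_infty_continuous: "f \<in> Cc_infty \<Longrightarrow> continuous_on UNIV f"
  using Cc_infty_Ck[of f 0] by auto

lemma Cc_infty_borel[measurable]: "f \<in> Cc_infty \<Longrightarrow> f \<in> borel_measurable borel"
  by (intro borel_measurable_continuous_onI Cc_infty_continuous)

lemma has_derivative_grad:
  assumes "f differentiable (at x)"
  shows "(f has_derivative (\<lambda>h. grad f x \<bullet> h)) (at x)"
proof -
  have l: "linear (frechet_derivative f (at x))" by (rule linear_frechet_derivative[OF assms])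
  have "frechet_derivative f (at x) h = grad f x \<bullet> h" for h
  proof -
    have "h = (\<Sum>i\<in>UNIV. h $ i *\<^sub>R axis i 1)"
      by (simp add: vec_eq_iff axis_def if_distrib cong: if_cong)
    then have "frechet_derivative f (at x) h = frechet_derivative f (at x) (\<Sum>i\<in>UNIV. h $ i *\<^sub>R axis i 1)"
      by simp
    also have "\<dots> = (\<Sum>i\<in>UNIV. h $ i * partial i f x)"
      by (simp add: linear_sum[OF l] linear_scale[OF l] partial_def)
    finally show ?thesis by (simp add: grad_def inner_vec_def mult.commute)
  qed
  then have "frechet_derivative f (at x) = (\<lambda>h. grad f x \<bullet> h)" by blast
  then show ?thesis using differentiable_has_frechet_derivative[OF assms] by simp
qed

text \<open>Directional derivative along \<open>h\<close>, written through the gradient so that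
  linearity in \<open>h\<close> holds by definition, without any differentiability of
  \<open>f\<close>.\<close>

definition dder :: "real^'n \<Rightarrow> (real^'n \<Rightarrow> real) \<Rightarrow> real^'n \<Rightarrow> real" where
  "dder h f x = grad f x \<bullet> h"

lemma dder_sum: "dder h f = (\<lambda>x. \<Sum>i\<in>UNIV. h $ i * partial i f x)"
  by (simp add: dder_def fun_eq_iff grad_def inner_vec_def mult.commute)

lemma dder_add: "dder (h + k) f x = dder h f x + dder k f x"
  by (simp add: dder_def inner_add_right)

lemma dder_scaleR: "dder (c *\<^sub>R h) f x = c * dder h f x"
  by (simp add: dder_def)

lemma has_real_derivative_line:
  assumes "\<And>x. f differentiable (at x)"
  shows "((\<lambda>t. f (y + t *\<^sub>R h)) has_real_derivative dder h f (y + t *\<^sub>R h)) (at t within S)"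
proof -
  have "((\<lambda>t. f (y + t *\<^sub>R h)) has_derivative (\<lambda>s. grad f (y + t *\<^sub>R h) \<bullet> (s *\<^sub>R h))) (at t within S)"
    by (rule has_derivative_compose[of "\<lambda>t. y + t *\<^sub>R h" _ _ _ f])
       (auto intro!: derivative_eq_intros has_derivative_grad assms)
  moreover have "(\<lambda>s. grad f (y + t *\<^sub>R h) \<bullet> (s *\<^sub>R h)) = (*) (dder h f (y + t *\<^sub>R h))"
    by (simp add: fun_eq_iff dder_def)
  ultimately show ?thesis by (simp add: has_field_derivative_def)
qed

text \<open>The strict inequality makes the region open, so near each of its points \<open>f\<close>
  coincides with the zero function.\<close>

lemma partial_outside_support:
  assumes "\<And>x. norm x > r \<Longrightarrow> f x = 0" "norm x > r"
  shows "partial i f x = 0"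
proof -
  have "(f has_derivative (\<lambda>h. 0)) (at x)"
  proof (rule has_derivative_transform_within_open[where f = "\<lambda>x. 0" and s = "{x. norm x > r}"])
    show "open {x :: real^'a. norm x > r}" by (intro open_Collect_less continuous_intros)
  qed (use assms in auto)
  from partial_eqI[OF this] show ?thesis by simp
qed

lemma Cc_infty_partial: "f \<in> Cc_infty \<Longrightarrow> partial i f \<in> Cc_infty"
  unfolding Cc_infty_iff using partial_outside_support
  by (metis Ck.simps(2))

lemma Cc_infty_zero: "(\<lambda>x. 0) \<in> Cc_infty"
  by (auto simp: Cc_infty_iff Ck_const)

lemma Cc_infty_add: "f \<in> Cc_infty \<Longrightarrow> g \<in> Cc_infty \<Longrightarrow> (\<lambda>x. f x + g x) \<in> Cc_infty"
proof -
  assume a: "f \<in> Cc_infty" "g \<in> Cc_infty"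
  obtain r s where "\<forall>x. norm x > r \<longrightarrow> f x = 0" "\<forall>x. norm x > s \<longrightarrow> g x = 0"
    using a unfolding Cc_infty_iff by blast
  then have "\<forall>x. norm x > max r s \<longrightarrow> f x + g x = 0" by auto
  then show ?thesis using a unfolding Cc_infty_iff by (blast intro: Ck_add)
qed

lemma Cc_infty_mult: "(\<And>k. Ck k g) \<Longrightarrow> f \<in> Cc_infty \<Longrightarrow> (\<lambda>x. g x * f x) \<in> Cc_infty"
  unfolding Cc_infty_iff by (metis Ck_mult mult_zero_right)

lemma Cc_infty_sum: "(\<And>i. i \<in> S \<Longrightarrow> f i \<in> Cc_infty) \<Longrightarrow> (\<lambda>x. \<Sum>i\<in>S. f i x) \<in> Cc_infty"
  by (induction S rule: infinite_finite_induct) (simp_all add: Cc_infty_zero Cc_infty_add)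

lemma Cc_infty_cmult: "f \<in> Cc_infty \<Longrightarrow> (\<lambda>x. c * f x) \<in> Cc_infty"
  by (rule Cc_infty_mult) (rule Ck_const)

lemma Cc_infty_dder: "f \<in> Cc_infty \<Longrightarrow> dder h f \<in> Cc_infty"
  unfolding dder_sum by (intro Cc_infty_sum Cc_infty_cmult Cc_infty_partial)

text \<open>One statement serves translations, wide cut-offs and narrow mollifiers.\<close>

lemma Cc_infty_affine:
  assumes "f \<in> Cc_infty" "c \<noteq> 0"
  shows "(\<lambda>x. f (a + c *\<^sub>R x)) \<in> Cc_infty"
proof -
  obtain r where r: "\<And>x. norm x \<ge> r \<Longrightarrow> f x = 0" using Cc_infty_supportE[OF assms(1)] by metis
  have "f (a + c *\<^sub>R x) = 0" if "norm x > (\<bar>r\<bar> + norm a) / \<bar>c\<bar>" for x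
  proof (rule r)
    have "\<bar>r\<bar> + norm a < \<bar>c\<bar> * norm x" using that assms(2) by (simp add: field_simps)
    moreover have "\<bar>c\<bar> * norm x \<le> norm (a + c *\<^sub>R x) + norm a"
      using norm_triangle_ineq4[of "a + c *\<^sub>R x" a] by simp
    ultimately show "r \<le> norm (a + c *\<^sub>R x)" by linarith
  qed
  then show ?thesis using assms(1) unfolding Cc_infty_iff by (blast intro: Ck_affine)
qed

lemma Cc_infty_bounded:
  assumes "f \<in> Cc_infty"
  obtains C where "C > 0" "\<And>x. \<bar>f x\<bar> \<le> C"
proof -
  obtain r where r: "r > 0" "\<And>x. norm x \<ge> r \<Longrightarrow> f x = 0" using Cc_infty_supportE[OF assms] by metis
  have "compact (f ` cball 0 r)"
    by (intro compact_continuous_image continuous_on_subset[OF Cc_infty_continuous[OF assms]]) auto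
  then obtain C where C: "\<forall>x\<in>cball 0 r. \<bar>f x\<bar> \<le> C"
    using compact_imp_bounded by (fastforce simp: bounded_iff)
  have "\<bar>f x\<bar> \<le> max C 1" for x
    using C r(2)[of x] by (cases "norm x \<le> r") force+
  then show ?thesis by (intro that[of "max C 1"]) auto
qed

lemma dder_affine:
  assumes "\<And>x. f differentiable (at x)"
  shows "dder h (\<lambda>x. f (a + c *\<^sub>R x)) x = c * dder h f (a + c *\<^sub>R x)"
  by (simp add: dder_sum partial_affine[OF assms] sum_distrib_left mult_ac)

lemma dder_cmult:
  assumes "\<And>x. f differentiable (at x)"
  shows "dder h (\<lambda>x. c * f x) x = c * dder h f x"
  by (simp add: dder_sum partial_cmult[OF assms] sum_distrib_left mult_ac)

lemma dder_dder:
  assumes "f \<in> Cc_infty"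
  shows "dder h (dder h' f) x = (\<Sum>i\<in>UNIV. \<Sum>j\<in>UNIV. h $ i * h' $ j * hessian f x $ i $ j)"
proof -
  have d: "partial j f differentiable at x" for j x
    by (intro Cc_infty_differentiable Cc_infty_partial assms)
  have d': "(\<lambda>x. c * partial j f x) differentiable at x" for c j x
    by (intro Cc_infty_differentiable Cc_infty_cmult Cc_infty_partial assms)
  show ?thesis
    unfolding dder_sum partial_sum[OF d'] partial_cmult[OF d]
    by (simp add: hessian_def sum_distrib_left mult_ac)
qed

text \<open>Writing \<open>Q\<close> as a sum of rank-one matrices turns the second-order term into
  second derivatives along the fixed directions \<open>B *v w k\<close>. From here on calculus along
  lines suffices, both for integration by parts and for the sign at a maximum.\<close>

lemma trace_hessian_eq:
  fixes B :: "real^'d^'n" and w :: "'d \<Rightarrow> real^'d"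
  assumes f: "f \<in> Cc_infty" and Q: "\<And>i j. Q $ i $ j = (\<Sum>k\<in>UNIV. w k $ i * w k $ j)"
  shows "trace (B ** Q ** transpose B ** hessian f x) = (\<Sum>k\<in>UNIV. dder (B *v w k) (dder (B *v w k) f) x)"
proof -
  have S: "(B ** Q ** transpose B) $ i $ j = (\<Sum>k\<in>UNIV. (B *v w k) $ i * (B *v w k) $ j)" for i j
  proof -
    have "(B ** Q ** transpose B) $ i $ j = (\<Sum>b\<in>UNIV. \<Sum>a\<in>UNIV. \<Sum>k\<in>UNIV. B $ i $ a * (w k $ a * w k $ b) * B $ j $ b)"
      by (simp add: matrix_matrix_mult_def transpose_def Q sum_distrib_left sum_distrib_right)
    also have "\<dots> = (\<Sum>b\<in>UNIV. \<Sum>k\<in>UNIV. \<Sum>a\<in>UNIV. B $ i $ a * (w k $ a * w k $ b) * B $ j $ b)"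
      by (intro sum.cong sum.swap refl)
    also have "\<dots> = (\<Sum>k\<in>UNIV. \<Sum>b\<in>UNIV. \<Sum>a\<in>UNIV. B $ i $ a * (w k $ a * w k $ b) * B $ j $ b)"
      by (rule sum.swap)
    also have "\<dots> = (\<Sum>k\<in>UNIV. (B *v w k) $ i * (B *v w k) $ j)"
      by (simp add: matrix_vector_mult_def sum_product sum_distrib_left sum_distrib_right mult_ac)
    finally show ?thesis .
  qed
  have "trace (B ** Q ** transpose B ** hessian f x) = (\<Sum>i\<in>UNIV. \<Sum>j\<in>UNIV. (B ** Q ** transpose B) $ i $ j * hessian f x $ j $ i)"
    by (simp add: trace_def matrix_matrix_mult_def[of "B ** Q ** transpose B"])
  also have "\<dots> = (\<Sum>j\<in>UNIV. \<Sum>i\<in>UNIV. \<Sum>k\<in>UNIV. (B *v w k) $ j * (B *v w k) $ i * hessian f x $ j $ i)"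
    by (subst sum.swap) (simp add: S sum_distrib_left mult_ac)
  also have "\<dots> = (\<Sum>j\<in>UNIV. \<Sum>k\<in>UNIV. \<Sum>i\<in>UNIV. (B *v w k) $ j * (B *v w k) $ i * hessian f x $ j $ i)"
    by (intro sum.cong sum.swap refl)
  also have "\<dots> = (\<Sum>k\<in>UNIV. \<Sum>j\<in>UNIV. \<Sum>i\<in>UNIV. (B *v w k) $ j * (B *v w k) $ i * hessian f x $ j $ i)"
    by (rule sum.swap)
  finally show ?thesis by (simp add: dder_dder[OF f])
qed

section \<open>A smooth bump function\<close>

definition flat :: "real poly \<Rightarrow> real \<Rightarrow> real" where
  "flat p t = (if t > 0 then poly p (1 / t) * exp (- (1 / t)) else 0)"

lemma poly_times_exp_tendsto_0: "((\<lambda>x::real. poly p x * exp (- x)) \<longlongrightarrow> 0) at_top"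
proof -
  have "((\<lambda>x. \<Sum>i\<le>degree p. coeff p i * (x ^ i / exp x)) \<longlongrightarrow> (\<Sum>i\<le>degree p. coeff p i * 0)) at_top"
    by (intro tendsto_intros tendsto_power_div_exp_0)
  then show ?thesis
    by (simp add: poly_altdef sum_distrib_right exp_minus divide_inverse mult.assoc)
qed

text \<open>The polynomial parameter makes the family closed under differentiation. In the variable
  \<open>x = 1 / t\<close> the time derivative is minus \<open>x^2\<close> times the derivative in
  \<open>x\<close>, which sends \<open>p(x) exp(-x)\<close> to
  \<open>x^2 (p - p')(x) exp(-x)\<close>. At 0 the right difference quotient is
  \<open>x p(x) exp(-x)\<close> with \<open>x\<close> tending to infinity.\<close>

lemma flat_has_derivative: "(flat p has_real_derivative flat ([:0, 0, 1:] * (p - pderiv p)) t) (at t)"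
proof -
  consider "t > 0" | "t < 0" | "t = 0" by linarith
  then show ?thesis
  proof cases
    case 1
    have "((\<lambda>t. poly p (1 / t) * exp (- (1 / t))) has_real_derivative flat ([:0, 0, 1:] * (p - pderiv p)) t) (at t)"
      using 1 by (auto intro!: derivative_eq_intros poly_DERIV[THEN DERIV_chain2] simp: flat_def field_simps power2_eq_square)
    then show ?thesis
      by (rule has_field_derivative_transform_within_open[where S = "{0<..}"]) (use 1 in \<open>auto simp: flat_def\<close>)
  next
    case 2
    have "((\<lambda>t. 0) has_real_derivative flat ([:0, 0, 1:] * (p - pderiv p)) t) (at t)"
      using 2 by (simp add: flat_def)
    then show ?thesis
      by (rule has_field_derivative_transform_within_open[where S = "{..<0}"]) (use 2 in \<open>auto simp: flat_def\<close>)
  next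
    case 3
    have R: "((\<lambda>h. flat p h / h) \<longlongrightarrow> 0) (at_right 0)"
    proof (rule Lim_transform_eventually)
      show "((\<lambda>h. poly ([:0, 1:] * p) (inverse h) * exp (- inverse h)) \<longlongrightarrow> 0) (at_right 0)"
        by (rule filterlim_compose[OF poly_times_exp_tendsto_0 filterlim_inverse_at_top_right])
      show "\<forall>\<^sub>F h in at_right 0. poly ([:0, 1:] * p) (inverse h) * exp (- inverse h) = flat p h / h"
        using eventually_at_right_less[of 0] by eventually_elim (auto simp: flat_def divide_inverse)
    qed
    have L: "((\<lambda>h. flat p h / h) \<longlongrightarrow> 0) (at_left 0)"
    proof (rule Lim_transform_eventually[OF tendsto_const])
      show "\<forall>\<^sub>F h in at_left 0. 0 = flat p h / h"
        by (auto simp: flat_def eventually_at_filter)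
    qed
    have "((\<lambda>h. flat p h / h) \<longlongrightarrow> 0) (at 0)" using L R by (simp add: filterlim_split_at)
    then show ?thesis using 3 by (simp add: DERIV_def flat_def)
  qed
qed

text \<open>The chain rule leaves the family: a coordinate times a member for another polynomial,
  hence the induction over all \<open>p\<close>. Using \<open>x \<bullet> x\<close> instead of the
  norm keeps the inner function smooth at the origin.\<close>

lemma Ck_flat: "Ck k (\<lambda>x :: real^'n. flat p (1 - x \<bullet> x))"
proof (induction k arbitrary: p)
  case 0
  have "continuous_on UNIV (flat p)"
    using flat_has_derivative by (intro continuous_at_imp_continuous_on ballI) (blast intro: DERIV_isCont)
  show ?case unfolding Ck.simps
    by (rule continuous_on_compose2[OF \<open>continuous_on UNIV (flat p)\<close>]) (auto intro!: continuous_intros)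
next
  case (Suc k)
  define q where "q = [:0, 0, 1:] * (p - pderiv p)"
  have D: "((\<lambda>x. flat p (1 - x \<bullet> x)) has_derivative (\<lambda>h. (- 2 * (x \<bullet> h)) * flat q (1 - x \<bullet> x))) (at x)" for x :: "real^'n"
  proof -
    have "((\<lambda>x. flat p (1 - x \<bullet> x)) has_derivative (\<lambda>h. (- (x \<bullet> h + h \<bullet> x)) * flat q (1 - x \<bullet> x))) (at x)"
      using flat_has_derivative[of p "1 - x \<bullet> x"]
      by (intro has_derivative_eq_rhs[OF has_derivative_compose[where f = "\<lambda>x. 1 - x \<bullet> x" and g = "flat p"
            and g' = "(*) (flat q (1 - x \<bullet> x))" and f' = "\<lambda>h. - (x \<bullet> h + h \<bullet> x)"]])
         (auto intro!: derivative_eq_intros simp: has_field_derivative_def q_def mult.commute)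
    then show ?thesis by (simp add: inner_commute algebra_simps)
  qed
  have "partial i (\<lambda>x. flat p (1 - x \<bullet> x)) = (\<lambda>x. (- 2 * x $ i) * flat q (1 - x \<bullet> x))" for i :: 'n
    by (rule ext) (simp add: partial_eqI[OF D] inner_axis)
  moreover have "Ck k (\<lambda>x :: real^'n. (- 2 * x $ i) * flat q (1 - x \<bullet> x))" for i
    by (intro Ck_mult Ck_const Ck_component Suc.IH)
  moreover have "(\<lambda>x :: real^'n. flat p (1 - x \<bullet> x)) differentiable (at x)" for x
    using D by (auto simp: differentiable_def)
  ultimately show ?case by simp
qed

lemma bump_function:
  obtains \<rho> :: "real^'n \<Rightarrow> real"
  where "\<rho> \<in> Cc_infty" "\<And>x. 0 \<le> \<rho> x" "\<And>x. \<rho> x \<le> 1" "\<rho> 0 = 1" "\<And>x. norm x \<ge> 1 \<Longrightarrow> \<rho> x = 0"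
proof
  \<comment> \<open>At the origin \<open>flat 1 1 = exp (-1)\<close>, so the factor
    \<open>exp 1\<close> normalises the peak to 1; elsewhere in the ball
    \<open>1 / (1 - x \<bullet> x)\<close> is at least 1 and the value stays below.\<close>
  define \<rho> :: "real^'n \<Rightarrow> real" where "\<rho> x = exp 1 * flat 1 (1 - x \<bullet> x)" for x
  show z: "\<rho> x = 0" if "norm x \<ge> 1" for x
  proof -
    have "x \<bullet> x \<ge> 1" using that by (simp add: dot_square_norm)
    then show ?thesis by (simp add: \<rho>_def flat_def)
  qed
  have "(\<lambda>x :: real^'n. exp 1 * flat 1 (1 - x \<bullet> x)) \<in> Cc_infty"
    unfolding Cc_infty_iff using z
    by (auto intro!: Ck_mult Ck_const Ck_flat exI[of _ 1] simp: \<rho>_def)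
  then show "\<rho> \<in> Cc_infty" unfolding \<rho>_def[abs_def] .
  show "0 \<le> \<rho> x" for x by (simp add: \<rho>_def flat_def)
  show "\<rho> 0 = 1" by (simp add: \<rho>_def flat_def flip: exp_add)
  show "\<rho> x \<le> 1" for x
  proof (cases "x \<bullet> x < 1")
    case True
    then have "1 \<le> 1 / (1 - x \<bullet> x)" by (simp add: field_simps)
    with True show ?thesis by (simp add: \<rho>_def flat_def flip: exp_add)
  qed (simp add: \<rho>_def flat_def)
qed

section \<open>Integration by parts\<close>

text \<open>Differentiation under the integral sign, with values in a Banach space so that real test
  functions may multiply complex waves. The mean value inequality makes each path Lipschitz with
  constant \<open>w x\<close> near \<open>t0\<close>; the normalised remainder is then dominated by
  \<open>2 * w\<close>, one \<open>w\<close> for the difference quotient and one for the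
  derivative.\<close>

lemma has_vector_derivative_lebesgue_integral:
  fixes f :: "real \<Rightarrow> 'a \<Rightarrow> 'b::{banach, second_countable_topology}"
  assumes \<delta>: "\<delta> > 0"
    and int: "\<And>t. \<bar>t - t0\<bar> < \<delta> \<Longrightarrow> integrable M (f t)"
    and der: "\<And>x t. \<bar>t - t0\<bar> < \<delta> \<Longrightarrow> ((\<lambda>t. f t x) has_vector_derivative f' t x) (at t)"
    and bnd: "\<And>x t. \<bar>t - t0\<bar> < \<delta> \<Longrightarrow> norm (f' t x) \<le> w x"
    and w: "integrable M w" and meas: "f' t0 \<in> borel_measurable M"
  shows "((\<lambda>t. \<integral>x. f t x \<partial>M) has_vector_derivative (\<integral>x. f' t0 x \<partial>M)) (at t0)"
    and "integrable M (f' t0)"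
proof -
  show int': "integrable M (f' t0)"
  proof (rule Bochner_Integration.integrable_bound[OF w meas], rule AE_I2)
    show "norm (f' t0 x) \<le> norm (w x)" for x
      using bnd[of t0 x] \<delta> by simp
  qed
  have lip: "norm (f t x - f t0 x) \<le> w x * \<bar>t - t0\<bar>" if t: "\<bar>t - t0\<bar> < \<delta>" for t x
  proof -
    have "norm (f t x - f t0 x) \<le> w x * norm (t - t0)"
    proof (rule differentiable_bound[where S = "ball t0 \<delta>" and f' = "\<lambda>t s. s *\<^sub>R f' t x"])
      show "((\<lambda>t. f t x) has_derivative (\<lambda>s. s *\<^sub>R f' u x)) (at u within ball t0 \<delta>)" if "u \<in> ball t0 \<delta>" for u
      proof -
        have "\<bar>u - t0\<bar> < \<delta>" using that by (simp add: dist_real_def abs_minus_commute)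
        from der[OF this, of x] show ?thesis
          unfolding has_vector_derivative_def by (rule has_derivative_at_withinI)
      qed
      show "onorm (\<lambda>s. s *\<^sub>R f' u x) \<le> w x" if "u \<in> ball t0 \<delta>" for u
      proof (rule onorm_bound)
        have "\<bar>u - t0\<bar> < \<delta>" using that by (simp add: dist_real_def abs_minus_commute)
        from bnd[OF this, of x] have b: "norm (f' u x) \<le> w x" .
        then show "0 \<le> w x" using norm_ge_zero order_trans by blast
        show "norm (s *\<^sub>R f' u x) \<le> w x * norm s" for s
          using mult_left_mono[OF b, of "norm s"] by (simp add: mult.commute)
      qed
    qed (use t \<delta> in \<open>auto simp: dist_real_def abs_minus_commute\<close>)
    then show ?thesis by simp
  qed
  have "((\<lambda>t. ((\<integral>x. f t x \<partial>M) - ((\<integral>x. f t0 x \<partial>M) + (t - t0) *\<^sub>R (\<integral>x. f' t0 x \<partial>M))) /\<^sub>R norm (t - t0)) \<longlongrightarrow> 0) (at t0)"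
    unfolding tendsto_at_iff_sequentially
  proof (intro allI impI)
    fix X :: "nat \<Rightarrow> real"
    assume X: "\<forall>i. X i \<in> UNIV - {t0}" "X \<longlonglongrightarrow> t0"
    obtain N where N: "\<And>n. n \<ge> N \<Longrightarrow> \<bar>X n - t0\<bar> < \<delta>"
      using X(2) \<delta> unfolding lim_sequentially dist_real_def by blast
    define Y where "Y n = X (n + N)" for n
    have Y: "\<bar>Y n - t0\<bar> < \<delta>" "Y n \<noteq> t0" for n using N X(1) by (auto simp: Y_def)
    have Y0: "Y \<longlonglongrightarrow> t0" unfolding Y_def using X(2) by (rule LIMSEQ_ignore_initial_segment)
    define g where "g n x = (f (Y n) x - (f t0 x + (Y n - t0) *\<^sub>R f' t0 x)) /\<^sub>R norm (Y n - t0)" for n x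
    have it: "integrable M (f t0)" using int[of t0] \<delta> by simp
    have "(\<lambda>n. \<integral>x. g n x \<partial>M) \<longlonglongrightarrow> (\<integral>x. 0 \<partial>M)"
    proof (rule integral_dominated_convergence)
      show "integrable M (\<lambda>x. 2 * w x)" using w by simp
      show "g n \<in> borel_measurable M" for n
        using int[OF Y(1)] it int' unfolding g_def by (intro borel_measurable_scaleR borel_measurable_diff borel_measurable_add) auto
      show "AE x in M. (\<lambda>n. g n x) \<longlonglongrightarrow> 0"
      proof (rule AE_I2)
        fix x
        have "((\<lambda>t. (f t x - (f t0 x + (t - t0) *\<^sub>R f' t0 x)) /\<^sub>R norm (t - t0)) \<longlongrightarrow> 0) (at t0)"
          using der[of t0 x] \<delta> unfolding has_vector_derivative_def has_derivative_within by (simp add: divide_inverse)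
        then show "(\<lambda>n. g n x) \<longlonglongrightarrow> 0"
          unfolding tendsto_at_iff_sequentially g_def using Y(2) Y0 by (auto simp: o_def)
      qed
      show "AE x in M. norm (g n x) \<le> 2 * w x" for n
      proof (rule AE_I2)
        fix x
        have p: "\<bar>Y n - t0\<bar> > 0" using Y(2)[of n] by simp
        have "norm (f (Y n) x - (f t0 x + (Y n - t0) *\<^sub>R f' t0 x)) \<le> norm (f (Y n) x - f t0 x) + \<bar>Y n - t0\<bar> * norm (f' t0 x)"
          by (metis diff_diff_eq norm_scaleR norm_triangle_ineq4)
        also have "\<dots> \<le> w x * \<bar>Y n - t0\<bar> + \<bar>Y n - t0\<bar> * w x"
          by (intro add_mono lip Y mult_left_mono bnd) (use \<delta> in auto)
        finally have "norm (f (Y n) x - (f t0 x + (Y n - t0) *\<^sub>R f' t0 x)) \<le> 2 * w x * \<bar>Y n - t0\<bar>"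
          by (simp add: mult_ac)
        then have "norm (f (Y n) x - (f t0 x + (Y n - t0) *\<^sub>R f' t0 x)) / \<bar>Y n - t0\<bar> \<le> 2 * w x"
          by (subst pos_divide_le_eq[OF p])
        then show "norm (g n x) \<le> 2 * w x"
          by (simp add: g_def divide_inverse mult.commute)
      qed
    qed simp
    moreover have "(\<integral>x. g n x \<partial>M) = ((\<integral>x. f (Y n) x \<partial>M) - ((\<integral>x. f t0 x \<partial>M) + (Y n - t0) *\<^sub>R (\<integral>x. f' t0 x \<partial>M))) /\<^sub>R norm (Y n - t0)" for n
      using int[OF Y(1)] it int' unfolding g_def by simp
    ultimately have "(\<lambda>n. ((\<integral>x. f (Y n) x \<partial>M) - ((\<integral>x. f t0 x \<partial>M) + (Y n - t0) *\<^sub>R (\<integral>x. f' t0 x \<partial>M))) /\<^sub>R norm (Y n - t0)) \<longlonglongrightarrow> 0"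
      by simp
    then show "((\<lambda>t. ((\<integral>x. f t x \<partial>M) - ((\<integral>x. f t0 x \<partial>M) + (t - t0) *\<^sub>R (\<integral>x. f' t0 x \<partial>M))) /\<^sub>R norm (t - t0)) \<circ> X) \<longlonglongrightarrow> 0"
      unfolding Y_def o_def by (rule LIMSEQ_offset)
  qed
  then show "((\<lambda>t. \<integral>x. f t x \<partial>M) has_vector_derivative (\<integral>x. f' t0 x \<partial>M)) (at t0)"
    unfolding has_vector_derivative_def has_derivative_within
    by (simp add: bounded_linear_scaleR_left divide_inverse)
qed

section \<open>Translation, scaling and integration by parts for Lebesgue integrals\<close>

lemma lborel_translate:
  fixes f :: "'a::euclidean_space \<Rightarrow> 'b::{banach, second_countable_topology}"
  assumes [measurable]: "f \<in> borel_measurable borel"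
  shows "(\<integral>x. f (x + a) \<partial>lborel) = (\<integral>x. f x \<partial>lborel)"
    and "integrable lborel (\<lambda>x. f (x + a)) \<longleftrightarrow> integrable lborel f"
proof -
  have "(\<integral>x. f x \<partial>lborel) = (\<integral>x. f x \<partial>distr lborel borel ((+) a))" by (simp only: lborel_distr_plus)
  also have "\<dots> = (\<integral>x. f (a + x) \<partial>lborel)" by (rule integral_distr) auto
  finally show "(\<integral>x. f (x + a) \<partial>lborel) = (\<integral>x. f x \<partial>lborel)" by (simp add: add.commute)
  have "integrable lborel f \<longleftrightarrow> integrable (distr lborel borel ((+) a)) f" by (simp only: lborel_distr_plus)
  also have "\<dots> \<longleftrightarrow> integrable lborel (\<lambda>x. f (a + x))" by (rule integrable_distr_eq) auto
  finally show "integrable lborel (\<lambda>x. f (x + a)) \<longleftrightarrow> integrable lborel f" by (simp add: add.commute)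
qed

lemma lborel_rescale:
  fixes f :: "'a::euclidean_space \<Rightarrow> 'b::{banach, second_countable_topology}"
  assumes [measurable]: "f \<in> borel_measurable borel" and c: "c > 0"
  shows "(\<integral>x. f x \<partial>lborel) = c ^ DIM('a) *\<^sub>R (\<integral>x. f (a + c *\<^sub>R x) \<partial>lborel)"
proof -
  have "(\<integral>x. f x \<partial>lborel) = (\<integral>x. f x \<partial>density (distr lborel borel (\<lambda>x. a + c *\<^sub>R x)) (\<lambda>_. ennreal (c ^ DIM('a))))"
    using c by (subst lborel_affine[of c a]) (auto simp: ennreal_power)
  also have "\<dots> = (\<integral>x. c ^ DIM('a) *\<^sub>R f x \<partial>distr lborel borel (\<lambda>x. a + c *\<^sub>R x))"
    using c by (intro integral_density) auto
  also have "\<dots> = (\<integral>x. c ^ DIM('a) *\<^sub>R f (a + c *\<^sub>R x) \<partial>lborel)"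
    by (rule integral_distr) auto
  finally show ?thesis by simp
qed

lemma integrable_bounded_support:
  fixes f :: "'a::euclidean_space \<Rightarrow> 'b::{banach, second_countable_topology}"
  assumes "f \<in> borel_measurable borel" "\<And>x. norm (f x) \<le> C" "\<And>x. norm x > r \<Longrightarrow> f x = 0"
  shows "integrable lborel f"
proof (rule Bochner_Integration.integrable_bound)
  have "emeasure lborel (cball (0 :: 'a) r) < \<infinity>"
    by (rule emeasure_bounded_finite) simp
  then show "integrable lborel (\<lambda>x. C * indicator (cball (0 :: 'a) r) x)"
    by (intro integrable_mult_right integrable_real_indicator) auto
  have "C \<ge> 0" using assms(2) norm_ge_zero order_trans by blast
  then show "AE x in lborel. norm (f x) \<le> norm (C * indicator (cball 0 r) x)"
    using assms(2,3) by (intro AE_I2) (auto split: split_indicator)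
qed (use assms in auto)

lemma integrable_Cc_infty_scaleR:
  fixes W :: "real^'n \<Rightarrow> 'b::{banach, second_countable_topology}"
  assumes f: "f \<in> Cc_infty" and W: "W \<in> borel_measurable borel" "\<And>x. norm (W x) \<le> K"
  shows "integrable lborel (\<lambda>x. f x *\<^sub>R W x)"
proof -
  obtain C where C: "C > 0" "\<And>x. \<bar>f x\<bar> \<le> C" using Cc_infty_bounded[OF f] by metis
  obtain r where r: "r > 0" "\<And>x. norm x \<ge> r \<Longrightarrow> f x = 0" using Cc_infty_supportE[OF f] by metis
  show ?thesis
  proof (rule integrable_bounded_support)
    show "(\<lambda>x. f x *\<^sub>R W x) \<in> borel_measurable borel"
      using f W(1) by (intro borel_measurable_scaleR Cc_infty_borel)
    show "norm (f x *\<^sub>R W x) \<le> C * K" for x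
      using C W(2) by (auto intro!: mult_mono)
    show "f x *\<^sub>R W x = 0" if "norm x > r" for x using that r(2) by auto
  qed
qed

lemma integrable_Cc_infty: "f \<in> Cc_infty \<Longrightarrow> integrable lborel f"
  using integrable_Cc_infty_scaleR[of f "\<lambda>x. 1 :: real" 1] by simp

text \<open>The translation sits on the smooth factor, so nothing beyond boundedness and
  measurability is asked of \<open>W\<close>.\<close>

lemma translate_has_vector_derivative:
  fixes W :: "real^'n \<Rightarrow> 'b::{banach, second_countable_topology}"
  assumes f: "f \<in> Cc_infty" and W: "W \<in> borel_measurable borel" "\<And>x. norm (W x) \<le> K"
  shows "((\<lambda>t. \<integral>y. f (y - t *\<^sub>R h) *\<^sub>R W y \<partial>lborel) has_vector_derivative
           - (\<integral>y. dder h f (y - t *\<^sub>R h) *\<^sub>R W y \<partial>lborel)) (at t)"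
proof -
  note df = Cc_infty_dder[OF f, of h]
  obtain C where C: "C > 0" "\<And>x. \<bar>dder h f x\<bar> \<le> C" using Cc_infty_bounded[OF df] by metis
  obtain r where r: "r > 0" "\<And>x. norm x \<ge> r \<Longrightarrow> dder h f x = 0" using Cc_infty_supportE[OF df] by metis
  have K: "K \<ge> 0" using W(2) norm_ge_zero order_trans by blast
  have tr: "(\<lambda>y. g (y - s)) \<in> Cc_infty" if "g \<in> Cc_infty" for g :: "real^'n \<Rightarrow> real" and s
    using Cc_infty_affine[OF that, of 1 "- s"] by simp
  \<comment> \<open>For \<open>\<bar>s - t\<bar> < 1\<close> all translates of the support lie in
    the ball of radius \<open>R\<close>, which gives one integrable majorant.\<close>
  define R where "R = r + (\<bar>t\<bar> + 1) * norm h"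
  have "((\<lambda>t. \<integral>y. f (y - t *\<^sub>R h) *\<^sub>R W y \<partial>lborel) has_vector_derivative
           (\<integral>y. (- dder h f (y - t *\<^sub>R h)) *\<^sub>R W y \<partial>lborel)) (at t)"
  proof (rule has_vector_derivative_lebesgue_integral(1)[where \<delta> = 1 and w = "\<lambda>y. C * K * indicator (cball 0 R) y"])
    show "integrable lborel (\<lambda>y. f (y - s *\<^sub>R h) *\<^sub>R W y)" for s
      by (rule integrable_Cc_infty_scaleR[OF tr[OF f] W])
    show "((\<lambda>t. f (y - t *\<^sub>R h) *\<^sub>R W y) has_vector_derivative (- dder h f (y - s *\<^sub>R h)) *\<^sub>R W y) (at s)" for y s
    proof -
      have "((\<lambda>t. f (y + t *\<^sub>R (- h))) has_real_derivative dder (- h) f (y + s *\<^sub>R (- h))) (at s)"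
        by (rule has_real_derivative_line[OF Cc_infty_differentiable[OF f]])
      moreover have "dder (- h) f x = - dder h f x" for x by (simp add: dder_def)
      ultimately have "((\<lambda>t. f (y - t *\<^sub>R h)) has_real_derivative - dder h f (y - s *\<^sub>R h)) (at s)"
        by simp
      from has_vector_derivative_scaleR[OF this has_vector_derivative_const[of "W y"]]
      show ?thesis by simp
    qed
    show "norm ((- dder h f (y - s *\<^sub>R h)) *\<^sub>R W y) \<le> C * K * indicator (cball 0 R) y" if "\<bar>s - t\<bar> < 1" for y s
    proof (cases "norm y \<le> R")
      case True
      then show ?thesis using C(2)[of "y - s *\<^sub>R h"] W(2)[of y] C(1) K by (auto intro!: mult_mono)
    next
      case False
      have "\<bar>s\<bar> * norm h \<le> (\<bar>t\<bar> + 1) * norm h" using that by (intro mult_right_mono) auto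
      then have "norm (y - s *\<^sub>R h) \<ge> r"
        using False norm_triangle_ineq2[of y "s *\<^sub>R h"] by (simp add: R_def)
      then show ?thesis using r(2) K C(1) by simp
    qed
    have "emeasure lborel (cball (0 :: real^'n) R) < \<infinity>"
      by (rule emeasure_bounded_finite) simp
    then show "integrable lborel (\<lambda>y. C * K * indicator (cball (0 :: real^'n) R) y)"
      by (intro integrable_mult_right integrable_real_indicator) auto
    show "(\<lambda>y. (- dder h f (y - t *\<^sub>R h)) *\<^sub>R W y) \<in> borel_measurable lborel"
      using Cc_infty_borel[OF tr[OF df, of "t *\<^sub>R h"]] W(1) by measurable
  qed simp
  then show ?thesis by simp
qed

text \<open>By translation invariance the function of \<open>t\<close> that integrates
  \<open>W\<close> against the translate of \<open>f\<close> by \<open>t *\<^sub>R h\<close> can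
  also be written with the shift on \<open>W\<close>. Computing its derivative at 0 in both forms
  gives the formula, with no boundary terms.\<close>

lemma integral_dder_by_parts:
  fixes W :: "real^'n \<Rightarrow> 'b::{banach, second_countable_topology}"
  assumes f: "f \<in> Cc_infty" and W: "W \<in> borel_measurable borel" "\<And>x. norm (W x) \<le> K"
    and W': "W' \<in> borel_measurable borel" "\<And>x. norm (W' x) \<le> K'"
    and der: "\<And>y t. ((\<lambda>t. W (y + t *\<^sub>R h)) has_vector_derivative W' (y + t *\<^sub>R h)) (at t)"
  shows "(\<integral>y. dder h f y *\<^sub>R W y \<partial>lborel) = - (\<integral>y. f y *\<^sub>R W' y \<partial>lborel)"
proof -
  note [measurable] = W(1) W'(1) Cc_infty_borel[OF f]
  have "((\<lambda>t. \<integral>y. f (y - t *\<^sub>R h) *\<^sub>R W y \<partial>lborel) has_vector_derivative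
           - (\<integral>y. dder h f y *\<^sub>R W y \<partial>lborel)) (at 0)"
    using translate_has_vector_derivative[OF f W, where h = h and t = 0] unfolding scaleR_zero_left diff_zero .
  moreover have "(\<integral>y. f (y - t *\<^sub>R h) *\<^sub>R W y \<partial>lborel) = (\<integral>y. f y *\<^sub>R W (y + t *\<^sub>R h) \<partial>lborel)" for t
    using lborel_translate(1)[of "\<lambda>y. f (y - t *\<^sub>R h) *\<^sub>R W y" "t *\<^sub>R h"] by simp
  moreover have "((\<lambda>t. \<integral>y. f y *\<^sub>R W (y + t *\<^sub>R h) \<partial>lborel) has_vector_derivative
           (\<integral>y. f y *\<^sub>R W' (y + 0 *\<^sub>R h) \<partial>lborel)) (at 0)"
  proof (rule has_vector_derivative_lebesgue_integral(1)[where \<delta> = 1 and w = "\<lambda>y. \<bar>f y\<bar> * K'"])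
    show "integrable lborel (\<lambda>y. f y *\<^sub>R W (y + s *\<^sub>R h))" for s
      by (rule integrable_Cc_infty_scaleR[OF f _ W(2)]) simp
    show "((\<lambda>t. f y *\<^sub>R W (y + t *\<^sub>R h)) has_vector_derivative f y *\<^sub>R W' (y + s *\<^sub>R h)) (at s)" for y s
      using has_vector_derivative_scaleR[OF DERIV_const[of "f y" "at s"] der[of y s]] by simp
    show "norm (f y *\<^sub>R W' (y + s *\<^sub>R h)) \<le> \<bar>f y\<bar> * K'" for y s
      using W'(2) by (auto intro!: mult_left_mono)
    show "integrable lborel (\<lambda>y. \<bar>f y\<bar> * K')"
      using integrable_Cc_infty[OF f] by auto
  qed auto
  ultimately have "- (\<integral>y. dder h f y *\<^sub>R W y \<partial>lborel) = (\<integral>y. f y *\<^sub>R W' y \<partial>lborel)"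
    by (simp add: vector_derivative_unique_at)
  then show ?thesis by (metis minus_minus)
qed

text \<open>The divergence of the vector field \<open>y \<mapsto> f y *\<^sub>R A y\<close>.\<close>

definition drift_div :: "real^'n^'n \<Rightarrow> (real^'n \<Rightarrow> real) \<Rightarrow> real^'n \<Rightarrow> real" where
  "drift_div A f y = dder (A *v y) f y + trace A * f y"

text \<open>Expanding \<open>A *v y\<close> in the columns of \<open>A\<close> replaces a field with
  linear coefficients by constant directions; the coefficients \<open>y $ j\<close> are absorbed
  into the test function, which stays a test function.\<close>

lemma drift_div_eq:
  fixes A :: "real^'n^'n"
  assumes f: "f \<in> Cc_infty"
  shows "drift_div A f = (\<lambda>y. \<Sum>j\<in>UNIV. dder (column j A) (\<lambda>y. y $ j * f y) y)"
proof
  fix y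
  have d: "(\<lambda>y :: real^'n. y $ j) differentiable at y" for j
    using Ck_component[of "Suc 0" j] by simp
  have p: "partial i (\<lambda>y :: real^'n. y $ j) y = (if i = j then 1 else 0)" for i j
    using partial_eqI[OF bounded_linear_imp_has_derivative[OF bounded_linear_vec_nth[of j]], where x = y and i = i]
    by (simp add: axis_def)
  have m: "partial i (\<lambda>y. y $ j * f y) y = y $ j * partial i f y + (if i = j then f y else 0)" for i j
    by (simp add: partial_mult[OF d Cc_infty_differentiable[OF f]] p)
  have "dder (column j A) (\<lambda>y. y $ j * f y) y = y $ j * dder (column j A) f y + A $ j $ j * f y" for j
    unfolding dder_sum m
    by (simp add: distrib_left sum.distrib if_distrib[of "\<lambda>x. _ * x"] column_def cong: if_cong)
       (simp add: sum_distrib_left mult_ac)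
  moreover have "A *v y = (\<Sum>j\<in>UNIV. y $ j *\<^sub>R column j A)"
    by (simp add: matrix_mult_sum scalar_mult_eq_scaleR)
  ultimately show "drift_div A f y = (\<Sum>j\<in>UNIV. dder (column j A) (\<lambda>y. y $ j * f y) y)"
    by (simp add: drift_div_def trace_def sum.distrib sum_distrib_right dder_def inner_sum_right)
qed

lemma Cc_infty_drift_div: "f \<in> Cc_infty \<Longrightarrow> drift_div A f \<in> Cc_infty"
  unfolding drift_div_eq by (intro Cc_infty_sum Cc_infty_dder Cc_infty_mult Ck_component)

text \<open>\<open>DW h\<close> is the derivative of \<open>W\<close> along \<open>h\<close>. Its
  linearity in \<open>h\<close> reassembles the columns into \<open>A *v y\<close>, and its bound
  may depend on \<open>h\<close> because only the finitely many columns are used as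
  directions.\<close>

lemma integral_drift_div_by_parts:
  fixes W :: "real^'n \<Rightarrow> 'b::{banach, second_countable_topology}"
  assumes f: "f \<in> Cc_infty" and W: "W \<in> borel_measurable borel" "\<And>x. norm (W x) \<le> K"
    and DW: "\<And>h. DW h \<in> borel_measurable borel" "\<And>h x. norm (DW h x) \<le> K' h" "\<And>x. linear (\<lambda>h. DW h x)"
    and der: "\<And>y t h. ((\<lambda>t. W (y + t *\<^sub>R h)) has_vector_derivative DW h (y + t *\<^sub>R h)) (at t)"
  shows "(\<integral>y. drift_div A f y *\<^sub>R W y \<partial>lborel) = - (\<integral>y. f y *\<^sub>R DW (A *v y) y \<partial>lborel)"
proof -
  have c: "(\<lambda>y. y $ j * f y) \<in> Cc_infty" for j by (intro Cc_infty_mult Ck_component f)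
  have "(\<integral>y. drift_div A f y *\<^sub>R W y \<partial>lborel) = (\<Sum>j\<in>UNIV. \<integral>y. dder (column j A) (\<lambda>y. y $ j * f y) y *\<^sub>R W y \<partial>lborel)"
    unfolding drift_div_eq[OF f] scaleR_sum_left
    by (intro Bochner_Integration.integral_sum integrable_Cc_infty_scaleR[OF Cc_infty_dder[OF c] W])
  also have "\<dots> = (\<Sum>j\<in>UNIV. - (\<integral>y. (y $ j * f y) *\<^sub>R DW (column j A) y \<partial>lborel))"
    by (intro sum.cong refl integral_dder_by_parts[OF c W DW(1,2) der])
  also have "\<dots> = - (\<integral>y. (\<Sum>j\<in>UNIV. (y $ j * f y) *\<^sub>R DW (column j A) y) \<partial>lborel)"
    unfolding sum_negf
    by (subst Bochner_Integration.integral_sum) (auto intro: integrable_Cc_infty_scaleR[OF c DW(1,2)])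
  also have "(\<lambda>y. \<Sum>j\<in>UNIV. (y $ j * f y) *\<^sub>R DW (column j A) y) = (\<lambda>y. f y *\<^sub>R DW (A *v y) y)"
  proof
    fix y
    have "A *v y = (\<Sum>j\<in>UNIV. y $ j *\<^sub>R column j A)"
      by (simp add: matrix_mult_sum scalar_mult_eq_scaleR)
    then show "(\<Sum>j\<in>UNIV. (y $ j * f y) *\<^sub>R DW (column j A) y) = f y *\<^sub>R DW (A *v y) y"
      by (simp add: linear_sum[OF DW(3)] linear_scale[OF DW(3)] scaleR_sum_right mult.commute)
  qed
  finally show ?thesis .
qed

section \<open>Levy measures\<close>

lemma levy_measure_borel:
  assumes "levy_measure \<nu>" "f \<in> borel_measurable borel"
  shows "f \<in> borel_measurable \<nu>"
proof -
  have "f \<in> borel_measurable (restrict_space borel (- {0}))"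
    using assms(2) by (rule measurable_restrict_space1)
  then show ?thesis
    using assms(1) measurable_cong_sets[of \<nu> "restrict_space borel (- {0})" borel borel]
    by (auto simp: levy_measure_def)
qed

lemma levy_measure_id: "levy_measure \<nu> \<Longrightarrow> (\<lambda>z. z) \<in> measurable \<nu> borel"
  by (rule levy_measure_borel) auto

lemma levy_measure_sigma_finite: "levy_measure \<nu> \<Longrightarrow> sigma_finite_measure \<nu>"
  by (simp add: levy_measure_def)

lemma levy_measure_integrable_min: "levy_measure \<nu> \<Longrightarrow> integrable \<nu> (\<lambda>z. min 1 ((norm z)\<^sup>2))"
proof (rule integrableI_nonneg)
  show "(\<lambda>z. min 1 ((norm z)\<^sup>2)) \<in> borel_measurable \<nu>" if "levy_measure \<nu>"
    by (rule levy_measure_borel[OF that]) measurable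
qed (auto simp: levy_measure_def)

lemma levy_measure_integrableI:
  fixes f :: "real^'d \<Rightarrow> 'b::{banach, second_countable_topology}"
  assumes "levy_measure \<nu>" "f \<in> borel_measurable borel" "\<And>z. norm (f z) \<le> C * min 1 ((norm z)\<^sup>2)"
  shows "integrable \<nu> f"
proof (rule Bochner_Integration.integrable_bound)
  show "integrable \<nu> (\<lambda>z. C * min 1 ((norm z)\<^sup>2))"
    by (intro integrable_mult_right levy_measure_integrable_min assms)
  show "f \<in> borel_measurable \<nu>" by (rule levy_measure_borel[OF assms(1,2)])
  show "AE z in \<nu>. norm (f z) \<le> norm (C * min 1 ((norm z)\<^sup>2))"
    using assms(3) by (intro AE_I2) (metis abs_ge_self order_trans real_norm_def)
qed

text \<open>Two mean value estimates in succession. The constant is \<open>C\<close> instead of the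
  sharp \<open>C / 2\<close>, which is good enough for domination.\<close>

lemma taylor_remainder_bound:
  fixes f :: "real \<Rightarrow> 'b::real_normed_vector"
  assumes f: "\<And>t. (f has_vector_derivative f' t) (at t)"
    and f': "\<And>t. (f' has_vector_derivative f'' t) (at t)"
    and C: "\<And>t. norm (f'' t) \<le> C"
  shows "norm (f 1 - f 0 - f' 0) \<le> C"
proof -
  have C0: "C \<ge> 0" using C norm_ge_zero order_trans by blast
  have d: "norm (f' t - f' 0) \<le> C" if "t \<in> {0..1}" for t
  proof -
    have "norm (f' t - f' 0) \<le> C * norm (t - 0)"
    proof (rule differentiable_bound[where S = UNIV and f' = "\<lambda>t s. s *\<^sub>R f'' t"])
      show "(f' has_derivative (\<lambda>s. s *\<^sub>R f'' x)) (at x)" for x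
        using f' by (simp add: has_vector_derivative_def)
      show "onorm (\<lambda>s. s *\<^sub>R f'' x) \<le> C" for x
      proof (rule onorm_bound[OF C0])
        show "norm (s *\<^sub>R f'' x) \<le> C * norm s" for s
          using mult_left_mono[OF C[of x], of "norm s"] by (simp add: mult.commute)
      qed
    qed auto
    also have "\<dots> \<le> C * 1" using that C0 by (intro mult_left_mono) auto
    finally show ?thesis by simp
  qed
  have "norm (f 1 - f 0 - (1 - 0) *\<^sub>R f' 0) \<le> norm (1 - 0 :: real) * C"
    by (rule vector_differentiable_bound_linearization[where S = "{0..1}"])
       (auto intro: has_vector_derivative_at_within f d simp: closed_segment_eq_real_ivl)
  then show ?thesis by simp
qed

lemma Cc_infty_dder_bound:
  assumes f: "f \<in> Cc_infty"
  obtains C where "C > 0" "\<And>h x. \<bar>dder h f x\<bar> \<le> C * norm h" "\<And>h x. \<bar>dder h (dder h f) x\<bar> \<le> C * (norm h)\<^sup>2"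
proof -
  have "\<exists>C. \<forall>x. \<bar>partial i f x\<bar> \<le> C" for i
    using Cc_infty_bounded[OF Cc_infty_partial[OF f]] by metis
  then obtain C1 where C1: "\<And>i x. \<bar>partial i f x\<bar> \<le> C1 i" by metis
  have "\<exists>C. \<forall>x. \<bar>hessian f x $ i $ j\<bar> \<le> C" for i j
    using Cc_infty_bounded[OF Cc_infty_partial[OF Cc_infty_partial[OF f]]] by (simp add: hessian_def) metis
  then obtain C2 where C2: "\<And>i j x. \<bar>hessian f x $ i $ j\<bar> \<le> C2 i j" by metis
  have n1: "C1 i \<ge> 0" for i using C1 abs_ge_zero order_trans by blast
  have n2: "C2 i j \<ge> 0" for i j using C2 abs_ge_zero order_trans by blast
  define S1 where "S1 = (\<Sum>i\<in>UNIV. C1 i)"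
  define S2 where "S2 = (\<Sum>i\<in>UNIV. \<Sum>j\<in>UNIV. C2 i j)"
  have S: "S1 \<ge> 0" "S2 \<ge> 0" unfolding S1_def S2_def by (intro sum_nonneg n1 n2)+
  have b1: "\<bar>dder h f x\<bar> \<le> S1 * norm h" for h x
  proof -
    have "\<bar>dder h f x\<bar> \<le> (\<Sum>i\<in>UNIV. \<bar>h $ i * partial i f x\<bar>)"
      unfolding dder_sum by (rule sum_abs)
    also have "\<dots> \<le> (\<Sum>i\<in>UNIV. C1 i * norm h)"
      using mult_mono[OF component_le_norm_cart C1 norm_ge_zero abs_ge_zero]
      by (intro sum_mono) (simp add: abs_mult mult.commute[of _ "norm h"])
    finally show ?thesis by (simp add: S1_def sum_distrib_right)
  qed
  have b2: "\<bar>dder h (dder h f) x\<bar> \<le> S2 * (norm h)\<^sup>2" for h x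
  proof -
    have "\<bar>dder h (dder h f) x\<bar> \<le> (\<Sum>i\<in>UNIV. \<Sum>j\<in>UNIV. \<bar>h $ i * h $ j * hessian f x $ i $ j\<bar>)"
      unfolding dder_dder[OF f] by (intro order_trans[OF sum_abs] sum_mono order_refl)
    also have "\<dots> \<le> (\<Sum>i\<in>UNIV. \<Sum>j\<in>UNIV. C2 i j * (norm h)\<^sup>2)"
    proof (intro sum_mono)
      fix i j
      have "\<bar>h $ i\<bar> * \<bar>h $ j\<bar> * \<bar>hessian f x $ i $ j\<bar> \<le> norm h * norm h * C2 i j"
        by (intro mult_mono component_le_norm_cart C2) auto
      then show "\<bar>h $ i * h $ j * hessian f x $ i $ j\<bar> \<le> C2 i j * (norm h)\<^sup>2"
        by (simp add: abs_mult power2_eq_square mult_ac)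
    qed
    finally show ?thesis by (simp add: S2_def sum_distrib_right)
  qed
  show ?thesis
  proof (rule that[of "S1 + S2 + 1"])
    show "S1 + S2 + 1 > 0" using S by simp
    show "\<bar>dder h f x\<bar> \<le> (S1 + S2 + 1) * norm h" for h x
      using b1[of h x] S by (auto simp: distrib_right intro: order_trans)
    show "\<bar>dder h (dder h f) x\<bar> \<le> (S1 + S2 + 1) * (norm h)\<^sup>2" for h x
      using b2[of h x] S by (auto simp: distrib_right intro: order_trans)
  qed
qed

section \<open>The jump part of the adjoint operator\<close>

definition jump_diff :: "real^'d^'n \<Rightarrow> (real^'n \<Rightarrow> real) \<Rightarrow> real^'n \<Rightarrow> real^'d \<Rightarrow> real" where
  "jump_diff B f x z = f (x - B *v z) - f x + dder (B *v z) f x * indicator (ball 0 1) z"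

lemma jump_diff_borel:
  fixes B :: "real^'d^'n"
  assumes f: "f \<in> Cc_infty"
  shows "(\<lambda>(z, x). jump_diff B f x z) \<in> borel_measurable (borel \<Otimes>\<^sub>M borel)"
proof -
  have c: "continuous_on UNIV (\<lambda>p :: (real^'d) \<times> (real^'n). f (snd p - B *v fst p) - f (snd p))"
    by (intro continuous_intros continuous_on_compose2[OF Cc_infty_continuous[OF f]]
        continuous_on_matrix_vector_mult') auto
  have d: "continuous_on UNIV (\<lambda>p :: (real^'d) \<times> (real^'n). dder (B *v fst p) f (snd p))"
    unfolding dder_sum
    by (intro continuous_intros continuous_on_compose2[OF Cc_infty_continuous[OF Cc_infty_partial[OF f]]]
        continuous_on_matrix_vector_mult') auto
  have m: "(\<lambda>p :: (real^'d) \<times> (real^'n). f (snd p - B *v fst p) - f (snd p)) \<in> borel_measurable (borel \<Otimes>\<^sub>M borel)"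
    "(\<lambda>p :: (real^'d) \<times> (real^'n). dder (B *v fst p) f (snd p)) \<in> borel_measurable (borel \<Otimes>\<^sub>M borel)"
    using borel_measurable_continuous_onI[OF c] borel_measurable_continuous_onI[OF d] by (simp_all add: borel_prod)
  have "(\<lambda>p :: (real^'d) \<times> (real^'n). (f (snd p - B *v fst p) - f (snd p)) + dder (B *v fst p) f (snd p) * indicator (ball 0 1) (fst p))
      \<in> borel_measurable (borel \<Otimes>\<^sub>M borel)"
    by (intro borel_measurable_add borel_measurable_times m measurable_compose[OF measurable_fst borel_measurable_indicator]) auto
  then show ?thesis by (simp add: jump_diff_def case_prod_beta' algebra_simps)
qed

text \<open>Two bounds with the same weight in \<open>z\<close>. The pointwise one lets
  \<open>\<nu>\<close> be integrated at fixed \<open>x\<close>, but it does not decay in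
  \<open>x\<close>; the bound on the \<open>x\<close>-integral is the one that permits Fubini. Small
  jumps use Taylor's formula on a fixed ball, large jumps the triangle inequality and translation
  invariance.\<close>

lemma jump_diff_bounds:
  fixes B :: "real^'d^'n"
  assumes f: "f \<in> Cc_infty"
  obtains C where "C > 0" "\<And>x z. \<bar>jump_diff B f x z\<bar> \<le> C * min 1 ((norm z)\<^sup>2)"
    "\<And>z. integrable lborel (\<lambda>x. jump_diff B f x z)"
    "\<And>z. (\<integral>x. \<bar>jump_diff B f x z\<bar> \<partial>lborel) \<le> C * min 1 ((norm z)\<^sup>2)"
proof -
  obtain C0 where C0: "C0 > 0" "\<And>x. \<bar>f x\<bar> \<le> C0" using Cc_infty_bounded[OF f] by metis
  obtain C2 where C2: "C2 > 0" "\<And>h x. \<bar>dder h (dder h f) x\<bar> \<le> C2 * (norm h)\<^sup>2"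
    using Cc_infty_dder_bound[OF f] by metis
  obtain r where r: "r > 0" "\<And>x. norm x \<ge> r \<Longrightarrow> f x = 0" using Cc_infty_supportE[OF f] by metis
  define b where "b = onorm ((*v) B)"
  have b: "norm (B *v z) \<le> b * norm z" "b \<ge> 0" for z
    unfolding b_def by (intro onorm onorm_pos_le matrix_vector_mul_bounded_linear)+
  have [measurable]: "f \<in> borel_measurable borel" using f by (rule Cc_infty_borel)
  have [measurable]: "(\<lambda>x. jump_diff B f x z) \<in> borel_measurable borel" for z
  proof -
    have "(\<lambda>x. (\<lambda>(z, x). jump_diff B f x z) (z, x)) \<in> borel_measurable borel"
      by (rule measurable_compose[OF _ jump_diff_borel[OF f]]) measurable
    then show ?thesis by simp
  qed
  have small: "\<bar>jump_diff B f x z\<bar> \<le> C2 * b\<^sup>2 * (norm z)\<^sup>2" if "norm z < 1" for x z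
  proof -
    define h where "h = - (B *v z)"
    have "norm (f (x + 1 *\<^sub>R h) - f (x + 0 *\<^sub>R h) - dder h f (x + 0 *\<^sub>R h)) \<le> C2 * (norm h)\<^sup>2"
    proof (rule taylor_remainder_bound)
      show "((\<lambda>t. f (x + t *\<^sub>R h)) has_vector_derivative dder h f (x + t *\<^sub>R h)) (at t)" for t
        unfolding has_real_derivative_iff_has_vector_derivative[symmetric]
        by (intro has_real_derivative_line Cc_infty_differentiable f)
      show "((\<lambda>t. dder h f (x + t *\<^sub>R h)) has_vector_derivative dder h (dder h f) (x + t *\<^sub>R h)) (at t)" for t
        unfolding has_real_derivative_iff_has_vector_derivative[symmetric]
        by (intro has_real_derivative_line Cc_infty_differentiable Cc_infty_dder f)
      show "norm (dder h (dder h f) (x + t *\<^sub>R h)) \<le> C2 * (norm h)\<^sup>2" for t using C2(2) by simp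
    qed
    also have "\<dots> \<le> C2 * (b * norm z)\<^sup>2"
      using b(1)[of z] C2(1) by (intro mult_left_mono power_mono) (auto simp: h_def)
    finally show ?thesis using that by (simp add: jump_diff_def h_def dder_def power_mult_distrib mult.assoc)
  qed
  \<comment> \<open>A jump with \<open>norm z < 1\<close> moves a point by at most \<open>b\<close>,
    so the support stays in one ball for all such \<open>z\<close>.\<close>
  have supp: "jump_diff B f x z = 0" if "norm z < 1" "norm x > r + b" for x z
  proof -
    have "norm (B *v z) \<le> b" using b(1)[of z] b(2) that(1) by (meson less_eq_real_def mult_left_le order_trans)
    then have "norm (x - B *v z) \<ge> r" using that(2) norm_triangle_ineq2[of x "B *v z"] by simp
    moreover have "norm x > r" using that(2) b(2) by simp
    moreover have "partial i f x = 0" for i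
      by (rule partial_outside_support[of r]) (use r(2) \<open>norm x > r\<close> in auto)
    ultimately show ?thesis using r(2) by (simp add: jump_diff_def dder_sum)
  qed
  define V where "V = measure lborel (cball (0 :: real^'n) (r + b))"
  \<comment> \<open>The product dominates both \<open>C2 * b\<^sup>2\<close>, for the pointwise
    bound at small jumps, and \<open>C2 * b\<^sup>2 * V\<close>, for its integral over the ball. The
    last two summands serve the large jumps.\<close>
  define D where "D = (C2 * b\<^sup>2 + 1) * (V + 1) + 2 * C0 + 2 * (\<integral>x. \<bar>f x\<bar> \<partial>lborel)"
  have V: "V \<ge> 0" by (simp add: V_def)
  have I0: "(\<integral>x. \<bar>f x\<bar> \<partial>lborel) \<ge> 0" by simp
  have cc: "C2 * b\<^sup>2 \<ge> 0" using C2(1) by simp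
  have D0: "D > 0"
    using V I0 C0(1) cc mult_nonneg_nonneg[of "C2 * b\<^sup>2 + 1" "V + 1"] unfolding D_def by linarith
  have D1: "C2 * b\<^sup>2 \<le> D" "C2 * b\<^sup>2 * V \<le> D" "2 * C0 \<le> D" "2 * (\<integral>x. \<bar>f x\<bar> \<partial>lborel) \<le> D"
    unfolding D_def using V I0 C0(1) cc mult_nonneg_nonneg[OF cc V] by (auto simp: algebra_simps)
  have mn: "norm z < 1 \<Longrightarrow> min 1 ((norm z)\<^sup>2) = (norm z)\<^sup>2" "\<not> norm z < 1 \<Longrightarrow> min 1 ((norm z)\<^sup>2) = 1" for z :: "real^'d"
    by (auto simp: min_def power_le_one not_less one_le_power antisym)
  have fs: "integrable lborel (\<lambda>x. f (x - B *v z))" "(\<integral>x. \<bar>f (x - B *v z)\<bar> \<partial>lborel) = (\<integral>x. \<bar>f x\<bar> \<partial>lborel)" for z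
    using lborel_translate[of f "- (B *v z)"] lborel_translate[of "\<lambda>x. \<bar>f x\<bar>" "- (B *v z)"] integrable_Cc_infty[OF f] by auto
  have int: "integrable lborel (\<lambda>x. jump_diff B f x z)" for z
    unfolding jump_diff_def using fs(1) integrable_Cc_infty[OF f] integrable_Cc_infty[OF Cc_infty_dder[OF f]] by auto
  have bnd: "\<bar>jump_diff B f x z\<bar> \<le> D * min 1 ((norm z)\<^sup>2)" for x z
  proof (cases "norm z < 1")
    case True
    have "\<bar>jump_diff B f x z\<bar> \<le> C2 * b\<^sup>2 * (norm z)\<^sup>2" by (rule small[OF True])
    also have "\<dots> \<le> D * (norm z)\<^sup>2" by (intro mult_right_mono D1) auto
    finally show ?thesis by (simp add: mn(1)[OF True])
  next
    case False
    then have "\<bar>jump_diff B f x z\<bar> \<le> 2 * C0"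
      using C0(2)[of x] C0(2)[of "x - B *v z"] by (auto simp: jump_diff_def)
    then show ?thesis using D1(3) by (simp add: mn(2)[OF False])
  qed
  have bndi: "(\<integral>x. \<bar>jump_diff B f x z\<bar> \<partial>lborel) \<le> D * min 1 ((norm z)\<^sup>2)" for z
  proof (cases "norm z < 1")
    case True
    have fin: "emeasure lborel (cball (0 :: real^'n) (r + b)) < \<infinity>" by (rule emeasure_bounded_finite) simp
    have "(\<integral>x. \<bar>jump_diff B f x z\<bar> \<partial>lborel) \<le> (\<integral>x. (C2 * b\<^sup>2 * (norm z)\<^sup>2) * indicator (cball (0 :: real^'n) (r + b)) x \<partial>lborel)"
    proof (rule integral_mono)
      show "integrable lborel (\<lambda>x. (C2 * b\<^sup>2 * (norm z)\<^sup>2) * indicator (cball (0 :: real^'n) (r + b)) x)"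
        using fin by (intro integrable_mult_right integrable_real_indicator) auto
      show "\<bar>jump_diff B f x z\<bar> \<le> (C2 * b\<^sup>2 * (norm z)\<^sup>2) * indicator (cball (0 :: real^'n) (r + b)) x" for x
        using small[OF True, of x] supp[OF True, of x] by (auto split: split_indicator)
    qed (use int in auto)
    also have "\<dots> = (C2 * b\<^sup>2 * V) * (norm z)\<^sup>2" by (simp add: V_def)
    also have "\<dots> \<le> D * (norm z)\<^sup>2" by (intro mult_right_mono D1) auto
    finally show ?thesis by (simp add: mn(1)[OF True])
  next
    case False
    have "(\<integral>x. \<bar>jump_diff B f x z\<bar> \<partial>lborel) \<le> (\<integral>x. \<bar>f (x - B *v z)\<bar> + \<bar>f x\<bar> \<partial>lborel)"
      using False int fs(1) integrable_Cc_infty[OF f] by (intro integral_mono) (auto simp: jump_diff_def)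
    also have "\<dots> = 2 * (\<integral>x. \<bar>f x\<bar> \<partial>lborel)"
      using fs integrable_Cc_infty[OF f] by simp
    finally show ?thesis using D1(4) by (simp add: mn(2)[OF False])
  qed
  show ?thesis by (rule that[OF D0 bnd int bndi])
qed

text \<open>The correlation of \<open>W\<close> with \<open>f\<close>, that is, \<open>W\<close>
  mollified by the reflection of \<open>f\<close>. It is smooth in \<open>s\<close> for every
  bounded measurable \<open>W\<close>, since derivatives in \<open>s\<close> fall on
  \<open>f\<close>.\<close>

definition shift_int :: "(real^'n \<Rightarrow> real) \<Rightarrow> (real^'n \<Rightarrow> 'b::{banach, second_countable_topology}) \<Rightarrow> real^'n \<Rightarrow> 'b" where
  "shift_int f W s = (\<integral>y. f (y - s) *\<^sub>R W y \<partial>lborel)"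

lemma shift_int_has_vector_derivative:
  fixes W :: "real^'n \<Rightarrow> 'b::{banach, second_countable_topology}"
  assumes f: "f \<in> Cc_infty" and W: "W \<in> borel_measurable borel" "\<And>x. norm (W x) \<le> K"
  shows "((\<lambda>t. shift_int f W (t *\<^sub>R h)) has_vector_derivative - shift_int (dder h f) W (t *\<^sub>R h)) (at t)"
  unfolding shift_int_def by (rule translate_has_vector_derivative[OF assms])

text \<open>Integrating \<open>W\<close> against the adjoint operator amounts to applying the operator to
  \<open>s \<mapsto> shift_int f W s\<close> at the origin.\<close>

lemma levy_op_adj_weak:
  fixes W :: "real^'n \<Rightarrow> 'b::{banach, second_countable_topology}" and B :: "real^'d^'n" and w :: "'d \<Rightarrow> real^'d"
  assumes \<nu>: "levy_measure \<nu>" and Q: "\<And>i j. Q $ i $ j = (\<Sum>k\<in>UNIV. w k $ i * w k $ j)"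
    and f: "f \<in> Cc_infty" and W: "W \<in> borel_measurable borel" "\<And>x. norm (W x) \<le> K"
  shows "integrable lborel (\<lambda>x. levy_op_adj B b Q \<nu> f x *\<^sub>R W x)" (is ?A)
    and "integrable \<nu> (\<lambda>z. shift_int f W (B *v z) - shift_int f W 0
            + indicator (ball 0 1) z *\<^sub>R shift_int (dder (B *v z) f) W 0)" (is ?B)
    and "(\<integral>x. levy_op_adj B b Q \<nu> f x *\<^sub>R W x \<partial>lborel) =
       (1 / 2) *\<^sub>R (\<Sum>k\<in>UNIV. shift_int (dder (B *v w k) (dder (B *v w k) f)) W 0)
       - shift_int (dder (B *v b) f) W 0
       + (\<integral>z. shift_int f W (B *v z) - shift_int f W 0
            + indicator (ball 0 1) z *\<^sub>R shift_int (dder (B *v z) f) W 0 \<partial>\<nu>)" (is ?C)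
proof -
  interpret \<nu>: sigma_finite_measure \<nu> by (rule levy_measure_sigma_finite[OF \<nu>])
  interpret P: pair_sigma_finite \<nu> "lborel :: (real^'n) measure" ..
  obtain C where C: "C > 0" "\<And>x z. \<bar>jump_diff B f x z\<bar> \<le> C * min 1 ((norm z)\<^sup>2)"
    "\<And>z. integrable lborel (\<lambda>x. jump_diff B f x z)"
    "\<And>z. (\<integral>x. \<bar>jump_diff B f x z\<bar> \<partial>lborel) \<le> C * min 1 ((norm z)\<^sup>2)"
    using jump_diff_bounds[OF f, of B] by metis
  have K: "K \<ge> 0" using W(2) norm_ge_zero order_trans by blast
  have [measurable]: "(\<lambda>z. z) \<in> measurable \<nu> borel" by (rule levy_measure_id[OF \<nu>])
  note [measurable] = W(1) Cc_infty_borel[OF f]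
  have "(\<lambda>p. (\<lambda>(z, x). jump_diff B f x z) (fst p, snd p)) \<in> borel_measurable (\<nu> \<Otimes>\<^sub>M lborel)"
    by (rule measurable_compose[OF _ jump_diff_borel[OF f]]) measurable
  then have [measurable]: "(\<lambda>p. jump_diff B f (snd p) (fst p)) \<in> borel_measurable (\<nu> \<Otimes>\<^sub>M lborel)"
    by simp
  have Wp[measurable]: "(\<lambda>(z, x). jump_diff B f x z *\<^sub>R W x) \<in> borel_measurable (\<nu> \<Otimes>\<^sub>M lborel)"
    unfolding case_prod_beta' by measurable
  have zi: "integrable lborel (\<lambda>x. jump_diff B f x z *\<^sub>R W x)" for z
  proof (rule Bochner_Integration.integrable_bound)
    show "integrable lborel (\<lambda>x. jump_diff B f x z * K)" using C(3) by simp
    show "(\<lambda>x. jump_diff B f x z *\<^sub>R W x) \<in> borel_measurable lborel"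
      using C(3)[of z] W(1) by (intro borel_measurable_scaleR) auto
    show "AE x in lborel. norm (jump_diff B f x z *\<^sub>R W x) \<le> norm (jump_diff B f x z * K)"
      using W(2) K by (intro AE_I2) (auto simp: abs_mult intro!: mult_left_mono)
  qed
  \<comment> \<open>Integrability on the product space rests on the bound \<open>C(4)\<close> for
    the integral over \<open>x\<close>; \<open>W\<close> only contributes its bound
    \<open>K\<close>.\<close>
  have prod: "integrable (\<nu> \<Otimes>\<^sub>M lborel) (\<lambda>(z, x). jump_diff B f x z *\<^sub>R W x)"
  proof (rule P.Fubini_integrable)
    show "integrable \<nu> (\<lambda>z. \<integral>x. norm (case (z, x) of (z, x) \<Rightarrow> jump_diff B f x z *\<^sub>R W x) \<partial>lborel)"
    proof (rule Bochner_Integration.integrable_bound)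
      show "integrable \<nu> (\<lambda>z. C * K * min 1 ((norm z)\<^sup>2))"
        by (intro integrable_mult_right levy_measure_integrable_min \<nu>)
      show "(\<lambda>z. \<integral>x. norm (case (z, x) of (z, x) \<Rightarrow> jump_diff B f x z *\<^sub>R W x) \<partial>lborel) \<in> borel_measurable \<nu>"
        by (rule lborel.borel_measurable_lebesgue_integral) (use Wp in measurable)
      show "AE z in \<nu>. norm (\<integral>x. norm (case (z, x) of (z, x) \<Rightarrow> jump_diff B f x z *\<^sub>R W x) \<partial>lborel) \<le> norm (C * K * min 1 ((norm z)\<^sup>2))"
      proof (rule AE_I2)
        fix z
        have "(\<integral>x. norm (jump_diff B f x z *\<^sub>R W x) \<partial>lborel) \<le> (\<integral>x. \<bar>jump_diff B f x z\<bar> * K \<partial>lborel)"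
          using integrable_norm[OF zi[of z]] C(3) W(2) by (intro integral_mono) (auto intro!: mult_left_mono)
        also have "\<dots> \<le> C * min 1 ((norm z)\<^sup>2) * K"
          using mult_right_mono[OF C(4) K] by simp
        finally show "norm (\<integral>x. norm (case (z, x) of (z, x) \<Rightarrow> jump_diff B f x z *\<^sub>R W x) \<partial>lborel) \<le> norm (C * K * min 1 ((norm z)\<^sup>2))"
          using C(1) K by (simp add: abs_mult mult_ac)
      qed
    qed
  qed (use zi Wp in auto)
  have jz: "integrable \<nu> (jump_diff B f x)" for x
  proof (rule levy_measure_integrableI[OF \<nu> _ C(2)[of x, folded real_norm_def]])
    have "(\<lambda>z. (\<lambda>(z, x). jump_diff B f x z) (z, x)) \<in> borel_measurable borel"
      by (rule measurable_compose[OF _ jump_diff_borel[OF f]]) measurable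
    then show "jump_diff B f x \<in> borel_measurable borel" by simp
  qed
  have inner: "(\<integral>x. jump_diff B f x z *\<^sub>R W x \<partial>lborel) = shift_int f W (B *v z) - shift_int f W 0
            + indicator (ball 0 1) z *\<^sub>R shift_int (dder (B *v z) f) W 0" for z
  proof -
    have "(\<lambda>y. f (y - B *v z)) \<in> Cc_infty" using Cc_infty_affine[OF f, of 1 "- (B *v z)"] by simp
    note i1 = integrable_Cc_infty_scaleR[OF this W] and i2 = integrable_Cc_infty_scaleR[OF f W]
      and i3 = integrable_Cc_infty_scaleR[OF Cc_infty_dder[OF f] W]
    have "(\<integral>x. jump_diff B f x z *\<^sub>R W x \<partial>lborel) =
      (\<integral>x. f (x - B *v z) *\<^sub>R W x - f x *\<^sub>R W x + indicator (ball 0 1) z *\<^sub>R dder (B *v z) f x *\<^sub>R W x \<partial>lborel)"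
      by (simp add: jump_diff_def algebra_simps)
    also have "\<dots> = shift_int f W (B *v z) - shift_int f W 0 + indicator (ball 0 1) z *\<^sub>R shift_int (dder (B *v z) f) W 0"
      unfolding shift_int_def using i1 i2 i3 by (simp del: scaleR_scaleR)
    finally show ?thesis .
  qed
  have "integrable \<nu> (\<lambda>z. \<integral>x. jump_diff B f x z *\<^sub>R W x \<partial>lborel)"
    using P.integrable_fst'[OF prod] by simp
  then show ?B unfolding inner .
  have nlx: "(\<integral>z. jump_diff B f x z *\<^sub>R W x \<partial>\<nu>) = (\<integral>z. jump_diff B f x z \<partial>\<nu>) *\<^sub>R W x" for x
    using jz by simp
  have n1: "integrable lborel (\<lambda>x. (\<integral>z. jump_diff B f x z \<partial>\<nu>) *\<^sub>R W x)"
    using P.integrable_snd[OF prod] by (simp add: nlx)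
  have n2: "(\<integral>x. (\<integral>z. jump_diff B f x z \<partial>\<nu>) *\<^sub>R W x \<partial>lborel) = (\<integral>z. \<integral>x. jump_diff B f x z *\<^sub>R W x \<partial>lborel \<partial>\<nu>)"
    using P.Fubini_integral[OF prod] by (simp add: nlx)
  have L: "levy_op_adj B b Q \<nu> f x *\<^sub>R W x = (1 / 2) *\<^sub>R (\<Sum>k\<in>UNIV. dder (B *v w k) (dder (B *v w k) f) x *\<^sub>R W x)
      - dder (B *v b) f x *\<^sub>R W x + (\<integral>z. jump_diff B f x z \<partial>\<nu>) *\<^sub>R W x" for x
    by (simp add: levy_op_adj_def trace_hessian_eq[OF f Q] jump_diff_def dder_def inner_commute
        scaleR_sum_left[symmetric] algebra_simps)
  note i1 = integrable_Cc_infty_scaleR[OF Cc_infty_dder[OF f] W]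
    and i2 = integrable_Cc_infty_scaleR[OF Cc_infty_dder[OF Cc_infty_dder[OF f]] W]
  show ?A unfolding L using i1 i2 n1 by auto
  show ?C unfolding L inner[symmetric] n2[symmetric]
    using i1 i2 n1 by (simp add: shift_int_def)
qed

lemma ou_op_adj_eq: "ou_op_adj A B b Q \<nu> f x = levy_op_adj B b Q \<nu> f x - drift_div A f x"
  by (simp add: ou_op_adj_def drift_div_def dder_def inner_commute)

section \<open>The maximum principle\<close>

text \<open>Were \<open>c\<close> positive, \<open>\<theta>'\<close> would be positive immediately
  to the right of its zero, and the mean value theorem would produce a value above
  \<open>\<theta> 0\<close>.\<close>

lemma deriv_at_global_max:
  fixes \<theta> :: "real \<Rightarrow> real"
  assumes d1: "\<And>t. (\<theta> has_real_derivative \<theta>' t) (at t)"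
    and d2: "(\<theta>' has_real_derivative c) (at 0)" and mx: "\<And>t. \<theta> t \<le> \<theta> 0"
  shows "\<theta>' 0 = 0" "c \<le> 0"
proof -
  show z: "\<theta>' 0 = 0"
    using DERIV_local_max[OF d1[of 0], of 1] mx by simp
  show "c \<le> 0"
  proof (rule ccontr)
    assume "\<not> c \<le> 0"
    then obtain d where d: "d > 0" "\<And>h. 0 < h \<Longrightarrow> h < d \<Longrightarrow> \<theta>' 0 < \<theta>' (0 + h)"
      using DERIV_pos_inc_right[OF d2] by auto
    obtain \<xi> where \<xi>: "0 < \<xi>" "\<xi> < d / 2" "\<theta> (d / 2) - \<theta> 0 = (d / 2 - 0) * \<theta>' \<xi>"
      using MVT2[of 0 "d / 2" \<theta> \<theta>'] d1 d(1) by auto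
    have "\<theta>' \<xi> > 0" using d(2)[of \<xi>] \<xi> z by simp
    then have "(d / 2 - 0) * \<theta>' \<xi> > 0" using d(1) by simp
    then show False using \<xi>(3) mx[of "d / 2"] by linarith
  qed
qed

lemma mollifier:
  obtains \<rho> :: "real^'n \<Rightarrow> real"
  where "\<rho> \<in> Cc_infty" "\<And>x. 0 \<le> \<rho> x" "\<And>x. norm x \<ge> 1 \<Longrightarrow> \<rho> x = 0" "(\<integral>x. \<rho> x \<partial>lborel) = 1"
proof -
  obtain \<rho> :: "real^'n \<Rightarrow> real" where \<rho>: "\<rho> \<in> Cc_infty" "\<And>x. 0 \<le> \<rho> x" "\<rho> 0 = 1" "\<And>x. norm x \<ge> 1 \<Longrightarrow> \<rho> x = 0"
    using bump_function by metis
  have "isCont \<rho> 0" using Cc_infty_continuous[OF \<rho>(1)] by (simp add: continuous_on_eq_continuous_at)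
  then obtain d where d: "d > 0" "\<And>x. dist x 0 < d \<Longrightarrow> dist (\<rho> x) (\<rho> 0) < 1 / 2"
    unfolding continuous_at_eps_delta by (metis half_gt_zero zero_less_one)
  have fin: "emeasure lborel (ball (0 :: real^'n) d) < \<infinity>" by (rule emeasure_bounded_finite) simp
  have "0 < (1 / 2) * measure lborel (ball (0 :: real^'n) d)" using content_ball_pos[OF d(1), of "0 :: real^'n"] by simp
  also have "\<dots> = (\<integral>x. (1 / 2) * indicator (ball (0 :: real^'n) d) x \<partial>lborel)" by simp
  also have "\<dots> \<le> (\<integral>x. \<rho> x \<partial>lborel)"
  proof (rule integral_mono)
    show "integrable lborel (\<lambda>x. (1 / 2) * indicator (ball (0 :: real^'n) d) x :: real)"
      using fin by (intro integrable_mult_right integrable_real_indicator) auto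
    show "(1 / 2) * indicator (ball 0 d) x \<le> \<rho> x" for x
      using d(2)[of x] \<rho>(2)[of x] \<rho>(3)
      by (auto simp: indicator_def dist_real_def dist_commute abs_if split: if_splits)
  qed (rule integrable_Cc_infty[OF \<rho>(1)])
  finally have p: "0 < (\<integral>x. \<rho> x \<partial>lborel)" .
  show ?thesis
  proof (rule that[of "\<lambda>x. (1 / (\<integral>x. \<rho> x \<partial>lborel)) * \<rho> x"])
    show "(\<lambda>x. (1 / (\<integral>x. \<rho> x \<partial>lborel)) * \<rho> x) \<in> Cc_infty" by (rule Cc_infty_cmult[OF \<rho>(1)])
  qed (use p \<rho> in auto)
qed

text \<open>The positive maximum principle, for a function \<open>W\<close> that has no derivatives
  of its own. At a maximum of the correlation all first derivatives vanish, which removes the drift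
  vector and the compensator; second derivatives along lines are nonpositive, and the jump integrand
  is an increment away from a maximum.\<close>

lemma levy_op_adj_weak_at_max:
  fixes W :: "real^'n \<Rightarrow> real" and B :: "real^'d^'n" and w :: "'d \<Rightarrow> real^'d"
  assumes \<nu>: "levy_measure \<nu>" and Q: "\<And>i j. Q $ i $ j = (\<Sum>k\<in>UNIV. w k $ i * w k $ j)"
    and f: "f \<in> Cc_infty" and W: "W \<in> borel_measurable borel" "\<And>x. norm (W x) \<le> K"
    and mx: "\<And>s. shift_int f W s \<le> shift_int f W 0"
  shows "shift_int (dder h f) W 0 = 0"
    and "(\<integral>x. levy_op_adj B b Q \<nu> f x * W x \<partial>lborel) \<le> 0"
proof -
  have D: "((\<lambda>t. shift_int f W (t *\<^sub>R h)) has_real_derivative - shift_int (dder h f) W (t *\<^sub>R h)) (at t)"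
    if "f \<in> Cc_infty" for f h t
    unfolding has_real_derivative_iff_has_vector_derivative by (rule shift_int_has_vector_derivative[OF that W])
  have D2: "((\<lambda>t. - shift_int (dder h f) W (t *\<^sub>R h)) has_real_derivative shift_int (dder h (dder h f)) W (t *\<^sub>R h)) (at t)" for h t
    using DERIV_minus[OF D[OF Cc_infty_dder[OF f]]] by simp
  note M = deriv_at_global_max[OF D[OF f] D2]
  have z: "shift_int (dder h f) W 0 = 0" for h using M(1)[of h] mx by simp
  then show "shift_int (dder h f) W 0 = 0" .
  have n: "shift_int (dder h (dder h f)) W 0 \<le> 0" for h using M(2)[of h] mx by simp
  have "(\<integral>z. shift_int f W (B *v z) - shift_int f W 0 + indicator (ball 0 1) z *\<^sub>R shift_int (dder (B *v z) f) W 0 \<partial>\<nu>) \<le> (\<integral>z. 0 \<partial>\<nu>)"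
    by (rule integral_mono[OF levy_op_adj_weak(2)[OF \<nu> Q f W]]) (use mx z in auto)
  moreover have "(\<Sum>k\<in>UNIV. shift_int (dder (B *v w k) (dder (B *v w k) f)) W 0) \<le> 0"
    by (intro sum_nonpos n)
  ultimately show "(\<integral>x. levy_op_adj B b Q \<nu> f x * W x \<partial>lborel) \<le> 0"
    using levy_op_adj_weak(3)[OF \<nu> Q f W, of B b] z by simp
qed

lemma shift_int_translate:
  fixes W :: "real^'n \<Rightarrow> 'b::{banach, second_countable_topology}"
  assumes "f \<in> borel_measurable borel" "W \<in> borel_measurable borel"
  shows "shift_int f W (s + a) = shift_int f (\<lambda>y. W (y + a)) s"
proof -
  note [measurable] = assms
  show ?thesis unfolding shift_int_def
    by (subst lborel_translate(1)[of "\<lambda>y. f (y - (s + a)) *\<^sub>R W y" a, symmetric]) (auto simp: algebra_simps)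
qed

text \<open>Only the total mass of \<open>f\<close> enters, so estimates obtained this way are
  uniform over all mollifiers.\<close>

lemma Cc_infty_integral_mult_bound:
  assumes f: "f \<in> Cc_infty" "\<And>x. 0 \<le> f x" "(\<integral>x. f x \<partial>lborel) = 1"
    and V: "V \<in> borel_measurable borel" "\<And>x. \<bar>V x\<bar> \<le> C"
  shows "\<bar>\<integral>x. f x * V x \<partial>lborel\<bar> \<le> C"
proof -
  have i: "integrable lborel (\<lambda>x. f x * V x)"
    using integrable_Cc_infty_scaleR[OF f(1) V(1), of C] V(2) by simp
  have "\<bar>\<integral>x. f x * V x \<partial>lborel\<bar> \<le> (\<integral>x. \<bar>f x * V x\<bar> \<partial>lborel)" by (rule integral_abs_bound)
  also have "\<dots> \<le> (\<integral>x. f x * C \<partial>lborel)"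
    using integrable_Cc_infty[OF f(1)] f(2) V(2)
    by (intro integral_mono[OF integrable_abs[OF i]]) (auto simp: abs_mult intro!: mult_left_mono)
  also have "\<dots> = C" using f(3) by simp
  finally show ?thesis .
qed

text \<open>The bound is uniform in the cut-off radius \<open>R\<close>: the linear growth of the drift is
  compensated by the factor \<open>1 / R\<close> gained from each derivative of the cut-off.\<close>

lemma ou_op_adj_cutoff_bound:
  fixes \<zeta> :: "real^'n \<Rightarrow> real" and A :: "real^'n^'n" and B :: "real^'d^'n" and w :: "'d \<Rightarrow> real^'d"
  assumes \<nu>: "levy_measure \<nu>" and Q: "\<And>i j. Q $ i $ j = (\<Sum>k\<in>UNIV. w k $ i * w k $ j)"
    and \<zeta>: "\<zeta> \<in> Cc_infty" "\<And>x. \<bar>\<zeta> x\<bar> \<le> 1" "\<And>x. norm x \<ge> 1 \<Longrightarrow> \<zeta> x = 0"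
  shows "\<exists>C\<ge>0. \<forall>R\<ge>1. \<forall>f\<in>Cc_infty. (\<forall>x. 0 \<le> f x) \<and> (\<integral>x. f x \<partial>lborel) = 1 \<longrightarrow>
     \<bar>\<integral>x. ou_op_adj A B b Q \<nu> f x * \<zeta> ((1 / R) *\<^sub>R x) \<partial>lborel\<bar> \<le> C"
proof -
  obtain C where C: "C > 0" "\<And>h x. \<bar>dder h \<zeta> x\<bar> \<le> C * norm h" "\<And>h x. \<bar>dder h (dder h \<zeta>) x\<bar> \<le> C * (norm h)\<^sup>2"
    using Cc_infty_dder_bound[OF \<zeta>(1)] by metis
  define \<beta> where "\<beta> = onorm ((*v) B)"
  have \<beta>: "norm (B *v z) \<le> \<beta> * norm z" "\<beta> \<ge> 0" for z
    unfolding \<beta>_def by (intro onorm onorm_pos_le matrix_vector_mul_bounded_linear)+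
  define \<alpha> where "\<alpha> = onorm ((*v) A)"
  have \<alpha>: "norm (A *v z) \<le> \<alpha> * norm z" "\<alpha> \<ge> 0" for z
    unfolding \<alpha>_def by (intro onorm onorm_pos_le matrix_vector_mul_bounded_linear)+
  \<comment> \<open>One summand for each part of the operator: diffusion, drift vector, jumps and
    linear drift. In the jump weight, \<open>C * \<beta>\<^sup>2\<close> comes from Taylor's formula
    for \<open>norm z < 1\<close>, and 2 bounds the plain increment for the other jumps, where the
    compensator is absent.\<close>
  define E where "E = (1 / 2) * (\<Sum>k\<in>UNIV. C * (norm (B *v w k))\<^sup>2) + C * norm (B *v b)
     + (\<integral>z. (C * \<beta>\<^sup>2 + 2) * min 1 ((norm z)\<^sup>2) \<partial>\<nu>) + C * \<alpha>"
  show ?thesis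
  proof (intro exI[of _ E] conjI ballI allI impI)
    have "0 \<le> (\<integral>z. (C * \<beta>\<^sup>2 + 2) * min 1 ((norm z)\<^sup>2) \<partial>\<nu>)"
      using C(1) by (intro integral_nonneg_AE AE_I2 mult_nonneg_nonneg) auto
    then show "E \<ge> 0" unfolding E_def using C(1) \<alpha>(2)
      by (intro add_nonneg_nonneg mult_nonneg_nonneg sum_nonneg) auto
    fix R :: real and f :: "real^'n \<Rightarrow> real"
    assume R: "R \<ge> 1" and f: "f \<in> Cc_infty" and f': "(\<forall>x. 0 \<le> f x) \<and> (\<integral>x. f x \<partial>lborel) = 1"
    then have f: "f \<in> Cc_infty" "\<And>x. 0 \<le> f x" "(\<integral>x. f x \<partial>lborel) = 1" by auto
    define W where "W a x = \<zeta> (a + (1 / R) *\<^sub>R x)" for a x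
    have Wc: "W a \<in> Cc_infty" for a
      unfolding W_def using R by (intro Cc_infty_affine \<zeta>(1)) auto
    have Wb: "\<bar>W a x\<bar> \<le> 1" for a x using \<zeta>(2) by (simp add: W_def)
    have Wm: "W a \<in> borel_measurable borel" for a using Wc by (rule Cc_infty_borel)
    have dW: "dder h (W a) = (\<lambda>x. (1 / R) * dder h \<zeta> (a + (1 / R) *\<^sub>R x))" for h a
      unfolding W_def by (rule ext, rule dder_affine, rule Cc_infty_differentiable[OF \<zeta>(1)])
    have ddW: "dder h (dder h (W a)) x = (1 / R) * ((1 / R) * dder h (dder h \<zeta>) (a + (1 / R) *\<^sub>R x))" for h a x
    proof -
      have "(\<lambda>x. dder h \<zeta> (a + (1 / R) *\<^sub>R x)) \<in> Cc_infty"
        using R by (intro Cc_infty_affine Cc_infty_dder \<zeta>(1)) auto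
      then show ?thesis unfolding dW
        by (subst dder_cmult[OF Cc_infty_differentiable]) (auto simp: dder_affine[OF Cc_infty_differentiable[OF Cc_infty_dder[OF \<zeta>(1)]]])
    qed
    have R1: "1 / R \<le> 1" "1 / R > 0" using R by auto
    have R2: "(1 / R) * (1 / R) \<le> 1" using R1 by (intro mult_le_one) auto
    have dWb: "\<bar>dder h (W a) x\<bar> \<le> C * norm h" for h a x
    proof -
      have "\<bar>dder h (W a) x\<bar> \<le> 1 * (C * norm h)"
        unfolding dW abs_mult using R1 C by (intro mult_mono) auto
      then show ?thesis by simp
    qed
    have ddWb: "\<bar>dder h (dder h (W a)) x\<bar> \<le> C * (norm h)\<^sup>2" for h a x
    proof -
      have "\<bar>dder h (dder h (W a)) x\<bar> = (1 / R) * (1 / R) * \<bar>dder h (dder h \<zeta>) (a + (1 / R) *\<^sub>R x)\<bar>"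
        using R1 by (simp add: ddW abs_mult)
      also have "\<dots> \<le> 1 * (C * (norm h)\<^sup>2)"
        using R2 C by (intro mult_mono) auto
      finally show ?thesis by simp
    qed
    have line: "((\<lambda>t. g (y + t *\<^sub>R h)) has_vector_derivative dder h g (y + t *\<^sub>R h)) (at t)" if "g \<in> Cc_infty" for g :: "real^'n \<Rightarrow> real" and y t h
      unfolding has_real_derivative_iff_has_vector_derivative[symmetric]
      by (rule has_real_derivative_line[OF Cc_infty_differentiable[OF that]])
    \<comment> \<open>Moving every derivative from \<open>f\<close> to the cut-off is what makes the
      bounds independent of the shape, and in particular of the width, of \<open>f\<close>.\<close>
    have ibp: "(\<integral>y. dder h u y * g y \<partial>lborel) = - (\<integral>y. u y * dder h g y \<partial>lborel)" if u: "u \<in> Cc_infty" and g: "g \<in> Cc_infty" for u g :: "real^'n \<Rightarrow> real" and h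
    proof -
      obtain K where "\<And>x. \<bar>g x\<bar> \<le> K" using Cc_infty_bounded[OF g] by metis
      moreover obtain K' where "\<And>x. \<bar>dder h g x\<bar> \<le> K'" using Cc_infty_bounded[OF Cc_infty_dder[OF g]] by metis
      ultimately show ?thesis
        using integral_dder_by_parts[OF u Cc_infty_borel[OF g] _ Cc_infty_borel[OF Cc_infty_dder[OF g]] _ line[OF g], where K = K and K' = K']
        by simp
    qed
    have b0: "\<bar>shift_int f (W a) 0\<bar> \<le> 1" for a
      unfolding shift_int_def using Cc_infty_integral_mult_bound[OF f Wm Wb] by simp
    have b1: "\<bar>shift_int (dder h f) (W a) 0\<bar> \<le> C * norm h" for h a
      unfolding shift_int_def
      using Cc_infty_integral_mult_bound[OF f Cc_infty_borel[OF Cc_infty_dder[OF Wc]] dWb]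
      by (simp add: ibp f Wc)
    have b2: "\<bar>shift_int (dder h (dder h f)) (W a) 0\<bar> \<le> C * (norm h)\<^sup>2" for h a
      unfolding shift_int_def
      using Cc_infty_integral_mult_bound[OF f Cc_infty_borel[OF Cc_infty_dder[OF Cc_infty_dder[OF Wc]]] ddWb]
      by (simp add: ibp f Wc Cc_infty_dder)
    \<comment> \<open>A shift by \<open>s\<close> is absorbed into the offset of the cut-off. The
      bounds \<open>b0\<close> and \<open>b2\<close>, proved at the origin for every offset
      \<open>a\<close>, thus hold along the whole line, as Taylor's formula requires.\<close>
    have sh: "shift_int g (W 0) s = shift_int g (W ((1 / R) *\<^sub>R s)) 0" if "g \<in> Cc_infty" for g s
      using shift_int_translate[OF Cc_infty_borel[OF that] Wm[of 0], of 0 s]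
      by (simp add: W_def[abs_def] scaleR_right_distrib add.commute)
    have W1: "norm (W 0 x) \<le> 1" for x using Wb by simp
    note weak1 = levy_op_adj_weak(1)[OF \<nu> Q f(1) Wm[of 0] W1, where B = B and b = b]
      and weak2 = levy_op_adj_weak(2)[OF \<nu> Q f(1) Wm[of 0] W1, where B = B]
      and weak3 = levy_op_adj_weak(3)[OF \<nu> Q f(1) Wm[of 0] W1, where B = B and b = b]
    define N where "N z = shift_int f (W 0) (B *v z) - shift_int f (W 0) 0
            + indicator (ball 0 1) z *\<^sub>R shift_int (dder (B *v z) f) (W 0) 0" for z
    have Nb: "\<bar>N z\<bar> \<le> (C * \<beta>\<^sup>2 + 2) * min 1 ((norm z)\<^sup>2)" for z
    proof (cases "norm z < 1")
      case True
      define h where "h = B *v z"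
      have "norm (shift_int f (W 0) (1 *\<^sub>R h) - shift_int f (W 0) (0 *\<^sub>R h) - (- shift_int (dder h f) (W 0) (0 *\<^sub>R h))) \<le> C * (norm h)\<^sup>2"
      proof (rule taylor_remainder_bound)
        show "((\<lambda>t. shift_int f (W 0) (t *\<^sub>R h)) has_vector_derivative - shift_int (dder h f) (W 0) (t *\<^sub>R h)) (at t)" for t
          by (rule shift_int_has_vector_derivative[OF f(1) Wm W1])
        show "((\<lambda>t. - shift_int (dder h f) (W 0) (t *\<^sub>R h)) has_vector_derivative - (- shift_int (dder h (dder h f)) (W 0) (t *\<^sub>R h))) (at t)" for t
          by (intro has_vector_derivative_minus shift_int_has_vector_derivative[OF Cc_infty_dder[OF f(1)] Wm W1])
        show "norm (- (- shift_int (dder h (dder h f)) (W 0) (t *\<^sub>R h))) \<le> C * (norm h)\<^sup>2" for t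
          using b2 by (simp add: sh Cc_infty_dder f)
      qed
      also have "\<dots> \<le> C * (\<beta> * norm z)\<^sup>2"
        using \<beta>(1)[of z] C(1) by (intro mult_left_mono power_mono) (auto simp: h_def)
      also have "\<dots> \<le> (C * \<beta>\<^sup>2 + 2) * (norm z)\<^sup>2" by (simp add: power_mult_distrib algebra_simps)
      also have "(norm z)\<^sup>2 = min 1 ((norm z)\<^sup>2)" using True by (auto simp: min_def power_le_one antisym)
      finally show ?thesis using True by (simp add: N_def h_def)
    next
      case False
      then have "\<bar>N z\<bar> \<le> 2" using b0[of 0] b0[of "(1 / R) *\<^sub>R (B *v z)"] sh[OF f(1), of "B *v z"] by (simp add: N_def)
      also have "\<dots> \<le> C * \<beta>\<^sup>2 + 2" using C(1) by simp
      also have "\<dots> = (C * \<beta>\<^sup>2 + 2) * min 1 ((norm z)\<^sup>2)" using False by (simp add: min_def one_le_power antisym)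
      finally show ?thesis .
    qed
    have NI: "\<bar>\<integral>z. N z \<partial>\<nu>\<bar> \<le> (\<integral>z. (C * \<beta>\<^sup>2 + 2) * min 1 ((norm z)\<^sup>2) \<partial>\<nu>)"
    proof -
      have i: "integrable \<nu> N" using weak2 by (simp add: N_def[abs_def])
      have "\<bar>\<integral>z. N z \<partial>\<nu>\<bar> \<le> (\<integral>z. \<bar>N z\<bar> \<partial>\<nu>)" by (rule integral_abs_bound)
      also have "\<dots> \<le> (\<integral>z. (C * \<beta>\<^sup>2 + 2) * min 1 ((norm z)\<^sup>2) \<partial>\<nu>)"
        using i Nb by (intro integral_mono integrable_mult_right levy_measure_integrable_min[OF \<nu>]) auto
      finally show ?thesis .
    qed
    have SI: "\<bar>\<Sum>k\<in>UNIV. shift_int (dder (B *v w k) (dder (B *v w k) f)) (W 0) 0\<bar> \<le> (\<Sum>k\<in>UNIV. C * (norm (B *v w k))\<^sup>2)"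
      by (rule order_trans[OF sum_abs sum_mono]) (rule b2)
    have L: "\<bar>\<integral>x. levy_op_adj B b Q \<nu> f x * W 0 x \<partial>lborel\<bar> \<le> (1 / 2) * (\<Sum>k\<in>UNIV. C * (norm (B *v w k))\<^sup>2) + C * norm (B *v b)
        + (\<integral>z. (C * \<beta>\<^sup>2 + 2) * min 1 ((norm z)\<^sup>2) \<partial>\<nu>)"
      using weak3 SI NI b1[of "B *v b" 0] unfolding N_def[symmetric] by simp
    have Dr: "(\<integral>x. drift_div A f x * W 0 x \<partial>lborel) = - (\<integral>x. f x * dder (A *v x) (W 0) x \<partial>lborel)"
    proof -
      have "linear (\<lambda>h. dder h (W 0) x)" for x
        by (rule linearI) (simp_all add: dder_add dder_scaleR)
      then show ?thesis
        using integral_drift_div_by_parts[OF f(1) Wm W1 Cc_infty_borel[OF Cc_infty_dder[OF Wc]] _ _ line[OF Wc], where K' = "\<lambda>h. C * norm h" and A = A] dWb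
        by simp
    qed
    \<comment> \<open>The factor \<open>1 / R\<close> of the derivative is moved into the argument
      of \<open>A\<close>; where the derivative of the cut-off can be nonzero, that argument has
      norm at most 1.\<close>
    have Drb: "\<bar>dder (A *v x) (W 0) x\<bar> \<le> C * \<alpha>" for x
    proof (cases "norm ((1 / R) *\<^sub>R x) > 1")
      case True
      have "partial i \<zeta> ((1 / R) *\<^sub>R x) = 0" for i
        by (rule partial_outside_support[OF _ True]) (use \<zeta>(3) in auto)
      then have "dder h \<zeta> ((1 / R) *\<^sub>R x) = 0" for h by (simp add: dder_sum)
      then show ?thesis using C(1) \<alpha>(2) by (simp add: dW)
    next
      case False
      have "dder (A *v x) (W 0) x = dder (A *v ((1 / R) *\<^sub>R x)) \<zeta> ((1 / R) *\<^sub>R x)"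
        by (simp add: dW matrix_vector_mult_scaleR dder_scaleR)
      also have "\<bar>\<dots>\<bar> \<le> C * norm (A *v ((1 / R) *\<^sub>R x))" by (rule C(2))
      also have "\<dots> \<le> C * (\<alpha> * norm ((1 / R) *\<^sub>R x))" using C(1) by (intro mult_left_mono \<alpha>(1)) auto
      also have "\<dots> \<le> C * (\<alpha> * 1)" using False C(1) \<alpha>(2) by (intro mult_left_mono) auto
      finally show ?thesis by simp
    qed
    have Drm: "(\<lambda>x. dder (A *v x) (W 0) x) \<in> borel_measurable borel"
    proof -
      have [measurable]: "partial i (W 0) \<in> borel_measurable borel" for i by (intro Cc_infty_borel Cc_infty_partial Wc)
      have [measurable]: "(\<lambda>x. (A *v x) $ i) \<in> borel_measurable borel" for i
        by (intro borel_measurable_continuous_onI continuous_intros)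
      show ?thesis unfolding dder_sum by measurable
    qed
    have Drc: "\<bar>\<integral>x. drift_div A f x * W 0 x \<partial>lborel\<bar> \<le> C * \<alpha>"
      using Cc_infty_integral_mult_bound[OF f Drm Drb] by (simp add: Dr)
    have "(\<integral>x. ou_op_adj A B b Q \<nu> f x * W 0 x \<partial>lborel) =
        (\<integral>x. levy_op_adj B b Q \<nu> f x * W 0 x \<partial>lborel) - (\<integral>x. drift_div A f x * W 0 x \<partial>lborel)"
      using weak1 integrable_Cc_infty_scaleR[OF Cc_infty_drift_div[OF f(1), of A] Wm W1]
      by (simp add: ou_op_adj_eq left_diff_distrib)
    then show "\<bar>\<integral>x. ou_op_adj A B b Q \<nu> f x * \<zeta> ((1 / R) *\<^sub>R x) \<partial>lborel\<bar> \<le> E"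
      using L Drc by (simp add: W_def E_def)
  qed
qed

text \<open>By scaling, the bound does not depend on the width \<open>\<epsilon>\<close> of the mollifier.\<close>

lemma drift_div_mollifier_bound:
  fixes \<rho> :: "real^'n \<Rightarrow> real" and A :: "real^'n^'n"
  assumes \<rho>: "\<rho> \<in> Cc_infty" "\<And>x. norm x \<ge> 1 \<Longrightarrow> \<rho> x = 0"
    and W: "W \<in> borel_measurable borel" "\<And>x. norm (W x) \<le> K"
    and \<epsilon>: "\<epsilon> > 0" and osc: "\<And>x. norm x \<le> \<epsilon> \<Longrightarrow> \<bar>W (a + x) - W a\<bar> \<le> \<kappa>"
    and f_def: "f = (\<lambda>y. (1 / \<epsilon> ^ CARD('n)) * \<rho> ((1 / \<epsilon>) *\<^sub>R (y - a)))"
    and crit: "shift_int (dder (A *v a) f) W 0 = 0"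
  shows "\<bar>\<integral>x. drift_div A f x * W x \<partial>lborel\<bar> \<le> \<kappa> * (\<integral>x. \<bar>drift_div A \<rho> x\<bar> \<partial>lborel)"
proof -
  define c where "c = 1 / \<epsilon> ^ CARD('n)"
  have f1: "f = (\<lambda>y. c * \<rho> (- (1 / \<epsilon>) *\<^sub>R a + (1 / \<epsilon>) *\<^sub>R y))"
    by (simp add: f_def c_def scaleR_diff_right)
  have aff: "(\<lambda>y. \<rho> (- (1 / \<epsilon>) *\<^sub>R a + (1 / \<epsilon>) *\<^sub>R y)) \<in> Cc_infty"
    using \<epsilon> by (intro Cc_infty_affine \<rho>) auto
  have f: "f \<in> Cc_infty" unfolding f1 by (rule Cc_infty_cmult[OF aff])
  have df: "dder h f y = c * ((1 / \<epsilon>) * dder h \<rho> ((1 / \<epsilon>) *\<^sub>R (y - a)))" for h y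
    unfolding f1
    by (subst dder_cmult[OF Cc_infty_differentiable[OF aff]], subst dder_affine[OF Cc_infty_differentiable[OF \<rho>(1)]])
       (simp add: scaleR_diff_right)
  \<comment> \<open>Split \<open>A *v y\<close> at the centre \<open>a\<close>. The part
    \<open>A *v (y - a)\<close> scales together with the mollifier, its linear growth cancelling the
    factor \<open>1 / \<epsilon>\<close> of the derivative; the constant part \<open>A *v a\<close>
    is removed by criticality.\<close>
  have D: "drift_div A f y = c * drift_div A \<rho> ((1 / \<epsilon>) *\<^sub>R (y - a)) + dder (A *v a) f y" for y
  proof -
    have "dder (A *v y) f y = dder (A *v (y - a)) f y + dder (A *v a) f y"
      by (simp add: dder_add[symmetric] matrix_vector_mult_diff_distrib)
    also have "dder (A *v (y - a)) f y = c * dder (A *v ((1 / \<epsilon>) *\<^sub>R (y - a))) \<rho> ((1 / \<epsilon>) *\<^sub>R (y - a))"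
      by (simp add: df matrix_vector_mult_scaleR dder_scaleR)
    finally show ?thesis by (simp add: drift_div_def f_def c_def algebra_simps)
  qed
  have gm[measurable]: "drift_div A \<rho> \<in> borel_measurable borel" by (intro Cc_infty_borel Cc_infty_drift_div \<rho>)
  note [measurable] = W(1)
  have i2: "integrable lborel (\<lambda>x. dder (A *v a) f x * W x)"
    using integrable_Cc_infty_scaleR[OF Cc_infty_dder[OF f] W] by simp
  have i0: "integrable lborel (\<lambda>x. drift_div A f x * W x)"
    using integrable_Cc_infty_scaleR[OF Cc_infty_drift_div[OF f] W] by simp
  have i1: "integrable lborel (\<lambda>x. c * drift_div A \<rho> ((1 / \<epsilon>) *\<^sub>R (x - a)) * W x)"
    using Bochner_Integration.integrable_diff[OF i0 i2] by (simp add: D algebra_simps)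
  have "(\<integral>x. drift_div A f x * W x \<partial>lborel) = (\<integral>x. c * drift_div A \<rho> ((1 / \<epsilon>) *\<^sub>R (x - a)) * W x \<partial>lborel)"
    using i1 i2 crit by (simp add: D distrib_right shift_int_def)
  also have "\<dots> = \<epsilon> ^ DIM(real^'n) *\<^sub>R (\<integral>x. c * drift_div A \<rho> ((1 / \<epsilon>) *\<^sub>R (a + \<epsilon> *\<^sub>R x - a)) * W (a + \<epsilon> *\<^sub>R x) \<partial>lborel)"
    by (rule lborel_rescale) (use \<epsilon> in auto)
  also have "\<dots> = (\<integral>x. drift_div A \<rho> x * W (a + \<epsilon> *\<^sub>R x) \<partial>lborel)"
    using \<epsilon> by (simp add: c_def mult.assoc)
  finally have e: "(\<integral>x. drift_div A f x * W x \<partial>lborel) = (\<integral>x. drift_div A \<rho> x * W (a + \<epsilon> *\<^sub>R x) \<partial>lborel)" .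
  \<comment> \<open>A divergence integrates to zero, so a constant may be subtracted from
    \<open>W\<close> and only its oscillation within distance \<open>\<epsilon>\<close> of
    \<open>a\<close> counts.\<close>
  have z: "(\<integral>x. drift_div A \<rho> x \<partial>lborel) = 0"
    using integral_drift_div_by_parts[OF \<rho>(1), of "\<lambda>x. 1 :: real" 1 "\<lambda>h x. 0" "\<lambda>h. 0" A]
    by (simp add: linear_zero)
  have i3: "integrable lborel (\<lambda>x. drift_div A \<rho> x * W (a + \<epsilon> *\<^sub>R x))"
    using integrable_Cc_infty_scaleR[OF Cc_infty_drift_div[OF \<rho>(1)], of "\<lambda>x. W (a + \<epsilon> *\<^sub>R x)" K] W(2) by simp
  note i4 = integrable_Cc_infty[OF Cc_infty_drift_div[OF \<rho>(1)], of A]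
  have "(\<integral>x. drift_div A \<rho> x * W (a + \<epsilon> *\<^sub>R x) \<partial>lborel) = (\<integral>x. drift_div A \<rho> x * (W (a + \<epsilon> *\<^sub>R x) - W a) \<partial>lborel)"
    using i3 i4 z by (simp add: right_diff_distrib)
  also have "\<bar>\<dots>\<bar> \<le> (\<integral>x. \<bar>drift_div A \<rho> x * (W (a + \<epsilon> *\<^sub>R x) - W a)\<bar> \<partial>lborel)" by (rule integral_abs_bound)
  also have "\<dots> \<le> (\<integral>x. \<kappa> * \<bar>drift_div A \<rho> x\<bar> \<partial>lborel)"
  proof (rule integral_mono)
    show "integrable lborel (\<lambda>x. \<bar>drift_div A \<rho> x * (W (a + \<epsilon> *\<^sub>R x) - W a)\<bar>)"
      using i3 i4 by (auto simp: right_diff_distrib)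
    show "\<bar>drift_div A \<rho> x * (W (a + \<epsilon> *\<^sub>R x) - W a)\<bar> \<le> \<kappa> * \<bar>drift_div A \<rho> x\<bar>" for x
    proof (cases "norm x > 1")
      case True
      have "partial i \<rho> x = 0" for i
        by (rule partial_outside_support[OF _ True]) (use \<rho>(2) in auto)
      then show ?thesis using \<rho>(2)[of x] True by (simp add: drift_div_def dder_sum)
    next
      case False
      then have "\<bar>W (a + \<epsilon> *\<^sub>R x) - W a\<bar> \<le> \<kappa>" using \<epsilon> by (intro osc) auto
      then show ?thesis by (simp add: abs_mult mult.commute[of \<kappa>] mult_left_mono)
    qed
  qed (use i4 in auto)
  also have "\<dots> = \<kappa> * (\<integral>x. \<bar>drift_div A \<rho> x\<bar> \<partial>lborel)" by simp
  finally show ?thesis unfolding e .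
qed

lemma Cc_infty_lipschitz:
  assumes "f \<in> Cc_infty"
  obtains L where "L > 0" "\<And>x y. \<bar>f x - f y\<bar> \<le> L * norm (x - y)"
proof -
  obtain C where C: "C > 0" "\<And>h x. \<bar>dder h f x\<bar> \<le> C * norm h"
    using Cc_infty_dder_bound[OF assms] by metis
  have "norm (f x - f y) \<le> C * norm (x - y)" for x y
  proof (rule differentiable_bound[where S = UNIV and f' = "\<lambda>x h. grad f x \<bullet> h"])
    show "onorm (\<lambda>h. grad f x \<bullet> h) \<le> C" for x
      by (rule onorm_bound) (use C in \<open>auto simp: dder_def\<close>)
  qed (auto intro!: has_derivative_grad Cc_infty_differentiable assms)
  then show ?thesis using that[OF C(1)] by simp
qed

text \<open>Maximum principle: perturb \<open>v\<close> by a wide cut-off so that its mollification attains its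
  maximum, and test the equation with the mollifier centred there.\<close>

lemma weak_subsolution_nonpos:
  fixes v :: "real^'n \<Rightarrow> real" and A :: "real^'n^'n" and B :: "real^'d^'n" and w :: "'d \<Rightarrow> real^'d"
  assumes \<nu>: "levy_measure \<nu>" and Q: "\<And>i j. Q $ i $ j = (\<Sum>k\<in>UNIV. w k $ i * w k $ j)"
    and lam: "0 < lam" and v: "v \<in> Cb"
    and eq: "\<And>f. f \<in> Cc_infty \<Longrightarrow> (\<integral>x. v x * (lam * f x - ou_op_adj A B b Q \<nu> f x) \<partial>lborel) = 0"
  shows "v x \<le> 0"
proof -
  obtain \<rho> :: "real^'n \<Rightarrow> real" where \<rho>: "\<rho> \<in> Cc_infty" "\<And>x. 0 \<le> \<rho> x" "\<And>x. norm x \<ge> 1 \<Longrightarrow> \<rho> x = 0" "(\<integral>x. \<rho> x \<partial>lborel) = 1"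
    using mollifier by metis
  obtain \<zeta> :: "real^'n \<Rightarrow> real" where \<zeta>: "\<zeta> \<in> Cc_infty" "\<And>x. 0 \<le> \<zeta> x" "\<And>x. \<zeta> x \<le> 1" "\<zeta> 0 = 1" "\<And>x. norm x \<ge> 1 \<Longrightarrow> \<zeta> x = 0"
    using bump_function by metis
  have \<zeta>a: "\<bar>\<zeta> x\<bar> \<le> 1" for x using \<zeta>(2,3)[of x] by simp
  obtain C where C: "C \<ge> 0" "\<And>R f. R \<ge> 1 \<Longrightarrow> f \<in> Cc_infty \<Longrightarrow> (\<And>x. 0 \<le> f x) \<Longrightarrow> (\<integral>x. f x \<partial>lborel) = 1 \<Longrightarrow>
     \<bar>\<integral>x. ou_op_adj A B b Q \<nu> f x * \<zeta> ((1 / R) *\<^sub>R x) \<partial>lborel\<bar> \<le> C"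
  proof -
    have "\<zeta> x = 0" if "1 \<le> norm x" for x by (rule \<zeta>(5)[OF that])
    from ou_op_adj_cutoff_bound[OF \<nu> Q \<zeta>(1) \<zeta>a this, of A B b] show ?thesis
      using that by blast
  qed
  define C0 where "C0 = (\<integral>x. \<bar>drift_div A \<rho> x\<bar> \<partial>lborel)"
  have C0: "C0 \<ge> 0" by (simp add: C0_def)
  obtain L where L: "L > 0" "\<And>x y. \<bar>\<zeta> x - \<zeta> y\<bar> \<le> L * norm (x - y)"
    using Cc_infty_lipschitz[OF \<zeta>(1)] by metis
  obtain Kv where Kv: "\<And>x. \<bar>v x\<bar> \<le> Kv" using v by (auto simp: Cb_def bounded_iff)
  have vu: "uniformly_continuous_on UNIV v" using v by (simp add: Cb_def)
  have vm: "v \<in> borel_measurable borel"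
    by (intro borel_measurable_continuous_onI uniformly_continuous_imp_continuous vu)
  have bdd: "bdd_above (range v)" using Kv by (intro bdd_aboveI[of _ Kv]) (auto simp: abs_le_iff)
  define S where "S = Sup (range v)"
  have vS: "v x \<le> S" for x unfolding S_def by (rule cSUP_upper[OF _ bdd]) simp
  \<comment> \<open>\<open>\<kappa>\<close> is both the height of the cut-off added to
    \<open>v\<close> and the tolerance for oscillations. The other constants on the right are fixed
    before it, so small \<open>\<kappa>\<close> forces \<open>S\<close> to be nonpositive.\<close>
  have main: "lam * S \<le> \<kappa> * (lam + C + C0)" if \<kappa>: "\<kappa> > 0" for \<kappa>
  proof -
    obtain x0 where x0: "v x0 > S - \<kappa> / 4"
      using less_cSupD[of "range v" "S - \<kappa> / 4"] \<kappa> by (auto simp: S_def)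
    obtain d where d: "d > 0" "\<And>x y. dist x y < d \<Longrightarrow> dist (v x) (v y) < \<kappa> / 4"
    proof -
      have "\<exists>d>0. \<forall>x\<in>UNIV. \<forall>y\<in>UNIV. dist y x < d \<longrightarrow> dist (v y) (v x) < \<kappa> / 4"
        using vu[unfolded uniformly_continuous_on_def, rule_format, of "\<kappa> / 4"] \<kappa> by simp
      then show ?thesis using that by blast
    qed
    \<comment> \<open>With this radius \<open>L * norm x0 / R\<close> is at most 1/8, so the cut-off
      is still at least 7/8 at \<open>x0\<close>.\<close>
    define R where "R = 1 + 8 * L * norm x0"
    have R: "R \<ge> 1" using L(1) by (simp add: R_def)
    \<comment> \<open>The bound 1 limits the reach of the mollifier, \<open>d / 2\<close> keeps the
      oscillation of \<open>v\<close> below \<open>\<kappa> / 4\<close>, and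
      \<open>1 / (4 * L)\<close> keeps that of \<open>\<kappa> * Z\<close> at most
      \<open>\<kappa> / 4\<close>.\<close>
    define \<epsilon> where "\<epsilon> = min 1 (min (d / 2) (1 / (4 * L)))"
    have \<epsilon>: "\<epsilon> > 0" "\<epsilon> \<le> 1" "\<epsilon> < d" "\<epsilon> \<le> 1 / (4 * L)" using d(1) L(1) by (auto simp: \<epsilon>_def)
    define Z where "Z x = \<zeta> ((1 / R) *\<^sub>R x)" for x
    have Zc: "Z \<in> Cc_infty" using Cc_infty_affine[OF \<zeta>(1), of "1 / R" 0] R by (simp add: Z_def[abs_def])
    have Zm: "Z \<in> borel_measurable borel" by (rule Cc_infty_borel[OF Zc])
    have Zb: "\<bar>Z x\<bar> \<le> 1" for x using \<zeta>a by (simp add: Z_def)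
    have ZL: "\<bar>Z x - Z y\<bar> \<le> L * norm (x - y)" for x y
    proof -
      have "\<bar>Z x - Z y\<bar> \<le> L * norm ((1 / R) *\<^sub>R x - (1 / R) *\<^sub>R y)" unfolding Z_def by (rule L(2))
      also have "\<dots> = L * ((1 / R) * norm (x - y))" using R by (simp flip: scaleR_diff_right)
      also have "\<dots> \<le> L * (1 * norm (x - y))" using R L(1) by (intro mult_left_mono mult_right_mono) auto
      finally show ?thesis by simp
    qed
    define W where "W x = v x + \<kappa> * Z x" for x
    have Wm[measurable]: "W \<in> borel_measurable borel" unfolding W_def[abs_def] using vm Zm by measurable
    have Wb: "norm (W x) \<le> Kv + \<kappa>" for x
    proof -
      have "\<bar>\<kappa> * Z x\<bar> \<le> \<kappa> * 1" unfolding abs_mult using Zb \<kappa> by (intro mult_mono) auto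
      then show ?thesis using Kv[of x] by (simp add: W_def)
    qed
    have Wosc: "\<bar>W (y + x) - W y\<bar> \<le> \<kappa> / 2" if "norm x \<le> \<epsilon>" for x y
    proof -
      have "\<bar>v (y + x) - v y\<bar> < \<kappa> / 4" using d(2)[of "y + x" y] that \<epsilon>(3) by (simp add: dist_norm)
      moreover have "\<bar>\<kappa> * Z (y + x) - \<kappa> * Z y\<bar> \<le> \<kappa> * (1 / 4)"
      proof -
        have "\<bar>Z (y + x) - Z y\<bar> \<le> L * norm x" using ZL[of "y + x" y] by simp
        also have "\<dots> \<le> L * (1 / (4 * L))" using that \<epsilon>(4) L(1) by (intro mult_left_mono) auto
        finally have "\<bar>Z (y + x) - Z y\<bar> \<le> 1 / 4" using L(1) by simp
        then have "\<kappa> * \<bar>Z (y + x) - Z y\<bar> \<le> \<kappa> * (1 / 4)" using \<kappa> by (intro mult_left_mono) auto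
        then show ?thesis using \<kappa> by (simp add: abs_mult flip: right_diff_distrib)
      qed
      ultimately show ?thesis unfolding W_def by linarith
    qed
    define F where "F a = (\<lambda>y. (1 / \<epsilon> ^ CARD('n)) * \<rho> ((1 / \<epsilon>) *\<^sub>R (y - a)))" for a
    have Fc: "F a \<in> Cc_infty" for a
    proof -
      have "(\<lambda>y. \<rho> (- (1 / \<epsilon>) *\<^sub>R a + (1 / \<epsilon>) *\<^sub>R y)) \<in> Cc_infty"
        using \<epsilon> by (intro Cc_infty_affine \<rho>) auto
      from Cc_infty_cmult[OF this, of "1 / \<epsilon> ^ CARD('n)"] show ?thesis
        unfolding F_def by (simp add: scaleR_diff_right)
    qed
    have F0: "0 \<le> F a y" for a y using \<epsilon>(1) \<rho>(2) by (simp add: F_def)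
    have [measurable]: "F a \<in> borel_measurable borel" "\<rho> \<in> borel_measurable borel" for a
      using Fc \<rho>(1) by (auto intro: Cc_infty_borel)
    have resc: "(\<integral>y. F a y * V y \<partial>lborel) = (\<integral>y. \<rho> y * V (a + \<epsilon> *\<^sub>R y) \<partial>lborel)"
      if [measurable]: "V \<in> borel_measurable borel" for a and V :: "real^'n \<Rightarrow> real"
    proof -
      have "(\<integral>y. F a y * V y \<partial>lborel) = \<epsilon> ^ DIM(real^'n) *\<^sub>R (\<integral>x. F a (a + \<epsilon> *\<^sub>R x) * V (a + \<epsilon> *\<^sub>R x) \<partial>lborel)"
        by (rule lborel_rescale) (use \<epsilon> in auto)
      then show ?thesis using \<epsilon>(1) by (simp add: F_def mult.assoc)
    qed
    have F1: "(\<integral>y. F a y \<partial>lborel) = 1" for a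
      using resc[of "\<lambda>_. 1" a] \<rho>(4) by simp
    define M where "M a = (\<integral>y. F a y * W y \<partial>lborel)" for a
    have Mr: "M a = (\<integral>y. \<rho> y * W (a + \<epsilon> *\<^sub>R y) \<partial>lborel)" for a
      unfolding M_def by (rule resc) simp
    have ri: "integrable lborel (\<lambda>y. \<rho> y * W (a + \<epsilon> *\<^sub>R y))" for a
      using integrable_Cc_infty_scaleR[OF \<rho>(1), of "\<lambda>y. W (a + \<epsilon> *\<^sub>R y)" "Kv + \<kappa>"] Wb by simp
    have Mle: "M a \<le> c" if "\<And>y. norm y < 1 \<Longrightarrow> W (a + \<epsilon> *\<^sub>R y) \<le> c" for a c
    proof -
      have "M a \<le> (\<integral>y. \<rho> y * c \<partial>lborel)" unfolding Mr
      proof (rule integral_mono[OF ri])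
        show "\<rho> y * W (a + \<epsilon> *\<^sub>R y) \<le> \<rho> y * c" for y
          using that[of y] \<rho>(2)[of y] \<rho>(3)[of y] by (cases "norm y < 1") (auto intro: mult_left_mono)
      qed (use integrable_Cc_infty[OF \<rho>(1)] in simp)
      then show ?thesis using \<rho>(4) by simp
    qed
    have Mge: "c \<le> M a" if "\<And>y. norm y < 1 \<Longrightarrow> c \<le> W (a + \<epsilon> *\<^sub>R y)" for a c
    proof -
      have "(\<integral>y. \<rho> y * c \<partial>lborel) \<le> M a" unfolding Mr
      proof (rule integral_mono[OF _ ri])
        show "\<rho> y * c \<le> \<rho> y * W (a + \<epsilon> *\<^sub>R y)" for y
          using that[of y] \<rho>(2)[of y] \<rho>(3)[of y] by (cases "norm y < 1") (auto intro: mult_left_mono)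
      qed (use integrable_Cc_infty[OF \<rho>(1)] in simp)
      then show ?thesis using \<rho>(4) by simp
    qed
    \<comment> \<open>The fractions leave a margin: -1/4 from the choice of \<open>x0\<close>, +7/8
      from the cut-off and -1/2 from mollifying add up to \<open>\<kappa> / 8\<close> above
      \<open>S\<close>.\<close>
    have Mx0: "M x0 > S"
    proof -
      have "\<bar>Z x0 - Z 0\<bar> \<le> 1 / 8"
      proof -
        have "\<bar>Z x0 - Z 0\<bar> \<le> L * norm ((1 / R) *\<^sub>R x0)"
          using L(2)[of "(1 / R) *\<^sub>R x0" 0] by (simp add: Z_def)
        also have "\<dots> = L * norm x0 / R" using R by simp
        also have "\<dots> \<le> 1 / 8" using R by (simp add: divide_le_eq) (simp add: R_def)
        finally show ?thesis .
      qed
      moreover have "Z 0 = 1" using \<zeta>(4) by (simp add: Z_def)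
      ultimately have "Z x0 \<ge> 7 / 8" by linarith
      then have "\<kappa> * Z x0 \<ge> \<kappa> * (7 / 8)" using \<kappa> by (intro mult_left_mono) auto
      then have "W x0 > S + \<kappa> * (5 / 8)" using x0 by (simp add: W_def)
      moreover have "W x0 - \<kappa> / 2 \<le> M x0"
      proof (rule Mge)
        fix y :: "real^'n" assume "norm y < 1"
        then have "norm (\<epsilon> *\<^sub>R y) \<le> \<epsilon>" using \<epsilon>(1) by simp
        from Wosc[OF this, of x0] show "W x0 - \<kappa> / 2 \<le> W (x0 + \<epsilon> *\<^sub>R y)" by linarith
      qed
      ultimately show ?thesis using \<kappa> by simp
    qed
    \<comment> \<open>Since \<open>\<epsilon>\<close> is at most 1, a mollifier centred beyond
      \<open>R + 1\<close> sees only points where the cut-off vanishes and \<open>W\<close> equals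
      \<open>v\<close>. The maximum therefore lies in a compact ball, even if \<open>v\<close> has
      none.\<close>
    have Mout: "M x \<le> S" if "norm x \<ge> R + 1" for x
    proof (rule Mle)
      fix y :: "real^'n" assume y: "norm y < 1"
      have "norm (\<epsilon> *\<^sub>R y) \<le> 1 * 1" unfolding norm_scaleR using \<epsilon>(1,2) y by (intro mult_mono) auto
      then have "norm (x + \<epsilon> *\<^sub>R y) \<ge> R" using that norm_diff_ineq[of x "\<epsilon> *\<^sub>R y"] by simp
      then have "norm ((1 / R) *\<^sub>R (x + \<epsilon> *\<^sub>R y)) \<ge> 1" using R by simp
      then have "Z (x + \<epsilon> *\<^sub>R y) = 0" unfolding Z_def by (rule \<zeta>(5))
      then show "W (x + \<epsilon> *\<^sub>R y) \<le> S" using vS by (simp add: W_def)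
    qed
    have Mcont: "continuous_on UNIV M"
    proof (rule continuous_at_imp_continuous_on, intro ballI)
      fix a
      show "isCont M a" unfolding isCont_def tendsto_at_iff_sequentially o_def
      proof (intro allI impI)
        fix X :: "nat \<Rightarrow> real^'n" assume X: "X \<longlonglongrightarrow> a"
        have Wcont: "isCont W y" for y
        proof -
          have "continuous_on UNIV W" unfolding W_def
            by (intro continuous_intros uniformly_continuous_imp_continuous vu Cc_infty_continuous Zc)
          then show ?thesis by (simp add: continuous_on_eq_continuous_at)
        qed
        show "(\<lambda>n. M (X n)) \<longlonglongrightarrow> M a" unfolding Mr
        proof (rule integral_dominated_convergence)
          show "integrable lborel (\<lambda>y. \<rho> y * (Kv + \<kappa>))" using integrable_Cc_infty[OF \<rho>(1)] by simp
          show "AE y in lborel. (\<lambda>n. \<rho> y * W (X n + \<epsilon> *\<^sub>R y)) \<longlonglongrightarrow> \<rho> y * W (a + \<epsilon> *\<^sub>R y)"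
            by (intro AE_I2 tendsto_intros isCont_tendsto_compose[OF Wcont] X)
          show "AE y in lborel. norm (\<rho> y * W (X n + \<epsilon> *\<^sub>R y)) \<le> \<rho> y * (Kv + \<kappa>)" for n
            using Wb \<rho>(2) by (intro AE_I2) (auto simp: abs_mult intro!: mult_left_mono)
        qed auto
      qed
    qed
    have "\<exists>a\<in>cball 0 (R + 1 + norm x0). \<forall>x\<in>cball 0 (R + 1 + norm x0). M x \<le> M a"
    proof (intro continuous_attains_sup continuous_on_subset[OF Mcont])
      have "0 \<le> R + 1 + norm x0" using R norm_ge_zero[of x0] by linarith
      then show "cball (0 :: real^'n) (R + 1 + norm x0) \<noteq> {}" by simp
    qed auto
    then obtain a where a: "\<And>x. norm x \<le> R + 1 + norm x0 \<Longrightarrow> M x \<le> M a"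
      unfolding mem_cball_0[symmetric] by blast
    have aS: "S < M a" using Mx0 a[of x0] R by simp
    have amax: "M x \<le> M a" for x
    proof (cases "norm x \<le> R + 1 + norm x0")
      case False
      then have "R + 1 \<le> norm x" using norm_ge_zero[of x0] by linarith
      then show ?thesis using Mout[of x] aS by simp
    qed (rule a)
    have FM: "shift_int (F a) W s = M (a + s)" for s
    proof -
      have "F a (y - s) = F (a + s) y" for y by (simp add: F_def algebra_simps)
      then show ?thesis by (simp add: shift_int_def M_def)
    qed
    have smax: "shift_int (F a) W s \<le> shift_int (F a) W 0" for s using amax by (simp add: FM)
    note crit = levy_op_adj_weak_at_max[OF \<nu> Q Fc Wm Wb smax]
    have dr: "\<bar>\<integral>x. drift_div A (F a) x * W x \<partial>lborel\<bar> \<le> \<kappa> / 2 * C0"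
      unfolding C0_def
      by (rule drift_div_mollifier_bound[OF \<rho>(1,3) Wm Wb \<epsilon>(1) Wosc F_def crit(1)])
    have vb: "norm (v x) \<le> Kv" and Zb': "norm (Z x) \<le> 1" for x using Kv Zb by auto
    define \<psi> where "\<psi> = (\<lambda>x. lam * F a x - ou_op_adj A B b Q \<nu> (F a) x)"
    have i: "integrable lborel (\<lambda>x. \<psi> x * V x)" "integrable lborel (\<lambda>x. F a x * V x)"
        "integrable lborel (\<lambda>x. levy_op_adj B b Q \<nu> (F a) x * V x)" "integrable lborel (\<lambda>x. drift_div A (F a) x * V x)"
      if V: "V \<in> borel_measurable borel" "\<And>x. norm (V x) \<le> K" for V :: "real^'n \<Rightarrow> real" and K
    proof -
      show 1: "integrable lborel (\<lambda>x. F a x * V x)" using integrable_Cc_infty_scaleR[OF Fc V] by simp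
      show 2: "integrable lborel (\<lambda>x. levy_op_adj B b Q \<nu> (F a) x * V x)" using levy_op_adj_weak(1)[OF \<nu> Q Fc V] by simp
      show 3: "integrable lborel (\<lambda>x. drift_div A (F a) x * V x)" using integrable_Cc_infty_scaleR[OF Cc_infty_drift_div[OF Fc] V] by simp
      have "integrable lborel (\<lambda>x. lam * (F a x * V x) - levy_op_adj B b Q \<nu> (F a) x * V x + drift_div A (F a) x * V x)"
        using 1 2 3 by auto
      then show "integrable lborel (\<lambda>x. \<psi> x * V x)" by (simp add: \<psi>_def ou_op_adj_eq algebra_simps)
    qed
    \<comment> \<open>The three terms have three fates: the first is reduced by the equation for
      \<open>v\<close>, the Levy part is nonpositive at the maximum, and the drift part is a
      commutator error of size \<open>\<kappa> / 2 * C0\<close>.\<close>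
    have e1: "lam * M a = (\<integral>x. \<psi> x * W x \<partial>lborel) + (\<integral>x. levy_op_adj B b Q \<nu> (F a) x * W x \<partial>lborel) - (\<integral>x. drift_div A (F a) x * W x \<partial>lborel)"
    proof -
      have "lam * M a = (\<integral>x. lam * (F a x * W x) \<partial>lborel)" by (simp add: M_def)
      also have "(\<lambda>x. lam * (F a x * W x)) = (\<lambda>x. \<psi> x * W x + levy_op_adj B b Q \<nu> (F a) x * W x - drift_div A (F a) x * W x)"
        by (simp add: \<psi>_def ou_op_adj_eq algebra_simps)
      finally show ?thesis using i[OF Wm Wb] by simp
    qed
    \<comment> \<open>The equation annihilates the contribution of \<open>v\<close>, leaving the
      cut-off with its factor \<open>\<kappa>\<close>.\<close>
    have e2: "(\<integral>x. \<psi> x * W x \<partial>lborel) = \<kappa> * (\<integral>x. \<psi> x * Z x \<partial>lborel)"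
    proof -
      have "(\<integral>x. \<psi> x * W x \<partial>lborel) = (\<integral>x. \<psi> x * v x + \<kappa> * (\<psi> x * Z x) \<partial>lborel)"
        by (simp add: W_def algebra_simps)
      also have "\<dots> = (\<integral>x. \<psi> x * v x \<partial>lborel) + \<kappa> * (\<integral>x. \<psi> x * Z x \<partial>lborel)"
        using i(1)[OF vm vb] i(1)[OF Zm Zb'] by simp
      also have "(\<integral>x. \<psi> x * v x \<partial>lborel) = 0" using eq[OF Fc[of a]] by (simp add: \<psi>_def mult.commute)
      finally show ?thesis by simp
    qed
    have e3: "(\<integral>x. \<psi> x * Z x \<partial>lborel) \<le> lam + C"
    proof -
      have o: "integrable lborel (\<lambda>x. ou_op_adj A B b Q \<nu> (F a) x * Z x)"
        using Bochner_Integration.integrable_diff[OF i(3)[OF Zm Zb'] i(4)[OF Zm Zb']] by (simp add: ou_op_adj_eq left_diff_distrib)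
      have "(\<integral>x. \<psi> x * Z x \<partial>lborel) = lam * (\<integral>x. F a x * Z x \<partial>lborel) - (\<integral>x. ou_op_adj A B b Q \<nu> (F a) x * Z x \<partial>lborel)"
        using o i(2)[OF Zm Zb'] by (simp add: \<psi>_def left_diff_distrib mult.assoc)
      moreover have "\<bar>\<integral>x. ou_op_adj A B b Q \<nu> (F a) x * Z x \<partial>lborel\<bar> \<le> C"
        unfolding Z_def by (rule C(2)[OF R Fc F0 F1])
      moreover have "(\<integral>x. F a x * Z x \<partial>lborel) \<le> 1"
        using Cc_infty_integral_mult_bound[OF Fc F0 F1 Zm Zb, of a] by linarith
      then have "lam * (\<integral>x. F a x * Z x \<partial>lborel) \<le> lam * 1"
        using lam by (intro mult_left_mono) auto
      ultimately show ?thesis by linarith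
    qed
    have "lam * S \<le> lam * M a" using aS lam by simp
    also have "\<dots> \<le> \<kappa> * (lam + C) + 0 + \<kappa> / 2 * C0"
      unfolding e1 e2 using crit(2)[where b = b and B = B] dr mult_left_mono[OF e3 less_imp_le[OF \<kappa>]] \<kappa> by linarith
    also have "\<dots> \<le> \<kappa> * (lam + C + C0)" using \<kappa> C0 by (simp add: algebra_simps)
    finally show ?thesis .
  qed
  have "S \<le> 0"
  proof (rule ccontr)
    assume "\<not> S \<le> 0"
    then have S: "lam * S > 0" using lam by simp
    define D where "D = lam + C + C0"
    have D: "D > 0" using lam C(1) C0 by (simp add: D_def)
    \<comment> \<open>Chosen so that \<open>main\<close> reads
      \<open>lam * S \<le> lam * S / 2\<close>.\<close>
    define \<kappa> where "\<kappa> = lam * S / (2 * D)"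
    have "\<kappa> > 0" using S D by (simp add: \<kappa>_def)
    from main[OF this] have "lam * S \<le> \<kappa> * D" by (simp add: D_def)
    also have "\<kappa> * D = lam * S / 2" using D by (simp add: \<kappa>_def)
    finally show False using S by linarith
  qed
  then show ?thesis using vS[of x] by simp
qed

section \<open>The stochastic integral\<close>

lemma partition_mono:
  assumes "is_partition t k p" "i \<le> j" "j \<le> k"
  shows "p i \<le> p j"
  using assms(2,3)
proof (induction j)
  case (Suc j)
  then show ?case using assms(1) by (cases "i = Suc j") (auto simp: is_partition_def intro: order_trans)
qed auto

lemma partition_range:
  assumes "is_partition t k p" "i \<le> k"
  shows "0 \<le> p i" "p i \<le> t"
  using partition_mono[OF assms(1), of 0 i] partition_mono[OF assms(1), of i k] assms
  by (auto simp: is_partition_def)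

text \<open>Intervals open on the left and closed on the right tile the interval from 0 to
  \<open>t\<close>, degenerate ones being empty, so a single summand survives: the one ending at the
  first partition point that reaches \<open>s\<close>. The surviving left endpoint is strictly
  before \<open>s\<close> and the right one is not, the position needed for right-continuous
  paths.\<close>

lemma partition_sum_indicator:
  fixes c :: "nat \<Rightarrow> 'b::real_vector"
  assumes P: "is_partition t k p" and s: "0 < s" "s \<le> t"
  obtains i where "i < k" "p i < s" "s \<le> p (Suc i)"
    "\<And>c :: nat \<Rightarrow> 'b. (\<Sum>i<k. indicator {p i<..p (Suc i)} s *\<^sub>R c i) = c i"
proof -
  define j where "j = (LEAST j. s \<le> p j)"
  have ex: "s \<le> p k" using P s by (simp add: is_partition_def)
  have j: "s \<le> p j" unfolding j_def by (rule LeastI[of _ k]) (rule ex)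
  have jk: "j \<le> k" unfolding j_def by (rule Least_le) (rule ex)
  have "j \<noteq> 0"
  proof
    assume "j = 0"
    with j s P show False by (simp add: is_partition_def)
  qed
  then obtain i where i: "j = Suc i" using not0_implies_Suc by blast
  have pi: "p i < s" using not_less_Least[of i "\<lambda>j. s \<le> p j"] i by (simp add: j_def[symmetric])
  have ik: "i < k" using jk i by simp
  have ind: "indicator {p l<..p (Suc l)} s *\<^sub>R c l = (if l = i then c i else 0)" if "l < k" for l and c :: "nat \<Rightarrow> 'b"
  proof -
    have "\<not> (p l < s \<and> s \<le> p (Suc l))" if "l \<noteq> i"
    proof (cases "l < i")
      case True
      then have "p (Suc l) \<le> p i" using partition_mono[OF P, of "Suc l" i] ik by simp
      then show ?thesis using pi by auto
    next
      case False
      then have "p (Suc i) \<le> p l" using partition_mono[OF P, of "Suc i" l] that \<open>l < k\<close> by simp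
      then show ?thesis using j i by auto
    qed
    then show ?thesis using pi j i by (auto simp: indicator_def)
  qed
  have "(\<Sum>l<k. indicator {p l<..p (Suc l)} s *\<^sub>R c l) = c i" for c :: "nat \<Rightarrow> 'b"
  proof -
    have "(\<Sum>l<k. indicator {p l<..p (Suc l)} s *\<^sub>R c l) = (\<Sum>l<k. if l = i then c i else 0)"
      using ind by (intro sum.cong) auto
    then show ?thesis using ik by simp
  qed
  with ik pi j i show ?thesis using that[of i] by auto
qed

text \<open>Both the path-wise construction of the stochastic integral and its characteristic function
  are limits of integrals of step functions, covered by one dominated convergence argument.\<close>

lemma riemann_step_tendsto:
  fixes c :: "real \<Rightarrow> real \<Rightarrow> real \<Rightarrow> 'b::{banach, second_countable_topology}"
  assumes P: "\<And>m. is_partition t (k m) (p m)"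
    and mesh: "\<And>\<delta>. \<delta> > 0 \<Longrightarrow> \<forall>\<^sub>F m in sequentially. \<forall>i<k m. p m (Suc i) - p m i < \<delta>"
    and c: "\<And>l r. (\<lambda>s. c s l r) \<in> borel_measurable borel"
    and bnd: "\<And>s l r. s \<in> {0..t} \<Longrightarrow> l \<in> {0..t} \<Longrightarrow> r \<in> {0..t} \<Longrightarrow> norm (c s l r) \<le> K"
    and lim: "\<And>s L R. s \<in> {0<..t} \<Longrightarrow> (\<And>m. L m \<in> {0..<s}) \<Longrightarrow> (\<And>m. R m \<in> {s..t}) \<Longrightarrow> L \<longlonglongrightarrow> s \<Longrightarrow> R \<longlonglongrightarrow> s \<Longrightarrow>
        (\<lambda>m. c s (L m) (R m)) \<longlonglongrightarrow> d s"
  shows "(\<lambda>m. \<Sum>i<k m. \<integral>s. indicator {p m i<..p m (Suc i)} s *\<^sub>R c s (p m i) (p m (Suc i)) \<partial>lborel)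
      \<longlonglongrightarrow> (\<integral>s. indicator {0<..t} s *\<^sub>R d s \<partial>lborel)"
    and "integrable lborel (\<lambda>s. indicator {0<..t} s *\<^sub>R d s)"
proof -
  \<comment> \<open>At each \<open>s\<close> a single interval contributes, and the mesh condition
    squeezes both of its endpoints towards \<open>s\<close>; \<open>lim\<close> then gives pointwise
    convergence.\<close>
  define S where "S m s = (\<Sum>i<k m. indicator {p m i<..p m (Suc i)} s *\<^sub>R c s (p m i) (p m (Suc i)))" for m s
  note [measurable] = c
  have Sm[measurable]: "S m \<in> borel_measurable borel" for m unfolding S_def by measurable
  have out: "S m s = 0" if "s \<notin> {0<..t}" for m s
  proof -
    have "indicator {p m i<..p m (Suc i)} s = (0 :: real)" if "i < k m" for i
      using partition_range[OF P, of i m] partition_range[OF P, of "Suc i" m] \<open>s \<notin> {0<..t}\<close> that by (auto simp: indicator_def)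
    then show ?thesis by (simp add: S_def)
  qed
  have inn: "\<exists>l r. l \<in> {0..<s} \<and> r \<in> {s..t} \<and> (\<exists>i<k m. l = p m i \<and> r = p m (Suc i)) \<and> S m s = c s l r" if s: "s \<in> {0<..t}" for m s
  proof -
    obtain i where i: "i < k m" "p m i < s" "s \<le> p m (Suc i)"
      "\<And>c :: nat \<Rightarrow> 'b. (\<Sum>i<k m. indicator {p m i<..p m (Suc i)} s *\<^sub>R c i) = c i"
      using partition_sum_indicator[OF P[of m]] s by (metis greaterThanAtMost_iff)
    have "S m s = c s (p m i) (p m (Suc i))" unfolding S_def by (rule i(4))
    moreover have "p m i \<in> {0..<s}" "p m (Suc i) \<in> {s..t}"
      using partition_range[OF P, of i m] partition_range[OF P, of "Suc i" m] i(1-3) by auto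
    ultimately show ?thesis using i(1) by blast
  qed
  have SK: "norm (S m s) \<le> \<bar>K\<bar> * indicator {0..t} s" for m s
  proof (cases "s \<in> {0<..t}")
    case True
    then obtain l r where "l \<in> {0..<s}" "r \<in> {s..t}" "S m s = c s l r" using inn by meson
    then show ?thesis using bnd[of s l r] True by auto
  qed (simp add: out)
  have Slim: "(\<lambda>m. S m s) \<longlonglongrightarrow> indicator {0<..t} s *\<^sub>R d s" for s
  proof (cases "s \<in> {0<..t}")
    case True
    then obtain L R where LR: "\<And>m. L m \<in> {0..<s}" "\<And>m. R m \<in> {s..t}"
      "\<And>m. \<exists>i<k m. L m = p m i \<and> R m = p m (Suc i)" "\<And>m. S m s = c s (L m) (R m)"
      using inn[OF True] by metis
    have near: "\<forall>\<^sub>F m in sequentially. R m - L m < \<delta>" if "\<delta> > 0" for \<delta>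
      using mesh[OF that] by eventually_elim (metis LR(3))
    have "L \<longlonglongrightarrow> s"
    proof (rule tendstoI)
      fix e :: real assume "e > 0"
      from near[OF this] show "\<forall>\<^sub>F m in sequentially. dist (L m) s < e"
      proof eventually_elim
        case (elim m)
        then show ?case using LR(1,2)[of m] by (auto simp: dist_real_def)
      qed
    qed
    moreover have "R \<longlonglongrightarrow> s"
    proof (rule tendstoI)
      fix e :: real assume "e > 0"
      from near[OF this] show "\<forall>\<^sub>F m in sequentially. dist (R m) s < e"
      proof eventually_elim
        case (elim m)
        then show ?case using LR(1,2)[of m] by (auto simp: dist_real_def)
      qed
    qed
    ultimately show ?thesis using lim[OF True LR(1,2)] True by (simp add: LR(4))
  qed (simp add: out)
  \<comment> \<open>Measurability of \<open>d\<close> is not among the hypotheses; it is inherited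
    from the step functions.\<close>
  have dm: "(\<lambda>s. indicator {0<..t} s *\<^sub>R d s) \<in> borel_measurable lborel"
    by (rule borel_measurable_LIMSEQ_metric[OF _ Slim]) simp
  have w: "integrable lborel (\<lambda>s. \<bar>K\<bar> * indicator {0..t} s)"
    by (intro integrable_mult_right integrable_real_indicator) (auto simp: emeasure_lborel_Icc_eq)
  have "(\<lambda>m. \<integral>s. S m s \<partial>lborel) \<longlonglongrightarrow> (\<integral>s. indicator {0<..t} s *\<^sub>R d s \<partial>lborel)"
    by (rule integral_dominated_convergence[OF dm _ w]) (use Slim SK in auto)
  moreover have "(\<integral>s. S m s \<partial>lborel) = (\<Sum>i<k m. \<integral>s. indicator {p m i<..p m (Suc i)} s *\<^sub>R c s (p m i) (p m (Suc i)) \<partial>lborel)" for m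
    unfolding S_def
  proof (rule Bochner_Integration.integral_sum)
    fix i assume "i \<in> {..<k m}"
    then have i: "i < k m" by simp
    show "integrable lborel (\<lambda>s. indicator {p m i<..p m (Suc i)} s *\<^sub>R c s (p m i) (p m (Suc i)))"
    proof (rule Bochner_Integration.integrable_bound[OF w])
      show "AE s in lborel. norm (indicator {p m i<..p m (Suc i)} s *\<^sub>R c s (p m i) (p m (Suc i))) \<le> norm (\<bar>K\<bar> * indicator {0..t} s)"
        using bnd[of _ "p m i" "p m (Suc i)"] partition_range[OF P, of i m] partition_range[OF P, of "Suc i" m] i
        by (intro AE_I2) (auto simp: indicator_def intro: order_trans[OF _ abs_ge_self])
    qed simp
  qed
  ultimately show "(\<lambda>m. \<Sum>i<k m. \<integral>s. indicator {p m i<..p m (Suc i)} s *\<^sub>R c s (p m i) (p m (Suc i)) \<partial>lborel)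
      \<longlonglongrightarrow> (\<integral>s. indicator {0<..t} s *\<^sub>R d s \<partial>lborel)" by simp
  show "integrable lborel (\<lambda>s. indicator {0<..t} s *\<^sub>R d s)"
    by (rule integrable_dominated_convergence[where s = S, OF dm _ w]) (auto intro!: AE_I2 Slim SK)
qed

lemma indicator_Ioc_integral:
  fixes f :: "real \<Rightarrow> 'b::{banach, second_countable_topology}"
  assumes [measurable]: "f \<in> borel_measurable borel"
  shows "(\<integral>s. indicator {a<..b} s *\<^sub>R f s \<partial>lborel) = (\<integral>s. indicator {a..b} s *\<^sub>R f s \<partial>lborel)"
proof (rule integral_cong_AE)
  have "AE s in lborel. s \<noteq> a" by (rule AE_lborel_singleton)
  then show "AE s in lborel. indicator {a<..b} s *\<^sub>R f s = indicator {a..b} s *\<^sub>R f s"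
    by eventually_elim (auto simp: indicator_def)
qed (auto)

section \<open>Right-continuous paths with left limits\<close>

lemma cadlag_bounded:
  assumes "cadlag f"
  obtains K where "\<And>s. s \<in> {0..t} \<Longrightarrow> norm (f s) \<le> K"
proof -
  have loc: "\<exists>U K. open U \<and> s \<in> U \<and> (\<forall>u\<in>U \<inter> {0..t}. norm (f u) \<le> K)" if s: "s \<in> {0..t}" for s
  proof -
    have "(f \<longlongrightarrow> f s) (at_right s)" using assms s by (simp add: cadlag_def)
    then have "\<forall>\<^sub>F u in at_right s. dist (f u) (f s) < 1" by (rule tendstoD) simp
    then have r: "\<forall>\<^sub>F u in at_right s. norm (f u) \<le> norm (f s) + 1"
      by eventually_elim (smt (verit) dist_norm norm_triangle_ineq2)
    \<comment> \<open>The guard is needed at \<open>s = 0\<close>, because values of a path at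
      negative times are unconstrained.\<close>
    have "\<exists>K. \<forall>\<^sub>F u in at_left s. u \<in> {0..t} \<longrightarrow> norm (f u) \<le> K"
    proof (cases "s = 0")
      case True
      then show ?thesis by (auto simp: eventually_at_filter)
    next
      case False
      then have "s > 0" using s by simp
      then obtain l where "(f \<longlongrightarrow> l) (at_left s)" using assms unfolding cadlag_def by blast
      then have "\<forall>\<^sub>F u in at_left s. dist (f u) l < 1" by (rule tendstoD) simp
      then have "\<forall>\<^sub>F u in at_left s. u \<in> {0..t} \<longrightarrow> norm (f u) \<le> norm l + 1"
        by eventually_elim (smt (verit) dist_norm norm_triangle_ineq2)
      then show ?thesis by blast
    qed
    then obtain K where l: "\<forall>\<^sub>F u in at_left s. u \<in> {0..t} \<longrightarrow> norm (f u) \<le> K" by blast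
    define K' where "K' = max K (norm (f s) + 1)"
    have "\<forall>\<^sub>F u in at s. u \<in> {0..t} \<longrightarrow> norm (f u) \<le> K'"
      unfolding eventually_at_split
    proof
      show "\<forall>\<^sub>F u in at_left s. u \<in> {0..t} \<longrightarrow> norm (f u) \<le> K'"
        using l by eventually_elim (auto simp: K'_def)
      show "\<forall>\<^sub>F u in at_right s. u \<in> {0..t} \<longrightarrow> norm (f u) \<le> K'"
        using r by eventually_elim (auto simp: K'_def)
    qed
    then obtain U where U: "open U" "s \<in> U" "\<forall>u\<in>U. u \<noteq> s \<longrightarrow> u \<in> {0..t} \<longrightarrow> norm (f u) \<le> K'"
      unfolding eventually_at_topological by auto
    have "\<forall>u\<in>U \<inter> {0..t}. norm (f u) \<le> K'"
      using U(3) by (auto simp: K'_def max_def)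
    then show ?thesis using U(1,2) by blast
  qed
  then obtain U K where UK: "\<And>s. s \<in> {0..t} \<Longrightarrow> open (U s) \<and> s \<in> U s \<and> (\<forall>u\<in>U s \<inter> {0..t}. norm (f u) \<le> K s)"
    by metis
  obtain C where C: "C \<subseteq> {0..t}" "finite C" "{0..t} \<subseteq> (\<Union>s\<in>C. U s)"
    using compactE_image[of "{0..t}" "{0..t}" U] UK by (metis UN_I compact_Icc subsetI)
  have "norm (f s) \<le> (\<Sum>c\<in>C. \<bar>K c\<bar>)" if s: "s \<in> {0..t}" for s
  proof -
    obtain c where c: "c \<in> C" "s \<in> U c" using C s by auto
    then have "norm (f s) \<le> K c" using UK[of c] C(1) s by blast
    also have "\<dots> \<le> \<bar>K c\<bar>" by simp
    also have "\<dots> \<le> (\<Sum>c\<in>C. \<bar>K c\<bar>)" using c C(2) by (intro member_le_sum) auto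
    finally show ?thesis .
  qed
  then show ?thesis using that by blast
qed

text \<open>The sequence may take the value \<open>s\<close> itself, hence the passage from
  \<open>at_right s\<close> to the filter within \<open>{s..}\<close>.\<close>

lemma cadlag_tendsto_from_right:
  assumes "cadlag f" "0 \<le> s" "\<And>m. s \<le> R m" "R \<longlonglongrightarrow> s"
  shows "(\<lambda>m. f (R m)) \<longlonglongrightarrow> f s"
proof -
  have "(f \<longlongrightarrow> f s) (at s within {s..})"
    using assms(1,2) by (simp add: cadlag_def at_within_Ici_at_right)
  then have "continuous (at s within {s..}) f" by (simp add: continuous_within)
  from continuous_within_tendsto_compose'[OF this, of R sequentially] show ?thesis
    using assms(3,4) by auto
qed

text \<open>Summation by parts turns the left-point sums into integrals of \<open>F'\<close> against step
  approximations of the path.\<close>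

lemma riemann_sum_tendsto_pathwise:
  fixes z :: "real \<Rightarrow> real^'d" and F F' :: "real \<Rightarrow> real^'d^'n"
  assumes P: "\<And>m. is_partition t (k m) (p m)"
    and mesh: "\<And>\<delta>. \<delta> > 0 \<Longrightarrow> \<forall>\<^sub>F m in sequentially. \<forall>i<k m. p m (Suc i) - p m i < \<delta>"
    and z: "cadlag z"
    and F: "\<And>s. (F has_vector_derivative F' s) (at s)" and F': "continuous_on UNIV F'"
  shows "(\<lambda>m. \<Sum>i<k m. F (p m i) *v (z (p m (Suc i)) - z (p m i))) \<longlonglongrightarrow>
      F t *v z t - F 0 *v z 0 - (\<integral>s. indicator {0<..t} s *\<^sub>R (F' s *v z s) \<partial>lborel)"
proof -
  have Gc: "continuous_on UNIV (\<lambda>s. F' s *v x)" for x :: "real^'d"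
    by (intro continuous_on_matrix_vector_mult' F' continuous_on_const)
  have Gd: "((\<lambda>s. F s *v x) has_vector_derivative F' s *v x) (at s)" for x s
    using bounded_linear.has_vector_derivative[OF bounded_bilinear.bounded_linear_left[OF bounded_bilinear_matrix_vector_mult] F] .
  obtain Kz where Kz: "\<And>s. s \<in> {0..t} \<Longrightarrow> norm (z s) \<le> Kz" using cadlag_bounded[OF z] by metis
  have "compact (F' ` {0..t})" by (intro compact_continuous_image continuous_on_subset[OF F']) auto
  then obtain KF where KF: "\<And>s. s \<in> {0..t} \<Longrightarrow> norm (F' s) \<le> KF"
    using compact_imp_bounded by (fastforce simp: bounded_iff)
  obtain C where C: "C > 0" "\<And>(a :: real^'d^'n) b. norm (a *v b) \<le> norm a * norm b * C"
    using bounded_bilinear.pos_bounded[OF bounded_bilinear_matrix_vector_mult] by blast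
  have lim: "(\<lambda>m. \<Sum>i<k m. \<integral>s. indicator {p m i<..p m (Suc i)} s *\<^sub>R (F' s *v z (p m (Suc i))) \<partial>lborel)
      \<longlonglongrightarrow> (\<integral>s. indicator {0<..t} s *\<^sub>R (F' s *v z s) \<partial>lborel)"
  proof (rule riemann_step_tendsto(1)[where c = "\<lambda>s l r. F' s *v z r" and K = "KF * Kz * C", OF P mesh])
    show "(\<lambda>s. F' s *v z r) \<in> borel_measurable borel" for r
      by (intro borel_measurable_continuous_onI Gc)
    show "norm (F' s *v z r) \<le> KF * Kz * C" if "s \<in> {0..t}" "r \<in> {0..t}" for s r
    proof -
      have "norm (F' s) * norm (z r) \<le> KF * Kz"
        using KF[OF that(1)] Kz[OF that(2)] norm_ge_zero order_trans by (intro mult_mono) (auto intro: order_trans[OF norm_ge_zero])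
      then show ?thesis using C(2)[of "F' s" "z r"] mult_right_mono[of _ "KF * Kz" C] C(1) by (meson less_imp_le order_trans)
    qed
    show "(\<lambda>m. F' s *v z (R m)) \<longlonglongrightarrow> F' s *v z s"
      if "s \<in> {0<..t}" "\<And>m. R m \<in> {s..t}" "R \<longlonglongrightarrow> s" for s R
      using that by (intro tendsto_matrix_vector_mult' tendsto_const cadlag_tendsto_from_right[OF z]) auto
  qed auto
  have "(\<Sum>i<k m. F (p m i) *v (z (p m (Suc i)) - z (p m i))) = F t *v z t - F 0 *v z 0 -
     (\<Sum>i<k m. \<integral>s. indicator {p m i<..p m (Suc i)} s *\<^sub>R (F' s *v z (p m (Suc i))) \<partial>lborel)" for m
  proof -
    have ftc: "(\<integral>s. indicator {p m i<..p m (Suc i)} s *\<^sub>R (F' s *v x) \<partial>lborel) = F (p m (Suc i)) *v x - F (p m i) *v x"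
      if "i < k m" for i and x :: "real^'d"
    proof -
      have le: "p m i \<le> p m (Suc i)" using P[of m] that by (simp add: is_partition_def)
      have "(\<integral>s. indicator {p m i<..p m (Suc i)} s *\<^sub>R (F' s *v x) \<partial>lborel) = (\<integral>s. indicator {p m i..p m (Suc i)} s *\<^sub>R (F' s *v x) \<partial>lborel)"
        by (intro indicator_Ioc_integral borel_measurable_continuous_onI Gc)
      also have "\<dots> = F (p m (Suc i)) *v x - F (p m i) *v x"
        by (rule integral_FTC_atLeastAtMost[OF le])
           (auto intro: has_vector_derivative_at_within Gd continuous_on_subset[OF Gc])
      finally show ?thesis .
    qed
    \<comment> \<open>Each left-point term is an increment of \<open>F *v z\<close> minus the
      increment of \<open>F\<close> applied to \<open>z\<close> at the right endpoint. Right
      continuity of the path thus governs the limit, and left limits enter only through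
      boundedness.\<close>
    have "(\<Sum>i<k m. F (p m i) *v (z (p m (Suc i)) - z (p m i))) =
        (\<Sum>i<k m. (F (p m (Suc i)) *v z (p m (Suc i)) - F (p m i) *v z (p m i))
          - (F (p m (Suc i)) *v z (p m (Suc i)) - F (p m i) *v z (p m (Suc i))))"
      by (intro sum.cong refl) (simp add: matrix_vector_mult_diff_distrib)
    also have "\<dots> = (\<Sum>i<k m. F (p m (Suc i)) *v z (p m (Suc i)) - F (p m i) *v z (p m i))
        - (\<Sum>i<k m. F (p m (Suc i)) *v z (p m (Suc i)) - F (p m i) *v z (p m (Suc i)))"
      by (rule sum_subtractf)
    also have "(\<Sum>i<k m. F (p m (Suc i)) *v z (p m (Suc i)) - F (p m i) *v z (p m i)) = F t *v z t - F 0 *v z 0"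
      using P[of m] by (subst sum_lessThan_telescope) (simp add: is_partition_def)
    also have "(\<Sum>i<k m. F (p m (Suc i)) *v z (p m (Suc i)) - F (p m i) *v z (p m (Suc i))) =
      (\<Sum>i<k m. \<integral>s. indicator {p m i<..p m (Suc i)} s *\<^sub>R (F' s *v z (p m (Suc i))) \<partial>lborel)"
      by (intro sum.cong refl ftc[symmetric]) simp
    finally show ?thesis .
  qed
  then show ?thesis using tendsto_diff[OF tendsto_const lim] by simp
qed

section \<open>Uniform partitions and existence of the stochastic integral\<close>

definition unif_part :: "real \<Rightarrow> nat \<Rightarrow> nat \<Rightarrow> real" where
  "unif_part t m i = t * (real i / real (Suc m))"

lemma is_partition_unif_part: "0 \<le> t \<Longrightarrow> is_partition t (Suc m) (unif_part t m)"
  by (auto simp: is_partition_def unif_part_def intro!: mult_left_mono divide_right_mono)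

lemma unif_part_mesh:
  assumes "\<delta> > 0"
  shows "\<forall>\<^sub>F m in sequentially. \<forall>i<Suc m. unif_part t m (Suc i) - unif_part t m i < \<delta>"
proof -
  have "(\<lambda>m. t * (1 / real (Suc m))) \<longlonglongrightarrow> t * 0"
    by (intro tendsto_intros LIMSEQ_Suc lim_inverse_n'[unfolded inverse_eq_divide])
  then have "\<forall>\<^sub>F m in sequentially. t * (1 / real (Suc m)) < \<delta>"
    using assms by (intro order_tendstoD) auto
  then show ?thesis
    by eventually_elim (simp add: unif_part_def add_divide_distrib distrib_left del: of_nat_Suc, simp add: diff_divide_distrib[symmetric] right_diff_distrib[symmetric])
qed

lemma (in prob_space) AE_tendsto_imp_tendsto_prob:
  fixes X :: "nat \<Rightarrow> 'a \<Rightarrow> 'b::{second_countable_topology, real_normed_vector}"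
  assumes [measurable]: "\<And>m. X m \<in> borel_measurable M" "Y \<in> borel_measurable M"
    and ae: "AE \<omega> in M. (\<lambda>m. X m \<omega>) \<longlonglongrightarrow> Y \<omega>" and e: "\<epsilon> > 0"
  shows "(\<lambda>m. measure M {\<omega>\<in>space M. norm (X m \<omega> - Y \<omega>) > \<epsilon>}) \<longlonglongrightarrow> 0"
proof -
  have "(\<lambda>m. \<integral>\<omega>. indicator {\<omega>\<in>space M. norm (X m \<omega> - Y \<omega>) > \<epsilon>} \<omega> \<partial>M) \<longlonglongrightarrow> (\<integral>\<omega>. (0 :: real) \<partial>M)"
  proof (rule integral_dominated_convergence[where w = "\<lambda>_. 1"])
    show "AE \<omega> in M. (\<lambda>m. indicator {\<omega>\<in>space M. norm (X m \<omega> - Y \<omega>) > \<epsilon>} \<omega> :: real) \<longlonglongrightarrow> 0"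
      using ae
    proof eventually_elim
      case (elim \<omega>)
      have "\<forall>\<^sub>F m in sequentially. norm (X m \<omega> - Y \<omega>) < \<epsilon>" using tendstoD[OF elim e] by (simp add: dist_norm)
      then have "\<forall>\<^sub>F m in sequentially. (indicator {\<omega>\<in>space M. norm (X m \<omega> - Y \<omega>) > \<epsilon>} \<omega> :: real) = 0"
        by eventually_elim (auto simp: indicator_def)
      then show ?case by (rule tendsto_eventually)
    qed
  qed (auto simp: indicator_def)
  moreover have "(\<integral>\<omega>. indicator {\<omega>\<in>space M. norm (X m \<omega> - Y \<omega>) > \<epsilon>} \<omega> \<partial>M) = measure M {\<omega>\<in>space M. norm (X m \<omega> - Y \<omega>) > \<epsilon>}" for m
  proof -
    have "{\<omega>\<in>space M. norm (X m \<omega> - Y \<omega>) > \<epsilon>} \<inter> space M = {\<omega>\<in>space M. norm (X m \<omega> - Y \<omega>) > \<epsilon>}" by auto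
    then show ?thesis by simp
  qed
  ultimately show ?thesis by simp
qed

lemma riemann_sum_measurable:
  assumes "levy_process M Z" "is_partition t k p"
  shows "riemann_sum Z F k p \<in> borel_measurable M"
proof -
  have [measurable]: "Z (p i) \<in> borel_measurable M" if "i \<le> k" for i
    using assms(1) partition_range(1)[OF assms(2) that] by (simp add: levy_process_def)
  have c: "continuous_on UNIV (\<lambda>x. F s *v x)" for s
    by (intro continuous_intros)
  show ?thesis unfolding riemann_sum_def
    by (intro borel_measurable_sum measurable_compose[OF _ borel_measurable_continuous_onI[OF c]] borel_measurable_diff) auto
qed

text \<open>The choice by \<open>SOME\<close> carries no information until a witness exists. For
  differentiable \<open>F\<close> almost every path gives convergence of the sums to a value that
  does not depend on the sequence of partitions, and almost sure convergence implies convergence in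
  probability.\<close>

lemma is_stoch_integral_stoch_integral:
  fixes Z :: "real \<Rightarrow> 'w \<Rightarrow> real^'d" and F F' :: "real \<Rightarrow> real^'d^'n"
  assumes Z: "levy_process M Z" and t: "0 \<le> t"
    and F: "\<And>s. (F has_vector_derivative F' s) (at s)" and F': "continuous_on UNIV F'"
  shows "is_stoch_integral M Z F t (stoch_integral M Z F t)"
proof -
  interpret prob_space M using Z by (simp add: levy_process_def)
  \<comment> \<open>Defined as a limit along one fixed sequence instead of by the pathwise formula
    with its integral over \<open>s\<close>, so that measurability in \<open>\<omega>\<close> comes
    from the sums.\<close>
  define I where "I \<omega> = lim (\<lambda>m. riemann_sum Z F (Suc m) (unif_part t m) \<omega>)" for \<omega>
  have Im: "I \<in> borel_measurable M" unfolding I_def[abs_def]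
    by (intro borel_measurable_lim_metric riemann_sum_measurable[OF Z is_partition_unif_part[OF t]])
  have cad: "AE \<omega> in M. cadlag (\<lambda>t. Z t \<omega>)" using Z by (simp add: levy_process_def)
  have "is_stoch_integral M Z F t I" unfolding is_stoch_integral_def
  proof (intro conjI allI impI Im)
    fix k :: "nat \<Rightarrow> nat" and p :: "nat \<Rightarrow> nat \<Rightarrow> real" and \<epsilon> :: real
    assume a: "(\<forall>m. is_partition t (k m) (p m)) \<and> (\<forall>\<delta>>0. \<forall>\<^sub>F m in sequentially. \<forall>i<k m. p m (Suc i) - p m i < \<delta>)"
      and e: "\<epsilon> > 0"
    show "(\<lambda>m. measure M {\<omega>\<in>space M. norm (riemann_sum Z F (k m) (p m) \<omega> - I \<omega>) > \<epsilon>}) \<longlonglongrightarrow> 0"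
    proof (rule AE_tendsto_imp_tendsto_prob[OF _ Im _ e])
      show "riemann_sum Z F (k m) (p m) \<in> borel_measurable M" for m
        using riemann_sum_measurable[OF Z] a by blast
      show "AE \<omega> in M. (\<lambda>m. riemann_sum Z F (k m) (p m) \<omega>) \<longlonglongrightarrow> I \<omega>"
        using cad
      proof eventually_elim
        case (elim \<omega>)
        have 1: "(\<lambda>m. riemann_sum Z F (Suc m) (unif_part t m) \<omega>) \<longlonglongrightarrow>
            F t *v Z t \<omega> - F 0 *v Z 0 \<omega> - (\<integral>s. indicator {0<..t} s *\<^sub>R (F' s *v Z s \<omega>) \<partial>lborel)"
          unfolding riemann_sum_def
          by (rule riemann_sum_tendsto_pathwise[OF is_partition_unif_part[OF t] unif_part_mesh elim F F'])
        have 2: "(\<lambda>m. riemann_sum Z F (k m) (p m) \<omega>) \<longlonglongrightarrow>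
            F t *v Z t \<omega> - F 0 *v Z 0 \<omega> - (\<integral>s. indicator {0<..t} s *\<^sub>R (F' s *v Z s \<omega>) \<partial>lborel)"
          unfolding riemann_sum_def
          by (rule riemann_sum_tendsto_pathwise[OF _ _ elim F F']) (use a in auto)
        show ?case unfolding I_def limI[OF 1] by (rule 2)
      qed
    qed
  qed
  then show ?thesis unfolding stoch_integral_def by (rule someI[of "is_stoch_integral M Z F t"])
qed

section \<open>Characteristic functions\<close>

lemma norm_iexp_diff_le: "norm (exp (\<i> * of_real a) - exp (\<i> * of_real b)) \<le> \<bar>a - b\<bar>" for a b :: real
proof -
  have "exp (\<i> * complex_of_real a) - exp (\<i> * complex_of_real b) = exp (\<i> * of_real b) * (exp (\<i> * of_real (a - b)) - 1)"
    by (simp add: algebra_simps flip: exp_add)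
  then have "norm (exp (\<i> * complex_of_real a) - exp (\<i> * complex_of_real b)) = norm (exp (\<i> * of_real (a - b)) - 1)"
    by (simp add: norm_mult)
  also have "\<dots> \<le> \<bar>a - b\<bar>" using iexp_approx1[of "a - b" 0] by simp
  finally show ?thesis .
qed

text \<open>The function \<open>exp (\<i> * of_real (q \<bullet> x))\<close> of \<open>x\<close> is
  bounded by 1 and Lipschitz with constant \<open>norm q\<close>. The Lipschitz bound is used where
  \<open>X m\<close> and \<open>Y\<close> are close, the trivial bound 2 on the event where they are
  not.\<close>

lemma (in prob_space) char_tendsto_of_tendsto_prob:
  fixes X :: "nat \<Rightarrow> 'a \<Rightarrow> real^'n"
  assumes [measurable]: "\<And>m. X m \<in> borel_measurable M" "Y \<in> borel_measurable M"
    and pr: "\<And>\<epsilon>. \<epsilon> > 0 \<Longrightarrow> (\<lambda>m. measure M {\<omega>\<in>space M. norm (X m \<omega> - Y \<omega>) > \<epsilon>}) \<longlonglongrightarrow> 0"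
  shows "(\<lambda>m. \<integral>\<omega>. exp (\<i> * of_real (q \<bullet> X m \<omega>)) \<partial>M) \<longlonglongrightarrow> (\<integral>\<omega>. exp (\<i> * of_real (q \<bullet> Y \<omega>)) \<partial>M)"
proof (rule LIMSEQ_I)
  fix e :: real assume e: "e > 0"
  \<comment> \<open>The added 1 keeps \<open>N\<close> positive for \<open>q = 0\<close>. With
    \<open>d\<close> below, the Lipschitz part is at most \<open>e / 4\<close>, and the exceptional
    event will contribute less than \<open>e / 2\<close>.\<close>
  define N where "N = norm q + 1"
  have N: "N > 0" using norm_ge_zero[of q] by (simp add: N_def add_nonneg_pos)
  define d where "d = e / (4 * N)"
  have d: "d > 0" using e N by (simp add: d_def)
  have qd: "norm q * d \<le> e / 4"
  proof -
    have "norm q * d \<le> N * d" using d by (intro mult_right_mono) (auto simp: N_def)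
    also have "\<dots> = e / 4" unfolding d_def using N by simp
    finally show ?thesis .
  qed
  define S where "S m = {\<omega>\<in>space M. norm (X m \<omega> - Y \<omega>) > d}" for m
  have Sm[measurable]: "S m \<in> sets M" for m unfolding S_def by measurable
  have ie: "integrable M (\<lambda>\<omega>. exp (\<i> * of_real (q \<bullet> V \<omega>)))" if [measurable]: "V \<in> borel_measurable M" for V :: "'a \<Rightarrow> real^'n"
    by (rule integrable_const_bound[of _ 1]) auto
  have bd: "norm ((\<integral>\<omega>. exp (\<i> * of_real (q \<bullet> X m \<omega>)) \<partial>M) - (\<integral>\<omega>. exp (\<i> * of_real (q \<bullet> Y \<omega>)) \<partial>M)) \<le> e / 4 + 2 * measure M (S m)" for m
  proof -
    have "norm ((\<integral>\<omega>. exp (\<i> * of_real (q \<bullet> X m \<omega>)) \<partial>M) - (\<integral>\<omega>. exp (\<i> * of_real (q \<bullet> Y \<omega>)) \<partial>M))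
       = norm (\<integral>\<omega>. exp (\<i> * of_real (q \<bullet> X m \<omega>)) - exp (\<i> * of_real (q \<bullet> Y \<omega>)) \<partial>M)"
      using ie by (subst Bochner_Integration.integral_diff) auto
    also have "\<dots> \<le> (\<integral>\<omega>. norm (exp (\<i> * of_real (q \<bullet> X m \<omega>)) - exp (\<i> * of_real (q \<bullet> Y \<omega>))) \<partial>M)"
      by (rule integral_norm_bound)
    also have "\<dots> \<le> (\<integral>\<omega>. e / 4 + 2 * indicator (S m) \<omega> \<partial>M)"
    proof (rule integral_mono_AE)
      show "integrable M (\<lambda>\<omega>. norm (exp (\<i> * of_real (q \<bullet> X m \<omega>)) - exp (\<i> * of_real (q \<bullet> Y \<omega>))))"
        using ie by (intro integrable_norm Bochner_Integration.integrable_diff) auto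
      show "AE \<omega> in M. norm (exp (\<i> * of_real (q \<bullet> X m \<omega>)) - exp (\<i> * of_real (q \<bullet> Y \<omega>))) \<le> e / 4 + 2 * indicator (S m) \<omega>"
      proof (rule AE_I2)
        fix \<omega> assume w: "\<omega> \<in> space M"
        show "norm (exp (\<i> * of_real (q \<bullet> X m \<omega>)) - exp (\<i> * of_real (q \<bullet> Y \<omega>))) \<le> e / 4 + 2 * indicator (S m) \<omega>"
        proof (cases "\<omega> \<in> S m")
          case True
          have "norm (exp (\<i> * of_real (q \<bullet> X m \<omega>)) - exp (\<i> * of_real (q \<bullet> Y \<omega>))) \<le> 1 + 1"
            by (rule order_trans[OF norm_triangle_ineq4]) simp
          then show ?thesis using True e by simp
        next
          case False
          have "norm (exp (\<i> * of_real (q \<bullet> X m \<omega>)) - exp (\<i> * of_real (q \<bullet> Y \<omega>))) \<le> \<bar>q \<bullet> X m \<omega> - q \<bullet> Y \<omega>\<bar>"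
            by (rule norm_iexp_diff_le)
          also have "\<dots> = \<bar>q \<bullet> (X m \<omega> - Y \<omega>)\<bar>" by (simp add: inner_diff_right)
          also have "\<dots> \<le> norm q * norm (X m \<omega> - Y \<omega>)" by (rule Cauchy_Schwarz_ineq2)
          also have "\<dots> \<le> norm q * d" using False w by (intro mult_left_mono) (auto simp: S_def)
          finally show ?thesis using qd False by simp
        qed
      qed
      show "integrable M (\<lambda>\<omega>. e / 4 + 2 * indicator (S m) \<omega>)"
        by (intro Bochner_Integration.integrable_add integrable_const integrable_mult_right integrable_real_indicator Sm)
           (simp add: less_top[symmetric])
    qed
    also have "\<dots> = e / 4 + 2 * measure M (S m)"
    proof -
      have "integrable M (indicator (S m) :: 'a \<Rightarrow> real)"
        by (intro integrable_real_indicator Sm) (simp add: less_top[symmetric])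
      then show ?thesis
        by (subst Bochner_Integration.integral_add) (auto simp: prob_space Int_absorb2 sets.sets_into_space[OF Sm])
    qed
    finally show ?thesis .
  qed
  have "\<forall>\<^sub>F m in sequentially. measure M (S m) < e / 4"
    using order_tendstoD(2)[OF pr[OF d], of "e / 4"] e by (simp add: S_def)
  then obtain N where N: "\<And>m. m \<ge> N \<Longrightarrow> measure M (S m) < e / 4" by (auto simp: eventually_sequentially)
  show "\<exists>N. \<forall>m\<ge>N. norm ((\<integral>\<omega>. exp (\<i> * of_real (q \<bullet> X m \<omega>)) \<partial>M) - (\<integral>\<omega>. exp (\<i> * of_real (q \<bullet> Y \<omega>)) \<partial>M)) < e"
  proof (intro exI[of _ N] allI impI)
    fix m assume "m \<ge> N"
    from N[OF this] bd[of m] e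
    show "norm ((\<integral>\<omega>. exp (\<i> * of_real (q \<bullet> X m \<omega>)) \<partial>M) - (\<integral>\<omega>. exp (\<i> * of_real (q \<bullet> Y \<omega>)) \<partial>M)) < e" by linarith
  qed
qed

text \<open>Independence of the increments factorises the expectation, stationarity replaces each
  increment by \<open>Z\<close> at the length of its interval, and the matrix moves to the frequency
  as a transpose.\<close>

lemma char_riemann_sum:
  fixes Z :: "real \<Rightarrow> 'w \<Rightarrow> real^'d" and F :: "real \<Rightarrow> real^'d^'n"
  assumes Z: "levy_process M Z"
    and char: "\<And>t p. 0 \<le> t \<Longrightarrow> (\<integral>\<omega>. exp (\<i> * of_real (p \<bullet> Z t \<omega>)) \<partial>M) = exp (- of_real t * \<Phi> p)"
    and P: "is_partition t k p"
  shows "(\<integral>\<omega>. exp (\<i> * of_real (q \<bullet> riemann_sum Z F k p \<omega>)) \<partial>M) =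
      exp (- (\<Sum>i<k. of_real (p (Suc i) - p i) * \<Phi> (transpose (F (p i)) *v q)))"
proof -
  interpret prob_space M using Z by (simp add: levy_process_def)
  have mono: "p i \<le> p (Suc i)" if "i < k" for i using P that by (simp add: is_partition_def)
  have ind: "indep_vars (\<lambda>_. borel) (\<lambda>i \<omega>. Z (p (Suc i)) \<omega> - Z (p i) \<omega>) {..<k}"
    using Z P unfolding levy_process_def is_partition_def by auto
  have [measurable]: "Z s \<in> borel_measurable M" if "0 \<le> s" for s using Z that by (simp add: levy_process_def)
  have em: "(\<lambda>x :: real^'d. exp (\<i> * of_real (q' \<bullet> x))) \<in> borel_measurable borel" for q'
    by measurable
  have eq: "exp (\<i> * of_real (q \<bullet> riemann_sum Z F k p \<omega>)) =
      (\<Prod>i<k. exp (\<i> * of_real ((transpose (F (p i)) *v q) \<bullet> (Z (p (Suc i)) \<omega> - Z (p i) \<omega>))))" for \<omega>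
    by (simp add: riemann_sum_def inner_sum_right exp_sum[symmetric] sum_distrib_left transpose_matrix_vector dot_lmul_matrix)
  have "(\<integral>\<omega>. exp (\<i> * of_real (q \<bullet> riemann_sum Z F k p \<omega>)) \<partial>M) =
      (\<Prod>i<k. \<integral>\<omega>. exp (\<i> * of_real ((transpose (F (p i)) *v q) \<bullet> (Z (p (Suc i)) \<omega> - Z (p i) \<omega>))) \<partial>M)"
    unfolding eq
  proof (rule indep_vars_lebesgue_integral)
    show "indep_vars (\<lambda>_. borel) (\<lambda>i \<omega>. exp (\<i> * of_real ((transpose (F (p i)) *v q) \<bullet> (Z (p (Suc i)) \<omega> - Z (p i) \<omega>)))) {..<k}"
      by (rule indep_vars_compose2[OF ind]) (rule em)
    fix i assume "i \<in> {..<k}"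
    then have [measurable]: "Z (p (Suc i)) \<in> borel_measurable M" "Z (p i) \<in> borel_measurable M"
      using partition_range[OF P] by auto
    show "integrable M (\<lambda>\<omega>. exp (\<i> * of_real ((transpose (F (p i)) *v q) \<bullet> (Z (p (Suc i)) \<omega> - Z (p i) \<omega>))))"
      by (rule integrable_const_bound[of _ 1]) auto
  qed simp
  also have "\<dots> = (\<Prod>i<k. exp (- of_real (p (Suc i) - p i) * \<Phi> (transpose (F (p i)) *v q)))"
  proof (rule prod.cong[OF refl])
    fix i assume "i \<in> {..<k}"
    then have i: "i < k" by simp
    define s where "s = p i" define h where "h = p (Suc i) - p i"
    have sh: "0 \<le> s" "0 \<le> h" "p (Suc i) = s + h"
      using partition_range[OF P, of i] i mono[OF i] by (auto simp: s_def h_def)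
    have d: "distr M borel (\<lambda>\<omega>. Z (s + h) \<omega> - Z s \<omega>) = distr M borel (Z h)"
      using Z sh by (simp add: levy_process_def)
    define r where "r = transpose (F s) *v q"
    have "(\<integral>\<omega>. exp (\<i> * of_real (r \<bullet> (Z (s + h) \<omega> - Z s \<omega>))) \<partial>M) = (\<integral>x. exp (\<i> * of_real (r \<bullet> x)) \<partial>distr M borel (\<lambda>\<omega>. Z (s + h) \<omega> - Z s \<omega>))"
      using sh by (subst integral_distr) auto
    also have "\<dots> = (\<integral>\<omega>. exp (\<i> * of_real (r \<bullet> Z h \<omega>)) \<partial>M)"
      unfolding d using sh by (subst integral_distr) auto
    also have "\<dots> = exp (- of_real h * \<Phi> r)" by (rule char[OF sh(2)])
    finally show "(\<integral>\<omega>. exp (\<i> * of_real ((transpose (F (p i)) *v q) \<bullet> (Z (p (Suc i)) \<omega> - Z (p i) \<omega>))) \<partial>M) =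
       exp (- of_real (p (Suc i) - p i) * \<Phi> (transpose (F (p i)) *v q))"
      unfolding sh(3) s_def[symmetric] r_def[symmetric] by simp
  qed
  also have "\<dots> = exp (- (\<Sum>i<k. of_real (p (Suc i) - p i) * \<Phi> (transpose (F (p i)) *v q)))"
    by (simp only: sum_negf[symmetric] exp_sum[OF finite_lessThan] mult_minus_left)
  finally show ?thesis .
qed

lemma riemann_sum_continuous_tendsto:
  fixes h :: "real \<Rightarrow> complex"
  assumes t: "0 \<le> t" and h: "continuous_on UNIV h"
  shows "(\<lambda>m. \<Sum>i<Suc m. of_real (unif_part t m (Suc i) - unif_part t m i) * h (unif_part t m i)) \<longlonglongrightarrow>
      (\<integral>s. indicator {0..t} s *\<^sub>R h s \<partial>lborel)"
proof -
  note P = is_partition_unif_part[OF t]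
  have "compact (h ` {0..t})" by (intro compact_continuous_image continuous_on_subset[OF h]) auto
  then obtain K where K: "\<And>s. s \<in> {0..t} \<Longrightarrow> norm (h s) \<le> K"
    using compact_imp_bounded by (fastforce simp: bounded_iff)
  have "(\<lambda>m. \<Sum>i<Suc m. \<integral>s. indicator {unif_part t m i<..unif_part t m (Suc i)} s *\<^sub>R h (unif_part t m i) \<partial>lborel) \<longlonglongrightarrow>
      (\<integral>s. indicator {0<..t} s *\<^sub>R h s \<partial>lborel)"
  proof (rule riemann_step_tendsto(1)[where c = "\<lambda>s l r. h l", OF P unif_part_mesh])
    show "(\<lambda>m. h (L m)) \<longlonglongrightarrow> h s" if "L \<longlonglongrightarrow> s" for L s
      using h that by (auto intro: isCont_tendsto_compose simp: continuous_on_eq_continuous_at)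
  qed (use K in auto)
  also have "(\<integral>s. indicator {0<..t} s *\<^sub>R h s \<partial>lborel) = (\<integral>s. indicator {0..t} s *\<^sub>R h s \<partial>lborel)"
    by (intro indicator_Ioc_integral borel_measurable_continuous_onI h)
  finally have L: "(\<lambda>m. \<Sum>i<Suc m. \<integral>s. indicator {unif_part t m i<..unif_part t m (Suc i)} s *\<^sub>R h (unif_part t m i) \<partial>lborel) \<longlonglongrightarrow>
      (\<integral>s. indicator {0..t} s *\<^sub>R h s \<partial>lborel)" .
  have "(\<integral>s. indicator {unif_part t m i<..unif_part t m (Suc i)} s *\<^sub>R h (unif_part t m i) \<partial>lborel) =
      of_real (unif_part t m (Suc i) - unif_part t m i) * h (unif_part t m i)" if "i < Suc m" for m i
  proof -
    have "unif_part t m i \<le> unif_part t m (Suc i)" using P[of m] that by (auto simp: is_partition_def)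
    then show ?thesis
      by (subst integral_scaleR_left) (auto simp: emeasure_lborel_Ioc integrable_indicator_iff scaleR_conv_of_real)
  qed
  then have "(\<Sum>i<Suc m. \<integral>s. indicator {unif_part t m i<..unif_part t m (Suc i)} s *\<^sub>R h (unif_part t m i) \<partial>lborel) =
      (\<Sum>i<Suc m. of_real (unif_part t m (Suc i) - unif_part t m i) * h (unif_part t m i))" for m
    by (intro sum.cong) auto
  then show ?thesis using L by (simp only:)
qed

text \<open>Both sides are limits along uniform partitions: convergence in probability handles the
  left, and in the exponent on the right the sums are Riemann sums of a continuous function.\<close>

lemma char_stoch_integral:
  fixes Z :: "real \<Rightarrow> 'w \<Rightarrow> real^'d" and F F' :: "real \<Rightarrow> real^'d^'n"
  assumes Z: "levy_process M Z"
    and char: "\<And>t p. 0 \<le> t \<Longrightarrow> (\<integral>\<omega>. exp (\<i> * of_real (p \<bullet> Z t \<omega>)) \<partial>M) = exp (- of_real t * \<Phi> p)"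
    and \<Phi>: "continuous_on UNIV \<Phi>" and t: "0 \<le> t"
    and F: "\<And>s. (F has_vector_derivative F' s) (at s)" and F': "continuous_on UNIV F'"
  shows "(\<integral>\<omega>. exp (\<i> * of_real (q \<bullet> stoch_integral M Z F t \<omega>)) \<partial>M) =
      exp (- (\<integral>s. indicator {0..t} s *\<^sub>R \<Phi> (transpose (F s) *v q) \<partial>lborel))"
proof -
  interpret prob_space M using Z by (simp add: levy_process_def)
  note P = is_partition_unif_part[OF t]
  have si: "is_stoch_integral M Z F t (stoch_integral M Z F t)"
    by (rule is_stoch_integral_stoch_integral[OF Z t F F'])
  have Fc: "continuous_on UNIV F"
    using F by (intro continuous_at_imp_continuous_on ballI) (blast intro: has_vector_derivative_continuous)
  have hc: "continuous_on UNIV (\<lambda>s. \<Phi> (transpose (F s) *v q))"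
  proof (rule continuous_on_compose2[OF \<Phi>])
    have "continuous_on UNIV (\<lambda>s. transpose (F s))"
      unfolding transpose_def by (intro continuous_on_vec_lambda continuous_intros Fc)
    then show "continuous_on UNIV (\<lambda>s. transpose (F s) *v q)"
      by (intro continuous_on_matrix_vector_mult' continuous_on_const)
  qed simp
  have 1: "(\<lambda>m. \<integral>\<omega>. exp (\<i> * of_real (q \<bullet> riemann_sum Z F (Suc m) (unif_part t m) \<omega>)) \<partial>M) \<longlonglongrightarrow>
      (\<integral>\<omega>. exp (\<i> * of_real (q \<bullet> stoch_integral M Z F t \<omega>)) \<partial>M)"
  proof (rule char_tendsto_of_tendsto_prob)
    show "riemann_sum Z F (Suc m) (unif_part t m) \<in> borel_measurable M" for m
      by (rule riemann_sum_measurable[OF Z P])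
    show "stoch_integral M Z F t \<in> borel_measurable M" using si by (simp add: is_stoch_integral_def)
    have "(\<forall>m. is_partition t (Suc m) (unif_part t m)) \<and> (\<forall>\<delta>>0. \<forall>\<^sub>F m in sequentially. \<forall>i<Suc m. unif_part t m (Suc i) - unif_part t m i < \<delta>)"
      using P unif_part_mesh by blast
    then show "(\<lambda>m. measure M {\<omega>\<in>space M. norm (riemann_sum Z F (Suc m) (unif_part t m) \<omega> - stoch_integral M Z F t \<omega>) > \<epsilon>}) \<longlonglongrightarrow> 0"
      if "\<epsilon> > 0" for \<epsilon>
      using si that unfolding is_stoch_integral_def by blast
  qed
  have 2: "(\<lambda>m. exp (- (\<Sum>i<Suc m. of_real (unif_part t m (Suc i) - unif_part t m i) * \<Phi> (transpose (F (unif_part t m i)) *v q)))) \<longlonglongrightarrow>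
      exp (- (\<integral>s. indicator {0..t} s *\<^sub>R \<Phi> (transpose (F s) *v q) \<partial>lborel))"
    by (intro tendsto_exp tendsto_minus riemann_sum_continuous_tendsto[OF t hc])
  have "(\<integral>\<omega>. exp (\<i> * of_real (q \<bullet> riemann_sum Z F (Suc m) (unif_part t m) \<omega>)) \<partial>M) =
      exp (- (\<Sum>i<Suc m. of_real (unif_part t m (Suc i) - unif_part t m i) * \<Phi> (transpose (F (unif_part t m i)) *v q)))" for m
    by (rule char_riemann_sum[OF Z _ P]) (rule char)
  with 1 have "(\<lambda>m. exp (- (\<Sum>i<Suc m. of_real (unif_part t m (Suc i) - unif_part t m i) * \<Phi> (transpose (F (unif_part t m i)) *v q)))) \<longlonglongrightarrow>
      (\<integral>\<omega>. exp (\<i> * of_real (q \<bullet> stoch_integral M Z F t \<omega>)) \<partial>M)"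
    by (simp only:)
  then show ?thesis using 2 by (rule LIMSEQ_unique)
qed

section \<open>Plane waves\<close>

text \<open>The variables are separated: a factor that is locally bounded in \<open>p\<close>, for
  dominated convergence in \<open>p\<close>, times the weight that every Levy measure integrates.
  Inside the unit ball the bound is a second-order Taylor remainder.\<close>

lemma levy_exponent_integrand_bound:
  fixes p z :: "real^'d"
  shows "norm (1 - exp (\<i> * of_real (p \<bullet> z)) + \<i> * of_real ((p \<bullet> z) * indicator (ball 0 1) z))
      \<le> (2 + (norm p)\<^sup>2) * min 1 ((norm z)\<^sup>2)"
proof (cases "norm z < 1")
  case True
  have "(\<Sum>k\<le>1. (\<i> * complex_of_real (p \<bullet> z)) ^ k / fact k) = 1 + \<i> * of_real (p \<bullet> z)" by simp
  then have "norm (exp (\<i> * of_real (p \<bullet> z)) - (1 + \<i> * of_real (p \<bullet> z))) \<le> \<bar>p \<bullet> z\<bar>\<^sup>2 / 2"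
    using iexp_approx1[of "p \<bullet> z" 1] by (simp add: numeral_2_eq_2)
  moreover have "1 - exp (\<i> * of_real (p \<bullet> z)) + \<i> * of_real ((p \<bullet> z) * indicator (ball 0 1) z)
      = - (exp (\<i> * of_real (p \<bullet> z)) - (1 + \<i> * of_real (p \<bullet> z)))" using True by simp
  ultimately have "norm (1 - exp (\<i> * of_real (p \<bullet> z)) + \<i> * of_real ((p \<bullet> z) * indicator (ball 0 1) z)) \<le> \<bar>p \<bullet> z\<bar>\<^sup>2 / 2"
    by (simp only: norm_minus_cancel)
  also have "\<dots> \<le> (norm p * norm z)\<^sup>2 / 2"
    by (intro divide_right_mono power_mono Cauchy_Schwarz_ineq2) auto
  also have "\<dots> \<le> (2 + (norm p)\<^sup>2) * (norm z)\<^sup>2"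
    by (simp add: power_mult_distrib algebra_simps)
  also have "(norm z)\<^sup>2 = min 1 ((norm z)\<^sup>2)" using True by (auto simp: min_def power_le_one antisym)
  finally show ?thesis .
next
  case False
  have "norm (1 - exp (\<i> * complex_of_real (p \<bullet> z))) \<le> 1 + 1"
    by (rule order_trans[OF norm_triangle_ineq4]) simp
  moreover have "2 \<le> 2 + (norm p)\<^sup>2" by simp
  ultimately have "norm (1 - exp (\<i> * complex_of_real (p \<bullet> z))) \<le> 2 + (norm p)\<^sup>2" by linarith
  moreover have "min 1 ((norm z)\<^sup>2) = 1" using False by (simp add: min_def one_le_power antisym)
  ultimately show ?thesis using False by simp
qed

lemma levy_exponent_integrable:
  fixes p :: "real^'d"
  assumes \<nu>: "levy_measure \<nu>"
  shows "integrable \<nu> (\<lambda>z. 1 - exp (\<i> * of_real (p \<bullet> z)) + \<i> * of_real ((p \<bullet> z) * indicator (ball 0 1) z))"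
proof (rule levy_measure_integrableI[OF \<nu> _ levy_exponent_integrand_bound])
  have [measurable]: "(ball 0 1 :: (real^'d) set) \<in> sets borel" by simp
  show "(\<lambda>z :: real^'d. 1 - exp (\<i> * complex_of_real (p \<bullet> z)) + \<i> * of_real ((p \<bullet> z) * indicator (ball 0 1) z)) \<in> borel_measurable borel"
    by measurable
qed

lemma continuous_levy_exponent:
  fixes Q :: "real^'d^'d"
  assumes \<nu>: "levy_measure \<nu>"
  shows "continuous_on UNIV (levy_exponent b Q \<nu>)"
proof -
  have "continuous_on UNIV (\<lambda>p. \<integral>z. 1 - exp (\<i> * complex_of_real (p \<bullet> z)) + \<i> * of_real ((p \<bullet> z) * indicator (ball 0 1) z) \<partial>\<nu>)"
  proof (rule continuous_at_imp_continuous_on, intro ballI)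
    fix p :: "real^'d"
    show "isCont (\<lambda>p. \<integral>z. 1 - exp (\<i> * complex_of_real (p \<bullet> z)) + \<i> * of_real ((p \<bullet> z) * indicator (ball 0 1) z) \<partial>\<nu>) p"
      unfolding isCont_def tendsto_at_iff_sequentially o_def
    proof (intro allI impI)
      fix X :: "nat \<Rightarrow> real^'d" assume X: "X \<longlonglongrightarrow> p"
      then have "Bseq X" by (rule convergent_imp_Bseq[OF convergentI])
      then obtain K where K: "\<And>n. norm (X n) \<le> K" by (auto simp: Bseq_def)
      show "(\<lambda>n. \<integral>z. 1 - exp (\<i> * complex_of_real (X n \<bullet> z)) + \<i> * of_real ((X n \<bullet> z) * indicator (ball 0 1) z) \<partial>\<nu>)
        \<longlonglongrightarrow> (\<integral>z. 1 - exp (\<i> * complex_of_real (p \<bullet> z)) + \<i> * of_real ((p \<bullet> z) * indicator (ball 0 1) z) \<partial>\<nu>)"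
      proof (rule integral_dominated_convergence)
        show "integrable \<nu> (\<lambda>z. (2 + K\<^sup>2) * min 1 ((norm z)\<^sup>2))"
          by (intro integrable_mult_right levy_measure_integrable_min \<nu>)
        show "AE z in \<nu>. (\<lambda>n. 1 - exp (\<i> * complex_of_real (X n \<bullet> z)) + \<i> * of_real ((X n \<bullet> z) * indicator (ball 0 1) z))
          \<longlonglongrightarrow> 1 - exp (\<i> * complex_of_real (p \<bullet> z)) + \<i> * of_real ((p \<bullet> z) * indicator (ball 0 1) z)"
          by (intro AE_I2 tendsto_intros X)
        show "AE z in \<nu>. norm (1 - exp (\<i> * complex_of_real (X n \<bullet> z)) + \<i> * of_real ((X n \<bullet> z) * indicator (ball 0 1) z)) \<le> (2 + K\<^sup>2) * min 1 ((norm z)\<^sup>2)" for n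
          using K[of n] by (intro AE_I2 order_trans[OF levy_exponent_integrand_bound] mult_right_mono add_left_mono power_mono) auto
      qed (use levy_exponent_integrable[OF \<nu>] in auto)
    qed
  qed
  moreover have "continuous_on UNIV (\<lambda>p. p \<bullet> (Q *v p))" by (intro continuous_intros)
  ultimately show ?thesis unfolding levy_exponent_def[abs_def] by (intro continuous_intros) auto
qed

section \<open>Waves as characters, and the symbol of the adjoint operator\<close>

definition wave :: "real^'n \<Rightarrow> real^'n \<Rightarrow> complex" where
  "wave q x = exp (\<i> * of_real (q \<bullet> x))"

lemma norm_wave[simp]: "norm (wave q x) = 1"
  by (simp add: wave_def)

lemma wave_measurable[measurable]: "wave q \<in> borel_measurable borel"
  unfolding wave_def[abs_def] by measurable

lemma wave_add: "wave q (x + y) = wave q x * wave q y"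
  by (simp add: wave_def inner_add_right distrib_left exp_add)

lemma wave_line_derivative:
  "((\<lambda>t. wave q (y + t *\<^sub>R h)) has_vector_derivative (\<i> * of_real (q \<bullet> h)) * wave q (y + t *\<^sub>R h)) (at t)"
  unfolding wave_def
  by (auto intro!: derivative_eq_intros simp: inner_add_right has_vector_derivative_complex_iff Re_exp Im_exp)

text \<open>A wave is a character of the translation group, so shifting the test function merely
  multiplies the integral by \<open>wave q s\<close>.\<close>

lemma shift_int_wave:
  assumes f: "f \<in> Cc_infty"
  shows "shift_int f (wave q) s = wave q s * (\<integral>x. f x *\<^sub>R wave q x \<partial>lborel)"
proof -
  have "shift_int f (wave q) (0 + s) = shift_int f (\<lambda>y. wave q (y + s)) 0"
    by (rule shift_int_translate) (use Cc_infty_borel[OF f] in auto)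
  also have "shift_int f (\<lambda>y. wave q (y + s)) 0 = (\<integral>y. wave q s * (f y *\<^sub>R wave q y) \<partial>lborel)"
    by (simp add: shift_int_def wave_add mult.commute)
  finally show ?thesis by (simp del: mult_scaleR_right)
qed

lemma integral_dder_wave:
  assumes f: "f \<in> Cc_infty"
  shows "(\<integral>x. dder h f x *\<^sub>R wave q x \<partial>lborel) = - (\<i> * of_real (q \<bullet> h)) * (\<integral>x. f x *\<^sub>R wave q x \<partial>lborel)"
proof -
  have "(\<integral>x. dder h f x *\<^sub>R wave q x \<partial>lborel) = - (\<integral>x. f x *\<^sub>R ((\<i> * of_real (q \<bullet> h)) * wave q x) \<partial>lborel)"
    by (rule integral_dder_by_parts[OF f wave_measurable, where K = 1 and K' = "\<bar>q \<bullet> h\<bar>"])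
       (auto intro: wave_line_derivative simp: norm_mult)
  then show ?thesis by (simp flip: mult_scaleR_right)
qed

text \<open>\<open>B\<close> enters only through \<open>q \<bullet> (B *v z) = p \<bullet> z\<close>
  with \<open>p = transpose B *v q\<close>, so the translation-invariant part acts as multiplication
  by minus the Levy exponent at \<open>p\<close>. The drift is not diagonal on waves: its term stays
  an integral and is later cancelled by the motion of the frequency.\<close>

lemma integral_ou_op_adj_wave:
  fixes A :: "real^'n^'n" and B :: "real^'d^'n" and w :: "'d \<Rightarrow> real^'d"
  assumes \<nu>: "levy_measure \<nu>" and Q: "\<And>i j. Q $ i $ j = (\<Sum>k\<in>UNIV. w k $ i * w k $ j)"
    and f: "f \<in> Cc_infty"
  shows "(\<integral>x. ou_op_adj A B b Q \<nu> f x *\<^sub>R wave q x \<partial>lborel) =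
      - levy_exponent b Q \<nu> (transpose B *v q) * (\<integral>x. f x *\<^sub>R wave q x \<partial>lborel)
      + (\<integral>x. f x *\<^sub>R (\<i> * of_real (q \<bullet> (A *v x)) * wave q x) \<partial>lborel)"
proof -
  define H where "H = (\<integral>x. f x *\<^sub>R wave q x \<partial>lborel)"
  define p where "p = transpose B *v q"
  have W: "norm (wave q x) \<le> 1" for x :: "real^'n" by simp
  have pz: "p \<bullet> z = q \<bullet> (B *v z)" for z
    by (simp add: p_def transpose_matrix_vector dot_lmul_matrix)
  have w0: "wave q 0 = 1" by (simp add: wave_def)
  have s0: "shift_int g (wave q) 0 = (\<integral>x. g x *\<^sub>R wave q x \<partial>lborel)" for g
    by (simp add: shift_int_def)
  have s1: "shift_int (dder h f) (wave q) 0 = - (\<i> * of_real (q \<bullet> h)) * H" for h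
    unfolding s0 H_def by (rule integral_dder_wave[OF f])
  have s2: "shift_int (dder h (dder h f)) (wave q) 0 = - of_real ((q \<bullet> h)\<^sup>2) * H" for h
    unfolding s0 integral_dder_wave[OF Cc_infty_dder[OF f]] integral_dder_wave[OF f] H_def
    by (simp add: power2_eq_square mult_ac)
  have pQ: "p \<bullet> (Q *v p) = (\<Sum>k\<in>UNIV. (q \<bullet> (B *v w k))\<^sup>2)"
  proof -
    have "p \<bullet> (Q *v p) = (\<Sum>i\<in>UNIV. \<Sum>j\<in>UNIV. \<Sum>k\<in>UNIV. p $ i * (w k $ i * w k $ j) * p $ j)"
      by (simp add: inner_vec_def matrix_vector_mult_def Q sum_distrib_left sum_distrib_right mult_ac)
    also have "\<dots> = (\<Sum>i\<in>UNIV. \<Sum>k\<in>UNIV. \<Sum>j\<in>UNIV. p $ i * (w k $ i * w k $ j) * p $ j)"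
      by (intro sum.cong sum.swap refl)
    also have "\<dots> = (\<Sum>k\<in>UNIV. \<Sum>i\<in>UNIV. \<Sum>j\<in>UNIV. p $ i * (w k $ i * w k $ j) * p $ j)"
      by (rule sum.swap)
    also have "\<dots> = (\<Sum>k\<in>UNIV. (p \<bullet> w k)\<^sup>2)"
      by (simp add: inner_vec_def power2_eq_square sum_product mult_ac)
    finally show ?thesis by (simp add: pz)
  qed
  define J where "J = (\<integral>z. 1 - exp (\<i> * of_real (p \<bullet> z)) + \<i> * of_real ((p \<bullet> z) * indicator (ball 0 1) z) \<partial>\<nu>)"
  have nl: "(\<integral>z. shift_int f (wave q) (B *v z) - shift_int f (wave q) 0
            + indicator (ball 0 1) z *\<^sub>R shift_int (dder (B *v z) f) (wave q) 0 \<partial>\<nu>) = - J * H"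
  proof -
    have "shift_int f (wave q) (B *v z) - shift_int f (wave q) 0
            + indicator (ball 0 1) z *\<^sub>R shift_int (dder (B *v z) f) (wave q) 0
        = (1 - exp (\<i> * of_real (p \<bullet> z)) + \<i> * of_real ((p \<bullet> z) * indicator (ball 0 1) z)) * (- H)" for z
      unfolding s1 shift_int_wave[OF f] H_def[symmetric] w0
      by (simp add: pz wave_def scaleR_conv_of_real algebra_simps)
    then show ?thesis
      using levy_exponent_integrable[OF \<nu>, of p] by (simp add: J_def)
  qed
  have S: "(\<Sum>k\<in>UNIV. shift_int (dder (B *v w k) (dder (B *v w k) f)) (wave q) 0) = - of_real (p \<bullet> (Q *v p)) * H"
    by (simp add: s2 pQ sum_negf sum_distrib_right)
  have L: "(\<integral>x. levy_op_adj B b Q \<nu> f x *\<^sub>R wave q x \<partial>lborel) = - levy_exponent b Q \<nu> p * H"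
    unfolding levy_op_adj_weak(3)[OF \<nu> Q f wave_measurable W]
    unfolding nl S unfolding s1 levy_exponent_def J_def[symmetric]
    by (simp add: pz[symmetric] inner_commute[of b] scaleR_conv_of_real algebra_simps)
  have D: "(\<integral>x. drift_div A f x *\<^sub>R wave q x \<partial>lborel) = - (\<integral>x. f x *\<^sub>R (\<i> * of_real (q \<bullet> (A *v x)) * wave q x) \<partial>lborel)"
  proof (rule integral_drift_div_by_parts[OF f wave_measurable W, where DW = "\<lambda>h x. \<i> * of_real (q \<bullet> h) * wave q x" and K' = "\<lambda>h. \<bar>q \<bullet> h\<bar>"])
    show "linear (\<lambda>h. \<i> * of_real (q \<bullet> h) * wave q x)" for x
      by (rule linearI) (simp_all add: inner_add_right algebra_simps scaleR_conv_of_real[of _ "_ :: complex"])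
  qed (auto intro: wave_line_derivative simp: norm_mult)
  have "(\<integral>x. ou_op_adj A B b Q \<nu> f x *\<^sub>R wave q x \<partial>lborel) =
      (\<integral>x. levy_op_adj B b Q \<nu> f x *\<^sub>R wave q x \<partial>lborel) - (\<integral>x. drift_div A f x *\<^sub>R wave q x \<partial>lborel)"
    using levy_op_adj_weak(1)[OF \<nu> Q f wave_measurable W] integrable_Cc_infty_scaleR[OF Cc_infty_drift_div[OF f] wave_measurable W]
    by (simp add: ou_op_adj_eq scaleR_diff_left)
  then show ?thesis unfolding L D H_def p_def by simp
qed

section \<open>Approximation by trigonometric polynomials\<close>

text \<open>The complex coefficient carries the phase, so sines, cosines and, at frequency zero,
  constants are generators. Products are derived and not a constructor; properties of all
  trigonometric polynomials then need checking only on waves and sums.\<close>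

inductive trig :: "(real^'n \<Rightarrow> real) \<Rightarrow> bool" where
  trig_wave: "trig (\<lambda>x. Re (c * wave p x))"
| trig_add: "trig f \<Longrightarrow> trig g \<Longrightarrow> trig (\<lambda>x. f x + g x)"

lemma trig_const: "trig (\<lambda>x :: real^'n. c)"
  using trig_wave[of "of_real c" "0 :: real^'n"] by (simp add: wave_def)

text \<open>The product-to-sum formula
  \<open>Re a * Re b = Re (a * b / 2) + Re (a * cnj b / 2)\<close>: frequencies add in one term and
  subtract in the other.\<close>

lemma trig_mult_wave: "trig f \<Longrightarrow> trig (\<lambda>x. Re (c * wave p x) * f x)"
proof (induction rule: trig.induct)
  case (trig_wave c' p')
  have "(\<lambda>x. Re (c * wave p x) * Re (c' * wave p' x)) =
      (\<lambda>x. Re ((c * c' / 2) * wave (p + p') x) + Re ((c * cnj c' / 2) * wave (p - p') x))"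
  proof
    fix x
    have 1: "wave (p + p') x = wave p x * wave p' x"
      by (simp add: wave_def inner_add_left distrib_left exp_add)
    have 2: "wave (p - p') x = wave p x * cnj (wave p' x)"
      by (simp add: wave_def inner_diff_left right_diff_distrib exp_diff exp_minus exp_cnj divide_inverse flip: exp_minus)
    have "Re a * Re b = Re (a * b / 2) + Re (a * cnj b / 2)" for a b :: complex by (simp add: field_simps)
    from this[of "c * wave p x" "c' * wave p' x"]
    show "Re (c * wave p x) * Re (c' * wave p' x) = Re ((c * c' / 2) * wave (p + p') x) + Re ((c * cnj c' / 2) * wave (p - p') x)"
      unfolding 1 2 by (simp add: mult_ac)
  qed
  then show ?case by (simp only: trig_add[OF trig.trig_wave trig.trig_wave])
next
  case (trig_add f g)
  then show ?case using trig.trig_add by (simp add: distrib_left)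
qed

lemma trig_mult: "trig f \<Longrightarrow> trig g \<Longrightarrow> trig (\<lambda>x. f x * g x)"
proof (induction rule: trig.induct)
  case (trig_wave c p)
  then show ?case by (rule trig_mult_wave)
next
  case (trig_add f h)
  then show ?case using trig.trig_add by (simp add: distrib_right)
qed

lemma trig_sum: "(\<And>i. i \<in> S \<Longrightarrow> trig (f i)) \<Longrightarrow> trig (\<lambda>x. \<Sum>i\<in>S. f i x)"
  by (induction S rule: infinite_finite_induct) (simp_all add: trig_const trig_add)

lemma trig_sin: "trig (\<lambda>x :: real^'n. sin (a * x $ i))"
proof -
  have "(\<lambda>x :: real^'n. sin (a * x $ i)) = (\<lambda>x. Re ((- \<i>) * wave (axis i a) x))"
    by (simp add: fun_eq_iff wave_def inner_axis' Im_exp)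
  then show ?thesis by (simp only: trig_wave)
qed

lemma trig_polynomial:
  assumes "real_polynomial_function P"
  shows "trig (\<lambda>x :: real^'n. P (\<chi> i. sin (a * x $ i)))"
  using assms
proof (induction rule: real_polynomial_function.induct)
  case (linear f)
  have "f (\<chi> i. sin (a * x $ i)) = (\<Sum>i\<in>UNIV. f (axis i 1) * sin (a * x $ i))" for x :: "real^'n"
  proof -
    have "(\<chi> i. sin (a * x $ i)) = (\<Sum>i\<in>UNIV. sin (a * x $ i) *\<^sub>R axis i 1)"
      by (simp add: vec_eq_iff axis_def if_distrib cong: if_cong)
    then have "f (\<chi> i. sin (a * x $ i)) = f (\<Sum>i\<in>UNIV. sin (a * x $ i) *\<^sub>R axis i 1)" by simp
    then show ?thesis using bounded_linear.linear[OF linear]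
      by (simp add: linear_sum linear_scale mult.commute)
  qed
  then show ?case by (simp add: trig_sum trig_mult[OF trig_const trig_sin])
next
  case (const c)
  then show ?case by (rule trig_const)
next
  case (add f g)
  then show ?case using trig_add by blast
next
  case (mult f g)
  then show ?case using trig_mult by blast
qed

text \<open>Approximating \<open>g (n arcsin y)\<close> on the cube \<open>[-1, 1]\<close> by polynomials and substituting
  \<open>y = sin (x / n)\<close> yields trigonometric polynomials that are globally bounded and close to \<open>g\<close>
  on \<open>[-n, n]\<close>.\<close>

lemma trig_approximation:
  fixes g :: "real^'n \<Rightarrow> real"
  assumes g: "continuous_on UNIV g" "\<And>x. \<bar>g x\<bar> \<le> K"
  obtains T where "\<And>n :: nat. trig (T n)" "\<And>n x. \<bar>T n x\<bar> \<le> K + 1" "\<And>x. (\<lambda>n. T n x) \<longlonglongrightarrow> g x"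
proof -
  have "\<exists>f. trig f \<and> (\<forall>x. \<bar>f x\<bar> \<le> K + 1) \<and> (\<forall>x. norm x \<le> Suc n \<longrightarrow> \<bar>f x - g x\<bar> \<le> 1 / real (Suc n))" for n
  proof -
    define N where "N = real (Suc n)"
    have N: "N \<ge> 1" by (simp add: N_def)
    define S :: "(real^'n) set" where "S = {y. \<forall>i. y $ i \<in> {-1..1}}"
    define G where "G y = g (\<chi> i. N * arcsin (y $ i))" for y
    have S: "compact S"
    proof -
      have "S = cbox (\<chi> i. -1) (\<chi> i. 1)" by (auto simp: S_def mem_box_cart)
      then show ?thesis by simp
    qed
    have "continuous_on S (\<lambda>y. \<chi> i. N * arcsin (y $ i))"
    proof (intro continuous_on_vec_lambda continuous_on_mult continuous_on_const)
      show "continuous_on S (\<lambda>y. arcsin (y $ i))" for i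
        by (intro continuous_on_arcsin continuous_intros) (auto simp: S_def)
    qed
    then have "continuous_on S G" unfolding G_def
      by (rule continuous_on_compose2[OF g(1)]) auto
    then obtain P where P: "real_polynomial_function P" "\<And>y. y \<in> S \<Longrightarrow> \<bar>G y - P y\<bar> < 1 / N"
      using Stone_Weierstrass_real_polynomial_function[OF S, of G "1 / N"] N by auto
    define f where "f x = P (\<chi> i. sin ((1 / N) * x $ i))" for x :: "real^'n"
    have mem: "(\<chi> i. sin ((1 / N) * x $ i)) \<in> S" for x :: "real^'n" by (simp add: S_def)
    have "trig f" unfolding f_def[abs_def] by (rule trig_polynomial[OF P(1)])
    \<comment> \<open>This holds for every \<open>x\<close>, because the sines always lie in the
      cube: far from the origin \<open>f x\<close> is within \<open>1 / N\<close>, hence within 1,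
      of the value of \<open>g\<close> at some other point.\<close>
    moreover have "\<bar>f x\<bar> \<le> K + 1" for x
    proof -
      have "1 / N \<le> 1" using N by simp
      then show ?thesis using P(2)[OF mem[of x]] g(2)[of "\<chi> i. N * arcsin (sin ((1 / N) * x $ i))"]
        by (simp add: f_def G_def abs_le_iff abs_less_iff)
    qed
    moreover have "\<bar>f x - g x\<bar> \<le> 1 / N" if "norm x \<le> N" for x
    proof -
      \<comment> \<open>Here \<open>x $ i / N\<close> lies between -1 and 1, inside the range where
        \<open>arcsin\<close> inverts \<open>sin\<close>.\<close>
      have "N * arcsin (sin ((1 / N) * x $ i)) = x $ i" for i
      proof -
        have "\<bar>x $ i\<bar> \<le> N" using component_le_norm_cart[of x i] that by simp
        then have "\<bar>(1 / N) * x $ i\<bar> \<le> 1" using N by (simp add: abs_mult)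
        then have "-1 \<le> (1 / N) * x $ i" "(1 / N) * x $ i \<le> 1" by linarith+
        then have "arcsin (sin ((1 / N) * x $ i)) = (1 / N) * x $ i"
          using pi_gt3 by (intro arcsin_sin) linarith+
        then show ?thesis using N by simp
      qed
      then have "G (\<chi> i. sin ((1 / N) * x $ i)) = g x" by (simp add: G_def)
      then show ?thesis using P(2)[OF mem[of x]] by (simp add: f_def abs_minus_commute)
    qed
    ultimately show ?thesis unfolding N_def by blast
  qed
  then obtain T where T: "\<And>n. trig (T n)" "\<And>n x. \<bar>T n x\<bar> \<le> K + 1"
     "\<And>n x. norm x \<le> Suc n \<Longrightarrow> \<bar>T n x - g x\<bar> \<le> 1 / real (Suc n)" by metis
  have "(\<lambda>n. T n x) \<longlonglongrightarrow> g x" for x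
  proof (rule LIMSEQ_I)
    fix e :: real assume e: "e > 0"
    obtain m where m: "1 / real (Suc m) < e" using nat_approx_posE[OF e] by blast
    show "\<exists>N. \<forall>n\<ge>N. norm (T n x - g x) < e"
    proof (intro exI[of _ "max m (nat \<lceil>norm x\<rceil>)"] allI impI)
      fix n assume n: "max m (nat \<lceil>norm x\<rceil>) \<le> n"
      then have "norm x \<le> Suc n" by linarith
      from T(3)[OF this] have "\<bar>T n x - g x\<bar> \<le> 1 / real (Suc n)" .
      also have "\<dots> \<le> 1 / real (Suc m)" using n by (intro divide_left_mono) auto
      finally show "norm (T n x - g x) < e" using m by simp
    qed
  qed
  then show ?thesis using that T(1,2) by blast
qed

section \<open>The semigroup on plane waves\<close>

text \<open>Time reversal reconciles the kernel at \<open>t - s\<close> in the process with the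
  integral up to \<open>t\<close> in \<open>wave_mult\<close>.\<close>

lemma integral_indicator_reflect:
  fixes h :: "real \<Rightarrow> complex"
  shows "(\<integral>s. indicator {0..t} s *\<^sub>R h (t - s) \<partial>lborel) = (\<integral>s. indicator {0..t} s *\<^sub>R h s \<partial>lborel)"
proof -
  have "(\<integral>s. indicator {0..t} s *\<^sub>R h s \<partial>lborel) = \<bar>-1\<bar> *\<^sub>R (\<integral>s. indicator {0..t} (t + (-1) * s) *\<^sub>R h (t + (-1) * s) \<partial>lborel)"
    by (rule lborel_integral_real_affine) simp
  also have "\<dots> = (\<integral>s. indicator {0..t} s *\<^sub>R h (t - s) \<partial>lborel)"
    by (auto intro!: Bochner_Integration.integral_cong simp: indicator_def)
  finally show ?thesis by simp
qed

text \<open>The characteristic function at \<open>q\<close> of the process started at 0. The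
  exponent is written after time reversal, so \<open>t\<close> occurs only as the upper limit and
  the fundamental theorem of calculus applies.\<close>

definition wave_mult :: "(real^'d \<Rightarrow> complex) \<Rightarrow> real^'n^'n \<Rightarrow> real^'d^'n \<Rightarrow> real^'n \<Rightarrow> real \<Rightarrow> complex" where
  "wave_mult \<Phi> A B q t = exp (- (\<integral>s. indicator {0..t} s *\<^sub>R \<Phi> (transpose B *v (transpose (mat_exp (s *\<^sub>R A)) *v q)) \<partial>lborel))"

lemma continuous_on_transpose:
  fixes f :: "'a::topological_space \<Rightarrow> real^'m^'n"
  shows "continuous_on S f \<Longrightarrow> continuous_on S (\<lambda>s. transpose (f s))"
  unfolding transpose_def by (intro continuous_on_vec_lambda continuous_intros)

text \<open>The derivative is taken within \<open>{0..T}\<close>: for negative times the integral is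
  empty and the function stays at 1, so at 0 only the derivative from the right has this value in
  general.\<close>

lemma wave_mult_derivative:
  fixes A :: "real^'n^'n" and B :: "real^'d^'n"
  assumes \<Phi>: "continuous_on UNIV \<Phi>" and t: "t \<in> {0..T}"
  shows "(wave_mult \<Phi> A B q has_vector_derivative
      - \<Phi> (transpose B *v (transpose (mat_exp (t *\<^sub>R A)) *v q)) * wave_mult \<Phi> A B q t) (at t within {0..T})"
proof -
  define h where "h s = \<Phi> (transpose B *v (transpose (mat_exp (s *\<^sub>R A)) *v q))" for s
  have hc: "continuous_on S h" for S unfolding h_def
    by (rule continuous_on_compose2[OF \<Phi>])
       (intro continuous_on_matrix_vector_mult' continuous_on_transpose continuous_on_mat_exp continuous_intros, simp)
  have eq: "(\<integral>s. indicator {0..u} s *\<^sub>R h s \<partial>lborel) = integral {0..u} h" for u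
    using set_borel_integral_eq_integral(2)[OF borel_integrable_atLeastAtMost'[OF hc]] by (simp add: set_lebesgue_integral_def)
  have "((\<lambda>u. integral {0..u} h) has_vector_derivative h t) (at t within {0..T})"
    by (rule integral_has_vector_derivative[OF hc t])
  then have "((\<lambda>u. - integral {0..u} h) has_vector_derivative - h t) (at t within {0..T})"
    by (rule has_vector_derivative_minus)
  from field_vector_diff_chain_within[OF this, of exp "exp (- integral {0..t} h)"]
  have "(exp \<circ> (\<lambda>u. - integral {0..u} h) has_vector_derivative - h t * exp (- integral {0..t} h)) (at t within {0..T})"
    by (auto intro: DERIV_subset[OF DERIV_exp])
  moreover have eq': "exp (- integral {0..u} h) = wave_mult \<Phi> A B q u" for u
    by (simp only: wave_mult_def h_def[symmetric] eq)
  moreover have "exp \<circ> (\<lambda>u. - integral {0..u} h) = wave_mult \<Phi> A B q"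
    by (rule ext) (simp only: o_def eq')
  ultimately show ?thesis by (simp only: h_def[symmetric])
qed

lemma shifted_mat_exp_derivative:
  fixes A :: "real^'n^'n" and B :: "real^'d^'n"
  shows "((\<lambda>s. mat_exp ((t - s) *\<^sub>R A) ** B) has_vector_derivative - ((mat_exp ((t - s) *\<^sub>R A) ** A) ** B)) (at s)"
    and "continuous_on UNIV (\<lambda>s. - ((mat_exp ((t - s) *\<^sub>R A) ** A) ** B))"
proof -
  have "((\<lambda>s. t - s) has_vector_derivative -1) (at s)"
    by (auto intro!: derivative_eq_intros)
  from vector_diff_chain_at[OF this mat_exp_has_vector_derivative[of A "t - s"]]
  have "((\<lambda>s. mat_exp ((t - s) *\<^sub>R A)) has_vector_derivative - (mat_exp ((t - s) *\<^sub>R A) ** A)) (at s)"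
    by (simp add: o_def)
  from bounded_linear.has_vector_derivative[OF bounded_bilinear.bounded_linear_left[OF bounded_bilinear_matrix_matrix_mult, of B] this]
  show "((\<lambda>s. mat_exp ((t - s) *\<^sub>R A) ** B) has_vector_derivative - ((mat_exp ((t - s) *\<^sub>R A) ** A) ** B)) (at s)"
    by (simp add: bounded_bilinear.minus_left[OF bounded_bilinear_matrix_matrix_mult])
  show "continuous_on UNIV (\<lambda>s. - ((mat_exp ((t - s) *\<^sub>R A) ** A) ** B))"
    by (intro continuous_on_minus continuous_on_matrix_matrix_mult' continuous_on_mat_exp continuous_intros)
qed

lemma stoch_integral_measurable:
  fixes A :: "real^'n^'n" and B :: "real^'d^'n"
  assumes "levy_process M Z" "0 \<le> t"
  shows "stoch_integral M Z (\<lambda>s. mat_exp ((t - s) *\<^sub>R A) ** B) t \<in> borel_measurable M"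
  using is_stoch_integral_stoch_integral[OF assms shifted_mat_exp_derivative[where t = t and A = A and B = B]]
  by (simp add: is_stoch_integral_def)

lemma ou_process_measurable:
  fixes A :: "real^'n^'n" and B :: "real^'d^'n"
  assumes "levy_process M Z" "0 \<le> t"
  shows "ou_process M Z A B x t \<in> borel_measurable M"
  unfolding ou_process_def[abs_def] using stoch_integral_measurable[OF assms, of A B] by measurable

text \<open>The starting point enters additively and deterministically, so the wave splits into a
  factor depending on \<open>x\<close>, with the flow moved to the frequency, and the characteristic
  function of the noise.\<close>

lemma ou_process_wave:
  fixes A :: "real^'n^'n" and B :: "real^'d^'n" and Z :: "real \<Rightarrow> 'w \<Rightarrow> real^'d"
  assumes Z: "levy_process M Z"
    and char: "\<And>t p. 0 \<le> t \<Longrightarrow> (\<integral>\<omega>. exp (\<i> * of_real (p \<bullet> Z t \<omega>)) \<partial>M) = exp (- of_real t * \<Phi> p)"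
    and \<Phi>: "continuous_on UNIV \<Phi>" and t: "0 \<le> t"
  shows "(\<integral>\<omega>. wave q (ou_process M Z A B x t \<omega>) \<partial>M) = wave_mult \<Phi> A B q t * wave (transpose (mat_exp (t *\<^sub>R A)) *v q) x"
proof -
  define h where "h s = \<Phi> (transpose B *v (transpose (mat_exp (s *\<^sub>R A)) *v q))" for s
  have "(\<integral>\<omega>. wave q (stoch_integral M Z (\<lambda>s. mat_exp ((t - s) *\<^sub>R A) ** B) t \<omega>) \<partial>M) =
      exp (- (\<integral>s. indicator {0..t} s *\<^sub>R \<Phi> (transpose (mat_exp ((t - s) *\<^sub>R A) ** B) *v q) \<partial>lborel))"
    unfolding wave_def
    by (rule char_stoch_integral[OF Z char \<Phi> t shifted_mat_exp_derivative])
  also have "(\<integral>s. indicator {0..t} s *\<^sub>R \<Phi> (transpose (mat_exp ((t - s) *\<^sub>R A) ** B) *v q) \<partial>lborel)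
      = (\<integral>s. indicator {0..t} s *\<^sub>R h (t - s) \<partial>lborel)"
    by (simp only: h_def matrix_transpose_mul matrix_vector_mul_assoc)
  also have "exp (- \<dots>) = wave_mult \<Phi> A B q t"
    unfolding integral_indicator_reflect by (simp add: wave_mult_def h_def)
  finally have e: "(\<integral>\<omega>. wave q (stoch_integral M Z (\<lambda>s. mat_exp ((t - s) *\<^sub>R A) ** B) t \<omega>) \<partial>M) = wave_mult \<Phi> A B q t" .
  have "wave q (mat_exp (t *\<^sub>R A) *v x) = wave (transpose (mat_exp (t *\<^sub>R A)) *v q) x"
    by (simp add: wave_def transpose_matrix_vector dot_lmul_matrix)
  with e show ?thesis by (simp add: ou_process_def wave_add)
qed

text \<open>The bound is read off from a probability measure: the multiplier is an expectation of
  numbers of modulus 1. No sign of the real part of \<open>\<Phi>\<close> has to be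
  established.\<close>

lemma wave_mult_norm_le:
  fixes A :: "real^'n^'n" and B :: "real^'d^'n" and Z :: "real \<Rightarrow> 'w \<Rightarrow> real^'d"
  assumes Z: "levy_process M Z"
    and char: "\<And>t p. 0 \<le> t \<Longrightarrow> (\<integral>\<omega>. exp (\<i> * of_real (p \<bullet> Z t \<omega>)) \<partial>M) = exp (- of_real t * \<Phi> p)"
    and \<Phi>: "continuous_on UNIV \<Phi>" and t: "0 \<le> t"
  shows "norm (wave_mult \<Phi> A B q t) \<le> 1"
proof -
  interpret prob_space M using Z by (simp add: levy_process_def)
  have "(\<integral>\<omega>. wave q (ou_process M Z A B 0 t \<omega>) \<partial>M) = wave_mult \<Phi> A B q t * wave (transpose (mat_exp (t *\<^sub>R A)) *v q) 0"
    by (rule ou_process_wave[OF Z _ \<Phi> t]) (rule char)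
  moreover have "wave r 0 = 1" for r :: "real^'n" by (simp add: wave_def)
  ultimately have "wave_mult \<Phi> A B q t = (\<integral>\<omega>. wave q (ou_process M Z A B 0 t \<omega>) \<partial>M)"
    by (simp only: mult_1_right)
  also have "norm \<dots> \<le> (\<integral>\<omega>. norm (wave q (ou_process M Z A B 0 t \<omega>)) \<partial>M)" by (rule integral_norm_bound)
  finally show ?thesis by (simp add: prob_space)
qed

text \<open>The derivative of the transported wave grows linearly in \<open>x\<close>; the compact
  support of \<open>f\<close> together with a bound on the flow over \<open>{t - 1..t + 1}\<close>
  gives the majorant \<open>D\<close>.\<close>

lemma wave_flow_derivative:
  fixes A :: "real^'n^'n"
  assumes f: "f \<in> Cc_infty"
  shows "((\<lambda>t. \<integral>x. f x *\<^sub>R wave (transpose (mat_exp (t *\<^sub>R A)) *v q) x \<partial>lborel) has_vector_derivative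
      (\<integral>x. f x *\<^sub>R (\<i> * of_real ((transpose (mat_exp (t *\<^sub>R A)) *v q) \<bullet> (A *v x)) * wave (transpose (mat_exp (t *\<^sub>R A)) *v q) x) \<partial>lborel)) (at t)"
proof -
  have tq: "(transpose (mat_exp (t *\<^sub>R A)) *v q) \<bullet> y = q \<bullet> (mat_exp (t *\<^sub>R A) *v y)" for t y
    by (simp add: transpose_matrix_vector dot_lmul_matrix)
  obtain r where r: "r > 0" "\<And>x. norm x \<ge> r \<Longrightarrow> f x = 0" using Cc_infty_supportE[OF f] by metis
  have "compact ((\<lambda>t. mat_exp (t *\<^sub>R A)) ` {t - 1..t + 1})"
    by (intro compact_continuous_image continuous_on_mat_exp continuous_intros) auto
  then obtain K where K: "\<And>s. s \<in> {t - 1..t + 1} \<Longrightarrow> norm (mat_exp (s *\<^sub>R A)) \<le> K"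
    using compact_imp_bounded by (fastforce simp: bounded_iff)
  obtain C where C: "C > 0" "\<And>(a :: real^'n^'n) b. norm (a *v b) \<le> norm a * norm b * C"
    using bounded_bilinear.pos_bounded[OF bounded_bilinear_matrix_vector_mult] by blast
  define D where "D = norm q * (K * (norm A * r * C) * C)"
  show ?thesis
    unfolding wave_def tq
  proof (rule has_vector_derivative_lebesgue_integral(1)[where \<delta> = 1 and w = "\<lambda>x. \<bar>f x\<bar> * D"])
    note [measurable] = Cc_infty_borel[OF f]
    have m1: "(\<lambda>x. q \<bullet> (mat_exp (s *\<^sub>R A) *v x)) \<in> borel_measurable borel" for s
      by (intro borel_measurable_continuous_onI continuous_intros)
    have m2: "(\<lambda>x. q \<bullet> (mat_exp (s *\<^sub>R A) *v (A *v x))) \<in> borel_measurable borel" for s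
      unfolding matrix_vector_mul_assoc by (intro borel_measurable_continuous_onI continuous_intros)
    note [measurable] = m1 m2
    show "integrable lborel (\<lambda>x. f x *\<^sub>R exp (\<i> * of_real (q \<bullet> (mat_exp (s *\<^sub>R A) *v x))))" for s
      by (rule integrable_Cc_infty_scaleR[OF f, of _ 1]) auto
    show "((\<lambda>t. f x *\<^sub>R exp (\<i> * of_real (q \<bullet> (mat_exp (t *\<^sub>R A) *v x)))) has_vector_derivative
       f x *\<^sub>R (\<i> * of_real (q \<bullet> (mat_exp (s *\<^sub>R A) *v (A *v x))) * exp (\<i> * of_real (q \<bullet> (mat_exp (s *\<^sub>R A) *v x))))) (at s)" for x s
    proof -
      have "((\<lambda>t. q \<bullet> (mat_exp (t *\<^sub>R A) *v x)) has_vector_derivative q \<bullet> ((mat_exp (s *\<^sub>R A) ** A) *v x)) (at s)"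
        by (intro bounded_linear.has_vector_derivative[OF bounded_linear_inner_right]
            bounded_linear.has_vector_derivative[OF bounded_bilinear.bounded_linear_left[OF bounded_bilinear_matrix_vector_mult]]
            mat_exp_has_vector_derivative)
      then have "((\<lambda>t. q \<bullet> (mat_exp (t *\<^sub>R A) *v x)) has_real_derivative q \<bullet> (mat_exp (s *\<^sub>R A) *v (A *v x))) (at s)"
        by (simp add: has_real_derivative_iff_has_vector_derivative matrix_vector_mul_assoc)
      then show ?thesis
        by (auto intro!: derivative_eq_intros simp: has_vector_derivative_complex_iff Re_exp Im_exp)
    qed
    show "norm (f x *\<^sub>R (\<i> * of_real (q \<bullet> (mat_exp (s *\<^sub>R A) *v (A *v x))) * exp (\<i> * of_real (q \<bullet> (mat_exp (s *\<^sub>R A) *v x))))) \<le> \<bar>f x\<bar> * D"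
      if "\<bar>s - t\<bar> < 1" for x s
    proof (cases "norm x \<ge> r")
      case True
      then show ?thesis using r(2) by simp
    next
      case False
      have k: "norm (mat_exp (s *\<^sub>R A)) \<le> K" using that by (intro K) auto
      then have K0: "K \<ge> 0" using norm_ge_zero order_trans by blast
      have "\<bar>q \<bullet> (mat_exp (s *\<^sub>R A) *v (A *v x))\<bar> \<le> norm q * norm (mat_exp (s *\<^sub>R A) *v (A *v x))" by (rule Cauchy_Schwarz_ineq2)
      also have "\<dots> \<le> norm q * (norm (mat_exp (s *\<^sub>R A)) * norm (A *v x) * C)" by (intro mult_left_mono C) auto
      also have "\<dots> \<le> norm q * (norm (mat_exp (s *\<^sub>R A)) * (norm A * norm x * C) * C)"
        using C by (intro mult_left_mono mult_right_mono) auto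
      also have "\<dots> \<le> norm q * (K * (norm A * r * C) * C)"
        using k K0 C(1) False r(1) by (intro mult_left_mono mult_right_mono mult_mono) auto
      finally have "\<bar>q \<bullet> (mat_exp (s *\<^sub>R A) *v (A *v x))\<bar> \<le> D" by (simp add: D_def)
      then show ?thesis by (simp add: norm_mult mult_left_mono)
    qed
    show "integrable lborel (\<lambda>x. \<bar>f x\<bar> * D)" using integrable_Cc_infty[OF f] by auto
    show "(\<lambda>x. f x *\<^sub>R (\<i> * of_real (q \<bullet> (mat_exp (t *\<^sub>R A) *v (A *v x))) * exp (\<i> * of_real (q \<bullet> (mat_exp (t *\<^sub>R A) *v x))))) \<in> borel_measurable lborel"
      by measurable
  qed simp
qed

section \<open>The resolvent identity\<close>

lemma integrable_exp_decay:
  fixes lam :: real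
  assumes lam: "lam > 0"
  shows "integrable lborel (\<lambda>t. indicator {0..} t * exp (- lam * t))"
proof (rule integrableI_nonneg)
  have lim: "((\<lambda>t. - exp (- lam * t) / lam) \<longlongrightarrow> - 0 / lam) at_top"
  proof (intro tendsto_intros)
    have "filterlim (\<lambda>t. - lam * t) at_bot at_top"
      using lam by (simp add: filterlim_uminus_at_bot filterlim_tendsto_pos_mult_at_top[OF tendsto_const _ filterlim_ident])
    then show "((\<lambda>t. exp (- lam * t)) \<longlongrightarrow> 0) at_top" by (rule filterlim_compose[OF exp_at_bot])
  qed (use lam in simp)
  have "(\<integral>\<^sup>+t. ennreal (exp (- lam * t)) * indicator {0..} t \<partial>lborel) = ennreal (- 0 / lam - (- exp (- lam * 0) / lam))"
    by (rule nn_integral_FTC_atLeast[OF _ _ _ lim]) (use lam in \<open>auto intro!: derivative_eq_intros\<close>)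
  moreover have "(\<integral>\<^sup>+t. ennreal (indicator {0..} t * exp (- lam * t)) \<partial>lborel) = (\<integral>\<^sup>+t. ennreal (exp (- lam * t)) * indicator {0..} t \<partial>lborel)"
    by (intro nn_integral_cong) (auto simp: indicator_def)
  ultimately show "(\<integral>\<^sup>+t. ennreal (indicator {0..} t * exp (- lam * t)) \<partial>lborel) < \<infinity>" by simp
qed auto

text \<open>The Fourier transform of \<open>f\<close>, with the sign convention of characteristic
  functions.\<close>

definition wave_int :: "(real^'n \<Rightarrow> real) \<Rightarrow> real^'n \<Rightarrow> complex" where
  "wave_int f q = (\<integral>x. f x *\<^sub>R wave q x \<partial>lborel)"

text \<open>Jumps spread the support, so the adjoint operator does not map test functions to test
  functions. Integrability against bounded \<open>V\<close> is what survives.\<close>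

lemma ou_test_function:
  fixes A :: "real^'n^'n" and B :: "real^'d^'n" and w :: "'d \<Rightarrow> real^'d"
    and V :: "real^'n \<Rightarrow> 'b::{banach, second_countable_topology}"
  assumes \<nu>: "levy_measure \<nu>" and Q: "\<And>i j. Q $ i $ j = (\<Sum>k\<in>UNIV. w k $ i * w k $ j)"
    and f: "f \<in> Cc_infty" and V: "V \<in> borel_measurable borel" "\<And>x. norm (V x) \<le> K"
  shows "integrable lborel (\<lambda>x. ou_op_adj A B b Q \<nu> f x *\<^sub>R V x)"
    and "integrable lborel (\<lambda>x. (lam * f x - ou_op_adj A B b Q \<nu> f x) *\<^sub>R V x)"
proof -
  show 1: "integrable lborel (\<lambda>x. ou_op_adj A B b Q \<nu> f x *\<^sub>R V x)"
    using levy_op_adj_weak(1)[OF \<nu> Q f V] integrable_Cc_infty_scaleR[OF Cc_infty_drift_div[OF f] V]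
    by (simp add: ou_op_adj_eq scaleR_diff_left)
  have "integrable lborel (\<lambda>x. lam *\<^sub>R (f x *\<^sub>R V x))"
    using integrable_Cc_infty_scaleR[OF f V] by (rule integrable_scaleR_right)
  then show "integrable lborel (\<lambda>x. (lam * f x - ou_op_adj A B b Q \<nu> f x) *\<^sub>R V x)"
    using 1 by (simp add: scaleR_diff_left)
qed

text \<open>On plane waves \<open>t \<mapsto> e\<^bsup>- lam t\<^esup> (P\<^sub>t e\<^sub>q, f)\<close> is an explicit function whose derivative is
  \<open>- e\<^bsup>- lam t\<^esup> (P\<^sub>t e\<^sub>q, lam f - L\<^sup>* f)\<close>.\<close>

lemma resolvent_wave:
  fixes A :: "real^'n^'n" and B :: "real^'d^'n" and w :: "'d \<Rightarrow> real^'d"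
  assumes \<nu>: "levy_measure \<nu>" and Q: "\<And>i j. Q $ i $ j = (\<Sum>k\<in>UNIV. w k $ i * w k $ j)"
    and f: "f \<in> Cc_infty" and lam: "lam > 0"
    and m1: "\<And>t. 0 \<le> t \<Longrightarrow> norm (wave_mult (levy_exponent b Q \<nu>) A B q t) \<le> 1"
  defines "m \<equiv> wave_mult (levy_exponent b Q \<nu>) A B q" and "p \<equiv> \<lambda>t. transpose (mat_exp (t *\<^sub>R A)) *v q"
    and "\<psi> \<equiv> \<lambda>x. lam * f x - ou_op_adj A B b Q \<nu> f x"
  shows "(\<integral>t. indicator {0..} t *\<^sub>R (exp (- lam * t) *\<^sub>R (m t * wave_int \<psi> (p t))) \<partial>lborel) = wave_int f q"
proof -
  have W1: "norm (wave q x) \<le> 1" for q x :: "real^'n" by simp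
  define \<Phi> where "\<Phi> = levy_exponent b Q \<nu>"
  have \<Phi>: "continuous_on UNIV \<Phi>" unfolding \<Phi>_def by (rule continuous_levy_exponent[OF \<nu>])
  define F' where "F' t = (\<integral>x. f x *\<^sub>R (\<i> * of_real (p t \<bullet> (A *v x)) * wave (p t) x) \<partial>lborel)" for t
  have Fd: "((\<lambda>t. wave_int f (p t)) has_vector_derivative F' t) (at t)" for t
    unfolding wave_int_def p_def F'_def by (rule wave_flow_derivative[OF f])
  \<comment> \<open>At \<open>q' = p t\<close> the last integral is \<open>F' t\<close>, the
    derivative of \<open>wave_int f\<close> along the moving frequency. In the product rule for
    \<open>G\<close> the drift therefore cancels, and the terms with \<open>lam\<close> and
    \<open>\<Phi>\<close> combine to \<open>G'\<close>.\<close>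
  have \<psi>i: "wave_int \<psi> q' = of_real lam * wave_int f q' + \<Phi> (transpose B *v q') * wave_int f q'
      - (\<integral>x. f x *\<^sub>R (\<i> * of_real (q' \<bullet> (A *v x)) * wave q' x) \<partial>lborel)" for q'
  proof -
    have "wave_int \<psi> q' = (\<integral>x. lam *\<^sub>R (f x *\<^sub>R wave q' x) - ou_op_adj A B b Q \<nu> f x *\<^sub>R wave q' x \<partial>lborel)"
      by (simp add: wave_int_def \<psi>_def scaleR_diff_left)
    also have "\<dots> = lam *\<^sub>R wave_int f q' - (\<integral>x. ou_op_adj A B b Q \<nu> f x *\<^sub>R wave q' x \<partial>lborel)"
      unfolding wave_int_def
      by (subst Bochner_Integration.integral_diff[OF integrable_scaleR_right[OF integrable_Cc_infty_scaleR[OF f wave_measurable W1]]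
            ou_test_function(1)[OF \<nu> Q f wave_measurable W1]])
         (simp del: scaleR_scaleR)
    finally show ?thesis
      unfolding integral_ou_op_adj_wave[OF \<nu> Q f] by (simp add: wave_int_def \<Phi>_def scaleR_conv_of_real)
  qed
  define G where "G t = exp (- lam * t) *\<^sub>R (m t * wave_int f (p t))" for t
  define G' where "G' t = - (exp (- lam * t) *\<^sub>R (m t * wave_int \<psi> (p t)))" for t
  have md: "(m has_vector_derivative - \<Phi> (transpose B *v p t) * m t) (at t within {0..T})" if "t \<in> {0..T}" for t T
    unfolding m_def p_def \<Phi>_def[symmetric] by (rule wave_mult_derivative[OF \<Phi> that])
  have Gd: "(G has_vector_derivative G' t) (at t within {0..T})" if t: "t \<in> {0..T}" for t T
  proof -
    have e: "((\<lambda>t. exp (- lam * t)) has_real_derivative - lam * exp (- lam * t)) (at t within {0..T})"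
      by (auto intro!: derivative_eq_intros)
    have "((\<lambda>t. m t * wave_int f (p t)) has_vector_derivative m t * F' t + - \<Phi> (transpose B *v p t) * m t * wave_int f (p t)) (at t within {0..T})"
      by (rule has_vector_derivative_mult[OF md[OF t] has_vector_derivative_at_within[OF Fd]])
    from has_vector_derivative_scaleR[OF e this]
    show ?thesis unfolding G_def[abs_def] G'_def \<psi>i F'_def[symmetric]
      by (simp add: scaleR_conv_of_real algebra_simps)
  qed
  define N where "N = (\<integral>x. \<bar>\<psi> x\<bar> \<partial>lborel)"
  have N: "norm (wave_int \<psi> q') \<le> N" for q'
    unfolding wave_int_def N_def by (rule order_trans[OF integral_norm_bound]) simp
  have N0: "N \<ge> 0" by (simp add: N_def)
  have pc: "continuous_on S p" for S
    unfolding p_def by (intro continuous_on_matrix_vector_mult' continuous_on_transpose continuous_on_mat_exp continuous_intros)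
  have \<psi>m: "\<psi> \<in> borel_measurable lborel" and \<psi>I: "integrable lborel \<psi>"
    using ou_test_function(2)[OF \<nu> Q f, of "\<lambda>x. 1 :: real" 1 lam A B b] by (auto simp: \<psi>_def)
  have wc: "continuous_on S (\<lambda>t. wave_int \<psi> (p t))" for S
  proof (rule continuous_on_compose2[OF _ pc])
    show "continuous_on UNIV (wave_int \<psi>)"
    proof (rule continuous_at_imp_continuous_on, intro ballI)
      fix q' :: "real^'n"
      show "isCont (wave_int \<psi>) q'" unfolding isCont_def tendsto_at_iff_sequentially o_def
      proof (intro allI impI)
        fix X :: "nat \<Rightarrow> real^'n" assume X: "X \<longlonglongrightarrow> q'"
        show "(\<lambda>n. wave_int \<psi> (X n)) \<longlonglongrightarrow> wave_int \<psi> q'" unfolding wave_int_def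
        proof (rule integral_dominated_convergence)
          show "integrable lborel (\<lambda>x. \<bar>\<psi> x\<bar>)" using \<psi>I by auto
          show "AE x in lborel. (\<lambda>n. \<psi> x *\<^sub>R wave (X n) x) \<longlonglongrightarrow> \<psi> x *\<^sub>R wave q' x"
            unfolding wave_def by (intro AE_I2 tendsto_intros X)
        qed (use \<psi>m in auto)
      qed
    qed
  qed simp
  have mc: "continuous_on {0..T} m" for T
    using md by (intro continuous_on_vector_derivative) blast
  have G'c: "continuous_on {0..T} G'" for T
    unfolding G'_def by (intro continuous_intros mc wc)
  \<comment> \<open>The fundamental theorem is used on bounded intervals only. As \<open>n\<close>
    grows, \<open>G (real n)\<close> vanishes and the integrals converge by domination, both thanks
    to the exponential factor.\<close>
  have ftc: "(\<integral>t. indicator {0..real n} t *\<^sub>R G' t \<partial>lborel) = G (real n) - G 0" for n :: nat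
    by (rule integral_FTC_atLeastAtMost) (use Gd G'c in auto)
  have Gb: "norm (G t) \<le> exp (- lam * t) * norm (\<integral>x. \<bar>f x\<bar> \<partial>lborel)" if "t \<ge> 0" for t
  proof -
    have "norm (wave_int f (p t)) \<le> (\<integral>x. \<bar>f x\<bar> \<partial>lborel)"
      unfolding wave_int_def by (rule order_trans[OF integral_norm_bound]) simp
    then have "norm (m t) * norm (wave_int f (p t)) \<le> 1 * norm (\<integral>x. \<bar>f x\<bar> \<partial>lborel)"
      using m1[OF that] by (intro mult_mono) (auto simp: m_def)
    then show ?thesis by (simp add: G_def norm_mult)
  qed
  have ex0: "(\<lambda>n :: nat. exp (- lam * real n)) \<longlonglongrightarrow> 0"
  proof -
    have "(\<lambda>n :: nat. exp (- lam) ^ n) \<longlonglongrightarrow> 0" using lam by (intro LIMSEQ_power_zero) simp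
    then show ?thesis by (simp add: exp_of_nat_mult[symmetric] mult.commute)
  qed
  have G0: "(\<lambda>n. G (real n)) \<longlonglongrightarrow> 0"
  proof (rule Lim_null_comparison)
    show "\<forall>\<^sub>F n in sequentially. norm (G (real n)) \<le> exp (- lam * real n) * norm (\<integral>x. \<bar>f x\<bar> \<partial>lborel)"
      using Gb by simp
    show "(\<lambda>n. exp (- lam * real n) * norm (\<integral>x. \<bar>f x\<bar> \<partial>lborel)) \<longlonglongrightarrow> 0"
      using tendsto_mult_left_zero[OF ex0] by simp
  qed
  note ei = integrable_exp_decay[OF lam]
  have lim: "(\<lambda>n. \<integral>t. indicator {0..real n} t *\<^sub>R G' t \<partial>lborel) \<longlonglongrightarrow> (\<integral>t. indicator {0..} t *\<^sub>R G' t \<partial>lborel)"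
  proof (rule integral_dominated_convergence[where w = "\<lambda>t. (indicator {0..} t * exp (- lam * t)) * N"])
    show "integrable lborel (\<lambda>t. (indicator {0..} t * exp (- lam * t)) * N)" using ei by simp
    show meas: "(\<lambda>t. indicator {0..real n} t *\<^sub>R G' t) \<in> borel_measurable lborel" for n
      using borel_measurable_continuous_on_indicator[OF _ G'c, of "real n"] by simp
    have l: "(\<lambda>n. indicator {0..real n} t *\<^sub>R G' t) \<longlonglongrightarrow> indicator {0..} t *\<^sub>R G' t" for t
    proof (rule tendsto_eventually)
      show "\<forall>\<^sub>F n in sequentially. indicator {0..real n} t *\<^sub>R G' t = indicator {0..} t *\<^sub>R G' t"
        using eventually_ge_at_top[of "nat \<lceil>t\<rceil>"] by eventually_elim (auto simp: indicator_def nat_le_iff ceiling_le_iff)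
    qed
    then show "AE t in lborel. (\<lambda>n. indicator {0..real n} t *\<^sub>R G' t) \<longlonglongrightarrow> indicator {0..} t *\<^sub>R G' t" by simp
    show "(\<lambda>t. indicator {0..} t *\<^sub>R G' t) \<in> borel_measurable lborel"
      by (rule borel_measurable_LIMSEQ_metric[OF meas l])
    show "AE t in lborel. norm (indicator {0..real n} t *\<^sub>R G' t) \<le> (indicator {0..} t * exp (- lam * t)) * N" for n
    proof (rule AE_I2)
      fix t
      have "norm (G' t) \<le> exp (- lam * t) * N" if "t \<ge> 0"
      proof -
        have "norm (m t) * norm (wave_int \<psi> (p t)) \<le> 1 * N"
          using m1[OF that] N by (intro mult_mono) (auto simp: m_def)
        then show ?thesis by (simp add: G'_def norm_mult)
      qed
      then show "norm (indicator {0..real n} t *\<^sub>R G' t) \<le> (indicator {0..} t * exp (- lam * t)) * N"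
        using N0 by (auto simp: indicator_def)
    qed
  qed
  have "(\<lambda>n. \<integral>t. indicator {0..real n} t *\<^sub>R G' t \<partial>lborel) \<longlonglongrightarrow> 0 - G 0"
    unfolding ftc by (intro tendsto_intros G0)
  from LIMSEQ_unique[OF lim this] have "(\<integral>t. indicator {0..} t *\<^sub>R G' t \<partial>lborel) = - G 0" by simp
  moreover have "m 0 = 1"
  proof -
    have "AE s in lborel. indicator {0..0} s *\<^sub>R h s = 0" for h :: "real \<Rightarrow> complex"
      using AE_lborel_singleton[of 0] by eventually_elim (simp add: indicator_def)
    from integral_eq_zero_AE[OF this] show ?thesis by (simp add: m_def wave_mult_def)
  qed
  then have "G 0 = wave_int f q" by (simp add: G_def p_def mat_exp_0)
  ultimately show ?thesis by (simp add: G'_def)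
qed

section \<open>Measurability and integrability in time and space\<close>

lemma Cb_bounded: "g \<in> Cb \<Longrightarrow> \<exists>K. \<forall>x. \<bar>g x\<bar> \<le> K"
  by (auto simp: Cb_def bounded_iff)

lemma Cb_continuous: "g \<in> Cb \<Longrightarrow> continuous_on UNIV g"
  by (simp add: Cb_def uniformly_continuous_imp_continuous)

lemma Cb_diff: "f \<in> Cb \<Longrightarrow> g \<in> Cb \<Longrightarrow> (\<lambda>x. f x - g x) \<in> Cb"
proof -
  assume f: "f \<in> Cb" and g: "g \<in> Cb"
  obtain K L where K: "\<And>x. \<bar>f x\<bar> \<le> K" and L: "\<And>x. \<bar>g x\<bar> \<le> L"
    using Cb_bounded[OF f] Cb_bounded[OF g] by auto
  have "\<bar>f x - g x\<bar> \<le> K + L" for x using K[of x] L[of x] by linarith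
  then have "bounded (range (\<lambda>x. f x - g x))" by (auto simp: bounded_iff)
  then show ?thesis using f g by (auto simp: Cb_def intro: uniformly_continuous_on_diff)
qed

text \<open>Differentiability within \<open>{0..T}\<close> yields continuity only on these compact
  intervals, so measurability on the half-line is obtained as a limit.\<close>

lemma borel_measurable_indicator_Ici:
  fixes m :: "real \<Rightarrow> 'b::{banach, second_countable_topology}"
  assumes "\<And>T. continuous_on {0..T} m"
  shows "(\<lambda>t. indicator {0..} t *\<^sub>R m t) \<in> borel_measurable borel"
proof (rule borel_measurable_LIMSEQ_metric)
  show "(\<lambda>t. indicator {0..real n} t *\<^sub>R m t) \<in> borel_measurable borel" for n
    using borel_measurable_continuous_on_indicator[OF _ assms, of "real n"] by simp
  show "(\<lambda>n. indicator {0..real n} t *\<^sub>R m t) \<longlonglongrightarrow> indicator {0..} t *\<^sub>R m t" for t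
  proof (rule tendsto_eventually)
    show "\<forall>\<^sub>F n in sequentially. indicator {0..real n} t *\<^sub>R m t = indicator {0..} t *\<^sub>R m t"
      using eventually_ge_at_top[of "nat \<lceil>t\<rceil>"] by eventually_elim (auto simp: indicator_def nat_le_iff ceiling_le_iff)
  qed
qed

text \<open>The hypothesis of Fubini for exchanging the time integral of the resolvent with the
  space integral; the majorant is a product of a function of \<open>t\<close> and a function of
  \<open>x\<close>.\<close>

lemma integrable_exp_decay_product:
  fixes U :: "real \<Rightarrow> real^'n \<Rightarrow> 'b::{banach, second_countable_topology}"
  assumes lam: "lam > 0" and \<psi>: "integrable lborel \<psi>"
    and m: "(\<lambda>(t, x). indicator {0..} t *\<^sub>R U t x) \<in> borel_measurable (borel \<Otimes>\<^sub>M borel)"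
    and b: "\<And>t x. 0 \<le> t \<Longrightarrow> norm (U t x) \<le> K"
  shows "integrable (lborel \<Otimes>\<^sub>M lborel) (\<lambda>(t, x). \<psi> x *\<^sub>R (indicator {0..} t *\<^sub>R (exp (- lam * t) *\<^sub>R U t x)))"
proof -
  have \<psi>m[measurable]: "\<psi> \<in> borel_measurable borel" using \<psi> by auto
  have m'[measurable]: "(\<lambda>p. indicator {0..} (fst p) *\<^sub>R U (fst p) (snd p)) \<in> borel_measurable (borel \<Otimes>\<^sub>M borel)"
    using m by (simp add: case_prod_beta')
  have K: "K \<ge> 0" using b[of 0 0] norm_ge_zero order_trans by blast
  have meas: "(\<lambda>p. \<psi> (snd p) *\<^sub>R (exp (- lam * fst p) *\<^sub>R (indicator {0..} (fst p) *\<^sub>R U (fst p) (snd p)))) \<in> borel_measurable (borel \<Otimes>\<^sub>M borel)"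
    by measurable
  have meas': "(\<lambda>(t, x). \<psi> x *\<^sub>R (indicator {0..} t *\<^sub>R (exp (- lam * t) *\<^sub>R U t x))) \<in> borel_measurable (lborel \<Otimes>\<^sub>M lborel)"
    using meas by (simp add: case_prod_beta' mult_ac)
  have bnd: "norm (\<psi> x *\<^sub>R (indicator {0..} t *\<^sub>R (exp (- lam * t) *\<^sub>R U t x))) \<le> (indicator {0..} t * exp (- lam * t) * K) * \<bar>\<psi> x\<bar>" for t x
  proof (cases "0 \<le> t")
    case True
    have "(exp (- lam * t) * norm (U t x)) * \<bar>\<psi> x\<bar> \<le> (exp (- lam * t) * K) * \<bar>\<psi> x\<bar>"
      by (intro mult_right_mono mult_left_mono b[OF True]) auto
    then show ?thesis using True by (simp add: mult_ac abs_mult)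
  qed simp
  have "integrable (lborel \<Otimes>\<^sub>M lborel) (\<lambda>(t, x). (indicator {0..} t * exp (- lam * t) * K) * \<bar>\<psi> x\<bar>)"
  proof (rule lborel_pair.Fubini_integrable)
    show "(\<lambda>(t, x). (indicator {0..} t * exp (- lam * t) * K) * \<bar>\<psi> x\<bar>) \<in> borel_measurable (lborel \<Otimes>\<^sub>M lborel)"
      by measurable
    show "integrable lborel (\<lambda>t. \<integral>x. norm (case (t, x) of (t, x) \<Rightarrow> (indicator {0..} t * exp (- lam * t) * K) * \<bar>\<psi> x\<bar>) \<partial>lborel)"
      using integrable_exp_decay[OF lam] K by (simp add: abs_mult)
  qed (use \<psi> in auto)
  then show ?thesis
  proof (rule Bochner_Integration.integrable_bound[OF _ meas'], intro AE_I2, clarify)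
    fix t x
    show "norm (\<psi> x *\<^sub>R (indicator {0..} t *\<^sub>R (exp (- lam * t) *\<^sub>R U t x))) \<le> norm ((indicator {0..} t * exp (- lam * t) * K) * \<bar>\<psi> x\<bar>)"
      by (rule order_trans[OF bnd]) simp
  qed
qed

lemma integral_Re_mult:
  fixes c :: complex
  assumes "integrable M h"
  shows "(\<integral>t. Re (c * h t) \<partial>M) = Re (c * (\<integral>t. h t \<partial>M))"
  using integral_Re[OF integrable_mult_right[OF assms, of c]] by (simp only: integral_mult_right_zero)

section \<open>The resolvent of the semigroup\<close>

locale levy_ou =
  fixes A :: "real^'n^'n" and B :: "real^'d^'n" and b :: "real^'d" and Q :: "real^'d^'d"
    and \<nu> :: "(real^'d) measure" and M :: "'w measure" and Z :: "real \<Rightarrow> 'w \<Rightarrow> real^'d"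
    and lam :: real and w :: "'d \<Rightarrow> real^'d"
  assumes \<nu>: "levy_measure \<nu>" and Q: "\<And>i j. Q $ i $ j = (\<Sum>k\<in>UNIV. w k $ i * w k $ j)"
    and Z: "levy_process M Z"
    and char: "\<And>t p. 0 \<le> t \<Longrightarrow>
           (\<integral>\<omega>. exp (\<i> * of_real (p \<bullet> Z t \<omega>)) \<partial>M) = exp (- of_real t * levy_exponent b Q \<nu> p)"
    and lam: "0 < lam"
begin

sublocale prob_space M
  using Z by (simp add: levy_process_def)

abbreviation P :: "real \<Rightarrow> (real^'n \<Rightarrow> real) \<Rightarrow> real^'n \<Rightarrow> real" where
  "P \<equiv> ou_semigroup M Z A B"

definition resolvent :: "(real^'n \<Rightarrow> real) \<Rightarrow> real^'n \<Rightarrow> real" where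
  "resolvent g x = (\<integral>t. indicator {0..} t *\<^sub>R (exp (- lam * t) *\<^sub>R P t g x) \<partial>lborel)"

lemma X_measurable[measurable]: "0 \<le> t \<Longrightarrow> ou_process M Z A B x t \<in> borel_measurable M"
  by (rule ou_process_measurable[OF Z])

lemma P_bound:
  assumes "\<And>x. \<bar>g x\<bar> \<le> K"
  shows "\<bar>P t g x\<bar> \<le> K"
proof (cases "integrable M (\<lambda>\<omega>. g (ou_process M Z A B x t \<omega>))")
  case True
  have "\<bar>P t g x\<bar> \<le> (\<integral>\<omega>. \<bar>g (ou_process M Z A B x t \<omega>)\<bar> \<partial>M)"
    unfolding ou_semigroup_def by (rule integral_abs_bound)
  also have "\<dots> \<le> (\<integral>\<omega>. K \<partial>M)" using True assms by (intro integral_mono) auto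
  finally show ?thesis by (simp add: prob_space)
next
  case False
  have "K \<ge> 0" using assms abs_ge_zero order_trans by blast
  with False show ?thesis by (simp add: ou_semigroup_def not_integrable_integral_eq)
qed

lemma P_integrable:
  fixes g :: "real^'n \<Rightarrow> real"
  assumes "g \<in> borel_measurable borel" "\<And>x. \<bar>g x\<bar> \<le> K" "0 \<le> t"
  shows "integrable M (\<lambda>\<omega>. g (ou_process M Z A B x t \<omega>))"
  using assms by (intro integrable_const_bound[of _ K]) auto

lemma P_tendsto:
  assumes f: "\<And>n. f n \<in> borel_measurable borel" and K: "\<And>n x. \<bar>f n x\<bar> \<le> K"
    and lim: "\<And>x. (\<lambda>n. f n x) \<longlonglongrightarrow> g x" and t: "0 \<le> t"
  shows "(\<lambda>n. P t (f n) x) \<longlonglongrightarrow> P t g x"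
  unfolding ou_semigroup_def
proof (rule integral_dominated_convergence[where w = "\<lambda>_. K"])
  have "g \<in> borel_measurable borel" by (rule borel_measurable_LIMSEQ_metric[OF f lim])
  then show "(\<lambda>\<omega>. g (ou_process M Z A B x t \<omega>)) \<in> borel_measurable M" using t by measurable
  show "(\<lambda>\<omega>. f n (ou_process M Z A B x t \<omega>)) \<in> borel_measurable M" for n using f t by measurable
qed (use K lim in auto)

abbreviation test :: "(real^'n \<Rightarrow> real) \<Rightarrow> real^'n \<Rightarrow> real" where
  "test f x \<equiv> lam * f x - ou_op_adj A B b Q \<nu> f x"

text \<open>Joint measurability in time and space belongs to the predicate because integrating over
  \<open>t\<close> needs it and it passes to pointwise limits. The indicator discards negative
  times, where the process is not controlled.\<close>

definition good :: "(real^'n \<Rightarrow> real) \<Rightarrow> bool" where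
  "good g \<longleftrightarrow> (\<exists>K. \<forall>x. \<bar>g x\<bar> \<le> K) \<and> g \<in> borel_measurable borel \<and>
     (\<lambda>(t, x). indicator {0..} t *\<^sub>R P t g x) \<in> borel_measurable (borel \<Otimes>\<^sub>M borel) \<and>
     (\<forall>f\<in>Cc_infty. (\<integral>x. test f x * resolvent g x \<partial>lborel) = (\<integral>x. f x * g x \<partial>lborel))"

lemma goodI:
  assumes "\<And>x. \<bar>g x\<bar> \<le> K" "g \<in> borel_measurable borel"
    and "(\<lambda>(t, x). indicator {0..} t *\<^sub>R P t g x) \<in> borel_measurable (borel \<Otimes>\<^sub>M borel)"
    and "\<And>f. f \<in> Cc_infty \<Longrightarrow> (\<integral>x. test f x * resolvent g x \<partial>lborel) = (\<integral>x. f x * g x \<partial>lborel)"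
  shows "good g"
  unfolding good_def
proof (intro conjI ballI)
  show "\<exists>K. \<forall>x. \<bar>g x\<bar> \<le> K" using assms(1) by blast
qed (fact assms)+

lemma goodD:
  assumes "good g"
  shows "\<exists>K. \<forall>x. \<bar>g x\<bar> \<le> K" and "g \<in> borel_measurable borel"
    and "(\<lambda>(t, x). indicator {0..} t *\<^sub>R P t g x) \<in> borel_measurable (borel \<Otimes>\<^sub>M borel)"
    and "f \<in> Cc_infty \<Longrightarrow> (\<integral>x. test f x * resolvent g x \<partial>lborel) = (\<integral>x. f x * g x \<partial>lborel)"
proof -
  note * = assms[unfolded good_def]
  show "\<exists>K. \<forall>x. \<bar>g x\<bar> \<le> K" by (rule *[THEN conjunct1])
  show "g \<in> borel_measurable borel" by (rule *[THEN conjunct2, THEN conjunct1])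
  show "(\<lambda>(t, x). indicator {0..} t *\<^sub>R P t g x) \<in> borel_measurable (borel \<Otimes>\<^sub>M borel)"
    by (rule *[THEN conjunct2, THEN conjunct2, THEN conjunct1])
  show "f \<in> Cc_infty \<Longrightarrow> (\<integral>x. test f x * resolvent g x \<partial>lborel) = (\<integral>x. f x * g x \<partial>lborel)"
    by (rule bspec[OF *[THEN conjunct2, THEN conjunct2, THEN conjunct2]])
qed

lemma test_integrable: "f \<in> Cc_infty \<Longrightarrow> integrable lborel (test f)"
  using ou_test_function(2)[OF \<nu> Q, of f "\<lambda>x. 1 :: real" 1 lam A B b] by simp

lemma wave_mult_bound: "0 \<le> t \<Longrightarrow> norm (wave_mult (levy_exponent b Q \<nu>) A B q t) \<le> 1"
  by (rule wave_mult_norm_le[OF Z char continuous_levy_exponent[OF \<nu>]])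

lemma P_time_measurable:
  assumes "(\<lambda>(t, x). indicator {0..} t *\<^sub>R P t g x) \<in> borel_measurable (borel \<Otimes>\<^sub>M borel)"
  shows "(\<lambda>t. indicator {0..} t *\<^sub>R (exp (- lam * t) *\<^sub>R P t g x)) \<in> borel_measurable borel"
proof -
  have "(\<lambda>t. (\<lambda>(t, x). indicator {0..} t *\<^sub>R P t g x) (t, x)) \<in> borel_measurable borel"
    by (rule measurable_compose[OF _ assms]) measurable
  then have "(\<lambda>t. indicator {0..} t *\<^sub>R P t g x) \<in> borel_measurable borel" by simp
  then have "(\<lambda>t. exp (- lam * t) *\<^sub>R (indicator {0..} t *\<^sub>R P t g x)) \<in> borel_measurable borel"
    by (rule borel_measurable_scaleR[rotated]) measurable
  then show ?thesis by (simp add: mult_ac)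
qed

lemma resolvent_integrand_bound:
  assumes "\<And>x. \<bar>g x\<bar> \<le> K"
  shows "norm (indicator {0..} t *\<^sub>R (exp (- lam * t) *\<^sub>R P t g x)) \<le> (indicator {0..} t * exp (- lam * t)) * K"
  using P_bound[OF assms, where t = t and x = x] by (auto simp: indicator_def abs_mult)

lemma resolvent_integrable:
  assumes "\<And>x. \<bar>g x\<bar> \<le> K"
    and "(\<lambda>(t, x). indicator {0..} t *\<^sub>R P t g x) \<in> borel_measurable (borel \<Otimes>\<^sub>M borel)"
  shows "integrable lborel (\<lambda>t. indicator {0..} t *\<^sub>R (exp (- lam * t) *\<^sub>R P t g x))"
proof (rule Bochner_Integration.integrable_bound)
  show "integrable lborel (\<lambda>t. (indicator {0..} t * exp (- lam * t)) * K)"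
    using integrable_exp_decay[OF lam] by simp
  show "AE t in lborel. norm (indicator {0..} t *\<^sub>R (exp (- lam * t) *\<^sub>R P t g x)) \<le> norm ((indicator {0..} t * exp (- lam * t)) * K)"
    by (rule AE_I2, rule order_trans[OF resolvent_integrand_bound[OF assms(1)]]) simp
qed (use P_time_measurable[OF assms(2)] in simp)

lemma resolvent_bound:
  assumes "\<And>x. \<bar>g x\<bar> \<le> K"
  shows "\<bar>resolvent g x\<bar> \<le> (\<integral>t. indicator {0..} t * exp (- lam * t) \<partial>lborel) * K"
proof (cases "integrable lborel (\<lambda>t. indicator {0..} t *\<^sub>R (exp (- lam * t) *\<^sub>R P t g x))")
  case True
  have "\<bar>resolvent g x\<bar> \<le> (\<integral>t. norm (indicator {0..} t *\<^sub>R (exp (- lam * t) *\<^sub>R P t g x)) \<partial>lborel)"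
    unfolding resolvent_def real_norm_def[symmetric] by (rule integral_norm_bound)
  also have "\<dots> \<le> (\<integral>t. (indicator {0..} t * exp (- lam * t)) * K \<partial>lborel)"
    using True integrable_exp_decay[OF lam] resolvent_integrand_bound[OF assms] by (intro integral_mono integrable_norm) auto
  finally show ?thesis by simp
next
  case False
  have "K \<ge> 0" using assms abs_ge_zero order_trans by blast
  moreover have "0 \<le> (\<integral>t. indicator {0..} t * exp (- lam * t) \<partial>lborel)" by (intro integral_nonneg_AE) auto
  ultimately show ?thesis using False by (simp add: resolvent_def not_integrable_integral_eq)
qed

lemma resolvent_measurable:
  assumes "(\<lambda>(t, x). indicator {0..} t *\<^sub>R P t g x) \<in> borel_measurable (borel \<Otimes>\<^sub>M borel)"
  shows "resolvent g \<in> borel_measurable borel"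
proof -
  have [measurable]: "(\<lambda>p. indicator {0..} (fst p) *\<^sub>R P (fst p) g (snd p)) \<in> borel_measurable (borel \<Otimes>\<^sub>M borel)"
    using assms by (simp add: case_prod_beta')
  have "(\<lambda>p. (\<lambda>p. indicator {0..} (fst p) *\<^sub>R P (fst p) g (snd p)) (snd p, fst p)) \<in> borel_measurable ((borel :: (real^'n) measure) \<Otimes>\<^sub>M (borel :: real measure))"
    by (rule measurable_compose[where N = "borel \<Otimes>\<^sub>M borel"]) measurable
  then have "(\<lambda>p. indicator {0..} (snd p) *\<^sub>R P (snd p) g (fst p)) \<in> borel_measurable ((borel :: (real^'n) measure) \<Otimes>\<^sub>M (borel :: real measure))"
    by (simp only: fst_conv snd_conv)
  then have "(\<lambda>p. exp (- lam * snd p) *\<^sub>R (indicator {0..} (snd p) *\<^sub>R P (snd p) g (fst p))) \<in> borel_measurable ((borel :: (real^'n) measure) \<Otimes>\<^sub>M (borel :: real measure))"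
    by (rule borel_measurable_scaleR[rotated]) measurable
  then have "(\<lambda>(x, t). indicator {0..} t *\<^sub>R (exp (- lam * t) *\<^sub>R P t g x)) \<in> borel_measurable ((borel :: (real^'n) measure) \<Otimes>\<^sub>M lborel)"
    by (simp add: case_prod_beta' mult_ac)
  then show ?thesis unfolding resolvent_def[abs_def] by (rule lborel.borel_measurable_lebesgue_integral)
qed

text \<open>Joint measurability is visible from the explicit formula: a measurable function of
  \<open>t\<close> times a jointly continuous wave. The weak equation follows from
  \<open>resolvent_wave\<close> by Fubini.\<close>

lemma good_wave: "good (\<lambda>x. Re (c * wave q x))"
proof -
  define m where "m = wave_mult (levy_exponent b Q \<nu>) A B q"
  define p where "p = (\<lambda>t. transpose (mat_exp (t *\<^sub>R A)) *v q)"
  have Pw: "P t (\<lambda>x. Re (c * wave q x)) x = Re (c * (m t * wave (p t) x))" if t: "0 \<le> t" for t x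
  proof -
    have i: "integrable M (\<lambda>\<omega>. wave q (ou_process M Z A B x t \<omega>))"
      using t by (intro integrable_const_bound[of _ 1]) auto
    have "(\<integral>\<omega>. wave q (ou_process M Z A B x t \<omega>) \<partial>M) = m t * wave (p t) x"
      unfolding m_def p_def by (rule ou_process_wave[OF Z char continuous_levy_exponent[OF \<nu>] t])
    moreover have "P t (\<lambda>x. Re (c * wave q x)) x = Re (c * (\<integral>\<omega>. wave q (ou_process M Z A B x t \<omega>) \<partial>M))"
      unfolding ou_semigroup_def by (rule integral_Re_mult[OF i])
    ultimately show ?thesis by simp
  qed
  have mc: "continuous_on {0..T} m" for T
    unfolding m_def using wave_mult_derivative[OF continuous_levy_exponent[OF \<nu>]]
    by (intro continuous_on_vector_derivative) blast
  have [measurable]: "(\<lambda>t. indicator {0..} t *\<^sub>R m t) \<in> borel_measurable borel"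
    by (rule borel_measurable_indicator_Ici[OF mc])
  have "continuous_on UNIV (\<lambda>y :: real \<times> (real^'n). wave (p (fst y)) (snd y))"
    unfolding wave_def p_def
    by (intro continuous_intros continuous_on_matrix_vector_mult' continuous_on_transpose continuous_on_mat_exp)
  from borel_measurable_continuous_onI[OF this]
  have [measurable]: "(\<lambda>y :: real \<times> (real^'n). wave (p (fst y)) (snd y)) \<in> borel_measurable (borel \<Otimes>\<^sub>M borel)"
    by (simp add: borel_prod)
  have um: "(\<lambda>y :: real \<times> (real^'n). (indicator {0..} (fst y) *\<^sub>R m (fst y)) * wave (p (fst y)) (snd y)) \<in> borel_measurable (borel \<Otimes>\<^sub>M borel)"
    by measurable
  then have um': "(\<lambda>(t, x). indicator {0..} t *\<^sub>R (m t * wave (p t) x)) \<in> borel_measurable (borel \<Otimes>\<^sub>M borel)"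
    by (simp add: case_prod_beta')
  have Pw': "indicator {0..} t *\<^sub>R P t (\<lambda>x. Re (c * wave q x)) x = Re (c * (indicator {0..} t *\<^sub>R (m t * wave (p t) x)))" for t x
  proof (cases "0 \<le> t")
    case True
    then have "indicator {0..} t = (1 :: real)" by simp
    then show ?thesis by (simp only: scaleR_one Pw[OF True])
  qed simp
  have jm: "(\<lambda>(t, x). indicator {0..} t *\<^sub>R P t (\<lambda>x. Re (c * wave q x)) x) \<in> borel_measurable (borel \<Otimes>\<^sub>M borel)"
  proof -
    have "(\<lambda>y :: real \<times> (real^'n). Re (c * ((indicator {0..} (fst y) *\<^sub>R m (fst y)) * wave (p (fst y)) (snd y)))) \<in> borel_measurable (borel \<Otimes>\<^sub>M borel)"
      using um by measurable
    then show ?thesis unfolding Pw' by (simp add: case_prod_beta')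
  qed
  have mb: "norm (m t * wave (p t) x) \<le> 1" if "0 \<le> t" for t x
    using wave_mult_bound[OF that] by (simp add: m_def norm_mult)
  have gb: "\<bar>Re (c * wave q x)\<bar> \<le> norm c" for x
    using abs_Re_le_cmod[of "c * wave q x"] by (simp add: norm_mult)
  have res: "(\<integral>x. test f x * resolvent (\<lambda>x. Re (c * wave q x)) x \<partial>lborel) = (\<integral>x. f x * Re (c * wave q x) \<partial>lborel)" if f: "f \<in> Cc_infty" for f
  proof -
    define H where "H t x = test f x *\<^sub>R (indicator {0..} t *\<^sub>R (exp (- lam * t) *\<^sub>R (m t * wave (p t) x)))" for t x
    have Hi: "integrable (lborel \<Otimes>\<^sub>M lborel) (\<lambda>(t, x). H t x)"
      unfolding H_def by (rule integrable_exp_decay_product[OF lam test_integrable[OF f] um' mb])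
    have tm: "(\<lambda>t. indicator {0..} t *\<^sub>R (exp (- lam * t) *\<^sub>R (m t * wave (p t) x))) \<in> borel_measurable borel" for x
    proof -
      have "(\<lambda>t. (\<lambda>(t, x). indicator {0..} t *\<^sub>R (m t * wave (p t) x)) (t, x)) \<in> borel_measurable borel"
        by (rule measurable_compose[OF _ um']) measurable
      then have "(\<lambda>t. indicator {0..} t *\<^sub>R (m t * wave (p t) x)) \<in> borel_measurable borel" by simp
      then have "(\<lambda>t. exp (- lam * t) *\<^sub>R (indicator {0..} t *\<^sub>R (m t * wave (p t) x))) \<in> borel_measurable borel"
        by (rule borel_measurable_scaleR[rotated]) measurable
      then show ?thesis by (simp add: mult_ac)
    qed
    have ti: "integrable lborel (\<lambda>t. indicator {0..} t *\<^sub>R (exp (- lam * t) *\<^sub>R (m t * wave (p t) x)))" for x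
    proof (rule Bochner_Integration.integrable_bound[OF integrable_exp_decay[OF lam]])
      show "AE t in lborel. norm (indicator {0..} t *\<^sub>R (exp (- lam * t) *\<^sub>R (m t * wave (p t) x))) \<le> norm (indicator {0..} t * exp (- lam * t))"
        using mb by (intro AE_I2) (auto simp: indicator_def)
    qed (use tm in simp)
    have rw: "test f x * resolvent (\<lambda>x. Re (c * wave q x)) x = Re (c * (\<integral>t. H t x \<partial>lborel))" for x
    proof -
      have "resolvent (\<lambda>x. Re (c * wave q x)) x = (\<integral>t. Re (c * (indicator {0..} t *\<^sub>R (exp (- lam * t) *\<^sub>R (m t * wave (p t) x)))) \<partial>lborel)"
        unfolding resolvent_def
      proof (rule Bochner_Integration.integral_cong[OF refl])
        fix t
        show "indicator {0..} t *\<^sub>R (exp (- lam * t) *\<^sub>R P t (\<lambda>x. Re (c * wave q x)) x) =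
            Re (c * (indicator {0..} t *\<^sub>R (exp (- lam * t) *\<^sub>R (m t * wave (p t) x))))"
        proof (cases "0 \<le> t")
          case True
          then have "indicator {0..} t = (1 :: real)" by simp
          then show ?thesis by (simp only: scaleR_one Pw[OF True]) (simp add: algebra_simps)
        qed simp
      qed
      also have "\<dots> = Re (c * (\<integral>t. indicator {0..} t *\<^sub>R (exp (- lam * t) *\<^sub>R (m t * wave (p t) x)) \<partial>lborel))"
        by (rule integral_Re_mult[OF ti])
      finally show ?thesis by (simp add: H_def del: scaleR_scaleR)
    qed
    \<comment> \<open>With the space integral inside, each time slice is the Fourier transform of
      \<open>test f\<close> at the moving frequency. The computation stays complex, and the real
      part is taken only after the identity for waves has been applied.\<close>
    have "(\<integral>x. \<integral>t. H t x \<partial>lborel \<partial>lborel) = (\<integral>t. \<integral>x. H t x \<partial>lborel \<partial>lborel)"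
      using lborel_pair.Fubini_integral[OF Hi] by simp
    also have "\<dots> = (\<integral>t. indicator {0..} t *\<^sub>R (exp (- lam * t) *\<^sub>R (m t * wave_int (test f) (p t))) \<partial>lborel)"
    proof (rule Bochner_Integration.integral_cong[OF refl])
      fix t
      have H: "H t x = (of_real (indicator {0..} t * exp (- lam * t)) * m t) * (test f x *\<^sub>R wave (p t) x)" for x
        by (simp add: H_def scaleR_conv_of_real mult_ac)
      have "(\<integral>x. H t x \<partial>lborel) = (of_real (indicator {0..} t * exp (- lam * t)) * m t) * wave_int (test f) (p t)"
        unfolding H wave_int_def by (rule integral_mult_right_zero)
      then show "(\<integral>x. H t x \<partial>lborel) = indicator {0..} t *\<^sub>R (exp (- lam * t) *\<^sub>R (m t * wave_int (test f) (p t)))"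
        by (simp add: scaleR_conv_of_real)
    qed
    also have "\<dots> = wave_int f q"
      unfolding m_def p_def by (rule resolvent_wave[OF \<nu> Q f lam wave_mult_bound])
    finally have fub: "(\<integral>x. \<integral>t. H t x \<partial>lborel \<partial>lborel) = wave_int f q" .
    have "integrable lborel (\<lambda>x. \<integral>t. H t x \<partial>lborel)" using lborel_pair.integrable_snd[OF Hi] by simp
    then have "(\<integral>x. test f x * resolvent (\<lambda>x. Re (c * wave q x)) x \<partial>lborel) = Re (c * wave_int f q)"
      unfolding rw fub[symmetric] by (rule integral_Re_mult)
    also have "\<dots> = (\<integral>x. Re (c * (f x *\<^sub>R wave q x)) \<partial>lborel)"
      unfolding wave_int_def
      by (rule integral_Re_mult[symmetric], rule integrable_Cc_infty_scaleR[OF f wave_measurable, of q 1]) simp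
    also have "\<dots> = (\<integral>x. f x * Re (c * wave q x) \<partial>lborel)"
      by (simp add: algebra_simps)
    finally show ?thesis .
  qed
  show ?thesis by (rule goodI[OF gb _ jm res]) simp
qed

lemma good_add:
  assumes f: "good f" and g: "good g"
  shows "good (\<lambda>x. f x + g x)"
proof -
  obtain K L where K: "\<And>x. \<bar>f x\<bar> \<le> K" and L: "\<And>x. \<bar>g x\<bar> \<le> L" using goodD(1)[OF f] goodD(1)[OF g] by metis
  note m = goodD(2)[OF f] goodD(2)[OF g] goodD(3)[OF f] goodD(3)[OF g]
  have Pa: "indicator {0..} t *\<^sub>R P t (\<lambda>x. f x + g x) x = indicator {0..} t *\<^sub>R P t f x + indicator {0..} t *\<^sub>R P t g x" for t x
    unfolding ou_semigroup_def using P_integrable[OF m(1) K] P_integrable[OF m(2) L] by (simp add: indicator_def)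
  have r: "resolvent (\<lambda>x. f x + g x) x = resolvent f x + resolvent g x" for x
  proof -
    have "indicator {0..} t *\<^sub>R (exp (- lam * t) *\<^sub>R P t (\<lambda>x. f x + g x) x)
        = indicator {0..} t *\<^sub>R (exp (- lam * t) *\<^sub>R P t f x) + indicator {0..} t *\<^sub>R (exp (- lam * t) *\<^sub>R P t g x)" for t
      using Pa[of t x] by (auto simp: indicator_def distrib_left)
    then show ?thesis unfolding resolvent_def
      using resolvent_integrable[OF K m(3)] resolvent_integrable[OF L m(4)] by simp
  qed
  have 4: "(\<integral>x. test h x * resolvent (\<lambda>x. f x + g x) x \<partial>lborel) = (\<integral>x. h x * (f x + g x) \<partial>lborel)" if h: "h \<in> Cc_infty" for h
  proof -
    have i: "integrable lborel (\<lambda>x. test h x * resolvent f x)" "integrable lborel (\<lambda>x. test h x * resolvent g x)"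
      using ou_test_function(2)[OF \<nu> Q h resolvent_measurable[OF m(3)] resolvent_bound[OF K, folded real_norm_def]]
        ou_test_function(2)[OF \<nu> Q h resolvent_measurable[OF m(4)] resolvent_bound[OF L, folded real_norm_def]] by auto
    have j: "integrable lborel (\<lambda>x. h x * f x)" "integrable lborel (\<lambda>x. h x * g x)"
      using integrable_Cc_infty_scaleR[OF h m(1) K[folded real_norm_def]] integrable_Cc_infty_scaleR[OF h m(2) L[folded real_norm_def]] by auto
    show ?thesis using i j goodD(4)[OF f h] goodD(4)[OF g h] by (simp add: r distrib_left)
  qed
  have 1: "\<bar>f x + g x\<bar> \<le> K + L" for x using K[of x] L[of x] by linarith
  have 3: "(\<lambda>(t, x). indicator {0..} t *\<^sub>R P t (\<lambda>x. f x + g x) x) \<in> borel_measurable (borel \<Otimes>\<^sub>M borel)"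
    unfolding Pa using borel_measurable_add[OF m(3,4)] by (simp add: case_prod_beta')
  have 2: "(\<lambda>x. f x + g x) \<in> borel_measurable borel" using m(1,2) by simp
  show ?thesis by (rule goodI[OF 1 2 3 4])
qed

text \<open>Dominated convergence on three levels: over \<open>\<omega>\<close> for the semigroup,
  over \<open>t\<close> with the exponential weight for the resolvent, and over \<open>x\<close>
  against the integrable \<open>test h\<close>. The common bound \<open>K\<close> supplies all three
  majorants.\<close>

lemma good_limit:
  assumes f: "\<And>n. good (f n)" and K: "\<And>n x. \<bar>f n x\<bar> \<le> K" and lim: "\<And>x. (\<lambda>n. f n x) \<longlonglongrightarrow> g x"
  shows "good g"
proof -
  note fm = goodD(2)[OF f] and fj = goodD(3)[OF f]
  have gm: "g \<in> borel_measurable borel" by (rule borel_measurable_LIMSEQ_metric[OF fm lim])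
  have gK: "\<bar>g x\<bar> \<le> K" for x
    by (rule tendsto_upperbound[OF tendsto_rabs[OF lim]]) (use K in auto)
  have Pl: "(\<lambda>n. indicator {0..} t *\<^sub>R P t (f n) x) \<longlonglongrightarrow> indicator {0..} t *\<^sub>R P t g x" for t x
    using P_tendsto[OF fm K lim, of t x] by (cases "0 \<le> t") (auto simp: indicator_def)
  have gj: "(\<lambda>(t, x). indicator {0..} t *\<^sub>R P t g x) \<in> borel_measurable (borel \<Otimes>\<^sub>M borel)"
    by (rule borel_measurable_LIMSEQ_metric[OF fj]) (use Pl in auto)
  have Rl: "(\<lambda>n. resolvent (f n) x) \<longlonglongrightarrow> resolvent g x" for x
    unfolding resolvent_def
  proof (rule integral_dominated_convergence[where w = "\<lambda>t. (indicator {0..} t * exp (- lam * t)) * K"])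
    show "AE t in lborel. (\<lambda>n. indicator {0..} t *\<^sub>R (exp (- lam * t) *\<^sub>R P t (f n) x)) \<longlonglongrightarrow> indicator {0..} t *\<^sub>R (exp (- lam * t) *\<^sub>R P t g x)"
    proof (rule AE_I2)
      fix t show "(\<lambda>n. indicator {0..} t *\<^sub>R (exp (- lam * t) *\<^sub>R P t (f n) x)) \<longlonglongrightarrow> indicator {0..} t *\<^sub>R (exp (- lam * t) *\<^sub>R P t g x)"
        using tendsto_scaleR[OF tendsto_const[of "exp (- lam * t)"] Pl[of t x]] by (simp add: mult_ac)
    qed
    show "integrable lborel (\<lambda>t. (indicator {0..} t * exp (- lam * t)) * K)"
      using integrable_exp_decay[OF lam] by simp
    show "AE t in lborel. norm (indicator {0..} t *\<^sub>R (exp (- lam * t) *\<^sub>R P t (f n) x)) \<le> (indicator {0..} t * exp (- lam * t)) * K" for n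
      by (intro AE_I2 resolvent_integrand_bound K)
  qed (use P_time_measurable[OF gj] P_time_measurable[OF fj] in auto)
  have "(\<integral>x. test h x * resolvent g x \<partial>lborel) = (\<integral>x. h x * g x \<partial>lborel)" if h: "h \<in> Cc_infty" for h :: "real^'n \<Rightarrow> real"
  proof (rule LIMSEQ_unique)
    define c where "c = (\<integral>t. indicator {0..} t * exp (- lam * t) \<partial>lborel) * K"
    have tm[measurable]: "test h \<in> borel_measurable borel" using test_integrable[OF h] by auto
    show "(\<lambda>n. \<integral>x. test h x * resolvent (f n) x \<partial>lborel) \<longlonglongrightarrow> (\<integral>x. test h x * resolvent g x \<partial>lborel)"
    proof (rule integral_dominated_convergence[where w = "\<lambda>x. \<bar>test h x\<bar> * c"])
      show "integrable lborel (\<lambda>x. \<bar>test h x\<bar> * c)" using test_integrable[OF h] by auto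
      show "AE x in lborel. norm (test h x * resolvent (f n) x) \<le> \<bar>test h x\<bar> * c" for n
        using resolvent_bound[OF K] by (intro AE_I2) (auto simp: abs_mult c_def intro!: mult_left_mono)
      show "AE x in lborel. (\<lambda>n. test h x * resolvent (f n) x) \<longlonglongrightarrow> test h x * resolvent g x"
        by (intro AE_I2 tendsto_intros Rl)
    qed (use resolvent_measurable[OF gj] resolvent_measurable[OF fj] tm in \<open>auto intro!: borel_measurable_times\<close>)
    have "(\<lambda>n. \<integral>x. h x * f n x \<partial>lborel) \<longlonglongrightarrow> (\<integral>x. h x * g x \<partial>lborel)"
    proof (rule integral_dominated_convergence[where w = "\<lambda>x. \<bar>h x\<bar> * K"])
      show "integrable lborel (\<lambda>x. \<bar>h x\<bar> * K)" using integrable_Cc_infty[OF h] by auto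
      show "AE x in lborel. (\<lambda>n. h x * f n x) \<longlonglongrightarrow> h x * g x"
        by (intro AE_I2 tendsto_intros lim)
      show "AE x in lborel. norm (h x * f n x) \<le> \<bar>h x\<bar> * K" for n
        using K by (intro AE_I2) (auto simp: abs_mult intro!: mult_left_mono)
    qed (use gm fm Cc_infty_borel[OF h] in \<open>auto intro!: borel_measurable_times\<close>)
    moreover have "(\<integral>x. h x * f n x \<partial>lborel) = (\<integral>x. test h x * resolvent (f n) x \<partial>lborel)" for n
      by (rule goodD(4)[OF f h, symmetric])
    ultimately show "(\<lambda>n. \<integral>x. test h x * resolvent (f n) x \<partial>lborel) \<longlonglongrightarrow> (\<integral>x. h x * g x \<partial>lborel)"
      by simp
  qed
  then show ?thesis by (rule goodI[OF gK gm gj])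
qed

lemma good_trig: "trig f \<Longrightarrow> good f"
  by (induction rule: trig.induct) (rule good_wave, rule good_add)

lemma good_Cb:
  assumes "g \<in> Cb"
  shows "good g"
proof -
  obtain K where K: "\<And>x. \<bar>g x\<bar> \<le> K" using Cb_bounded[OF assms] by metis
  obtain T where "\<And>n :: nat. trig (T n)" "\<And>n x. \<bar>T n x\<bar> \<le> K + 1" "\<And>x. (\<lambda>n. T n x) \<longlonglongrightarrow> g x"
    using trig_approximation[OF Cb_continuous[OF assms] K] by metis
  then show ?thesis using good_limit[of T "K + 1" g] good_trig by metis
qed

text \<open>Processes started at two points share the same noise and differ by the deterministic
  vector \<open>mat_exp (t *\<^sub>R A) *v (x - y)\<close>. This difference need not be small
  uniformly in \<open>t\<close>, so the sequential form of uniform continuity is used, with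
  dominated convergence in \<open>t\<close> under the exponential weight.\<close>

lemma resolvent_Cb:
  assumes g: "g \<in> Cb"
  shows "resolvent g \<in> Cb"
proof -
  obtain K where K: "\<And>x. \<bar>g x\<bar> \<le> K" using Cb_bounded[OF g] by metis
  have gm: "g \<in> borel_measurable borel" by (intro borel_measurable_continuous_onI Cb_continuous g)
  note j = goodD(3)[OF good_Cb[OF g]]
  have "uniformly_continuous_on UNIV (resolvent g)"
    unfolding uniformly_continuous_on_sequentially
  proof (intro allI impI)
    fix X Y :: "nat \<Rightarrow> real^'n"
    assume "(\<forall>n. X n \<in> UNIV) \<and> (\<forall>n. Y n \<in> UNIV) \<and> (\<lambda>n. dist (X n) (Y n)) \<longlonglongrightarrow> 0"
    then have XY: "(\<lambda>n. X n - Y n) \<longlonglongrightarrow> 0" by (simp add: dist_norm tendsto_norm_zero_iff)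
    have Pd: "(\<lambda>n. P t g (X n) - P t g (Y n)) \<longlonglongrightarrow> 0" if t: "0 \<le> t" for t
    proof -
      have "(\<lambda>n. \<integral>\<omega>. g (ou_process M Z A B (X n) t \<omega>) - g (ou_process M Z A B (Y n) t \<omega>) \<partial>M) \<longlonglongrightarrow> (\<integral>\<omega>. 0 \<partial>M)"
      proof (rule integral_dominated_convergence[where w = "\<lambda>_. 2 * K"])
        show "AE \<omega> in M. (\<lambda>n. g (ou_process M Z A B (X n) t \<omega>) - g (ou_process M Z A B (Y n) t \<omega>)) \<longlonglongrightarrow> 0"
        proof (rule AE_I2)
          fix \<omega>
          have "(\<lambda>n. mat_exp (t *\<^sub>R A) *v (X n - Y n)) \<longlonglongrightarrow> mat_exp (t *\<^sub>R A) *v 0"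
            by (intro tendsto_matrix_vector_mult' tendsto_const XY)
          then have "(\<lambda>n. dist (ou_process M Z A B (X n) t \<omega>) (ou_process M Z A B (Y n) t \<omega>)) \<longlonglongrightarrow> 0"
            by (simp add: ou_process_def dist_norm matrix_vector_mult_diff_distrib tendsto_norm_zero_iff)
          then have "(\<lambda>n. dist (g (ou_process M Z A B (X n) t \<omega>)) (g (ou_process M Z A B (Y n) t \<omega>))) \<longlonglongrightarrow> 0"
            using g unfolding Cb_def uniformly_continuous_on_sequentially by simp
          then show "(\<lambda>n. g (ou_process M Z A B (X n) t \<omega>) - g (ou_process M Z A B (Y n) t \<omega>)) \<longlonglongrightarrow> 0"
            by (simp add: dist_real_def tendsto_rabs_zero_iff)
        qed
        show "AE \<omega> in M. norm (g (ou_process M Z A B (X n) t \<omega>) - g (ou_process M Z A B (Y n) t \<omega>)) \<le> 2 * K" for n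
        proof (rule AE_I2)
          fix \<omega> show "norm (g (ou_process M Z A B (X n) t \<omega>) - g (ou_process M Z A B (Y n) t \<omega>)) \<le> 2 * K"
            using K[of "ou_process M Z A B (X n) t \<omega>"] K[of "ou_process M Z A B (Y n) t \<omega>"] unfolding real_norm_def by linarith
        qed
      qed (use gm t in auto)
      then show ?thesis
        using P_integrable[OF gm K t] by (simp add: ou_semigroup_def)
    qed
    have "(\<lambda>n. \<integral>t. indicator {0..} t *\<^sub>R (exp (- lam * t) *\<^sub>R P t g (X n)) - indicator {0..} t *\<^sub>R (exp (- lam * t) *\<^sub>R P t g (Y n)) \<partial>lborel) \<longlonglongrightarrow> (\<integral>t. 0 \<partial>(lborel :: real measure))"
    proof (rule integral_dominated_convergence[where w = "\<lambda>t. (indicator {0..} t * exp (- lam * t)) * (2 * K)"])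
      show "integrable lborel (\<lambda>t. (indicator {0..} t * exp (- lam * t)) * (2 * K))"
        using integrable_exp_decay[OF lam] by simp
      show "AE t in lborel. (\<lambda>n. indicator {0..} t *\<^sub>R (exp (- lam * t) *\<^sub>R P t g (X n)) - indicator {0..} t *\<^sub>R (exp (- lam * t) *\<^sub>R P t g (Y n))) \<longlonglongrightarrow> 0"
      proof (rule AE_I2)
        fix t :: real
        show "(\<lambda>n. indicator {0..} t *\<^sub>R (exp (- lam * t) *\<^sub>R P t g (X n)) - indicator {0..} t *\<^sub>R (exp (- lam * t) *\<^sub>R P t g (Y n))) \<longlonglongrightarrow> 0"
          using tendsto_mult_right_zero[OF Pd, of t "exp (- lam * t)"] by (cases "0 \<le> t") (auto simp: indicator_def right_diff_distrib)
      qed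
      show "AE t in lborel. norm (indicator {0..} t *\<^sub>R (exp (- lam * t) *\<^sub>R P t g (X n)) - indicator {0..} t *\<^sub>R (exp (- lam * t) *\<^sub>R P t g (Y n))) \<le> (indicator {0..} t * exp (- lam * t)) * (2 * K)" for n
      proof (rule AE_I2)
        fix t
        show "norm (indicator {0..} t *\<^sub>R (exp (- lam * t) *\<^sub>R P t g (X n)) - indicator {0..} t *\<^sub>R (exp (- lam * t) *\<^sub>R P t g (Y n))) \<le> (indicator {0..} t * exp (- lam * t)) * (2 * K)"
          using order_trans[OF norm_triangle_ineq4 add_mono[OF resolvent_integrand_bound[OF K] resolvent_integrand_bound[OF K]]]
          by (simp only: mult_2 distrib_left)
      qed
    qed (use P_time_measurable[OF j] in \<open>auto intro!: borel_measurable_diff\<close>)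
    then have "(\<lambda>n. resolvent g (X n) - resolvent g (Y n)) \<longlonglongrightarrow> 0"
      unfolding resolvent_def using resolvent_integrable[OF K j] by simp
    then show "(\<lambda>n. dist (resolvent g (X n)) (resolvent g (Y n))) \<longlonglongrightarrow> 0"
      by (simp add: dist_real_def tendsto_rabs_zero_iff)
  qed
  moreover have "bounded (range (resolvent g))"
  proof -
    have "norm (resolvent g x) \<le> (\<integral>t. indicator {0..} t * exp (- lam * t) \<partial>lborel) * K" for x
      unfolding real_norm_def by (rule resolvent_bound[OF K])
    then show ?thesis unfolding bounded_iff by blast
  qed
  ultimately show ?thesis by (simp add: Cb_def)
qed

lemma weak_solution_resolvent:
  assumes "g \<in> Cb"
  shows "weak_solution A B b Q \<nu> lam g (resolvent g)"
  unfolding weak_solution_def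
  using resolvent_Cb[OF assms] goodD(4)[OF good_Cb[OF assms]] by (simp add: mult.commute)

text \<open>The right-hand side cancels in the difference, to which the maximum principle applies;
  exchanging the two solutions later gives equality.\<close>

lemma weak_solution_le:
  assumes v: "weak_solution A B b Q \<nu> lam g v" and u: "weak_solution A B b Q \<nu> lam g u"
  shows "v x \<le> u x"
proof -
  have vu: "v \<in> Cb" "u \<in> Cb" using v u by (auto simp: weak_solution_def)
  have i: "integrable lborel (\<lambda>x. y x * test f x)" if y: "y \<in> Cb" and f: "f \<in> Cc_infty" for y f
  proof -
    obtain K where "\<And>x. \<bar>y x\<bar> \<le> K" using Cb_bounded[OF y] by metis
    then show ?thesis
      using ou_test_function(2)[OF \<nu> Q f borel_measurable_continuous_onI[OF Cb_continuous[OF y]], of K lam A B b]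
      by (simp add: mult.commute)
  qed
  have "v x - u x \<le> 0"
  proof (rule weak_subsolution_nonpos[OF \<nu> Q lam Cb_diff[OF vu]])
    fix f :: "real^'n \<Rightarrow> real" assume f: "f \<in> Cc_infty"
    have "(\<integral>x. (v x - u x) * test f x \<partial>lborel) = (\<integral>x. v x * test f x \<partial>lborel) - (\<integral>x. u x * test f x \<partial>lborel)"
      using i[OF vu(1) f] i[OF vu(2) f] by (simp add: left_diff_distrib)
    also have "\<dots> = 0" using v u f by (simp add: weak_solution_def)
    finally show "(\<integral>x. (v x - u x) * test f x \<partial>lborel) = 0" .
  qed
  then show ?thesis by simp
qed

end

theorem theorem6:
  fixes A :: "real^'n^'n" and B :: "real^'d^'n"
    and b :: "real^'d" and Q :: "real^'d^'d"
    and \<nu> \<mu> :: "(real^'d) measure" and r0 \<alpha> :: real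
    and M :: "'w measure" and Z :: "real \<Rightarrow> 'w \<Rightarrow> real^'d"
    and lam :: real and g u :: "real^'n \<Rightarrow> real"
  assumes "CARD('d) \<le> CARD('n)"
    and "rank B = CARD('d)"
    and "transpose Q = Q" and "\<And>p. 0 \<le> p \<bullet> (Q *v p)"
    and "levy_measure \<nu>"
    and "0 < r0" and "0 < \<alpha>" and "\<alpha> < 2"
    and "nondegenerate_sphere_measure \<alpha> \<mu>"
    and "dominates_stable \<nu> r0 \<alpha> \<mu>"
    and "rank (kalman_matrix A B) = CARD('n)"
    and "levy_process M Z"
    and "\<And>t p. 0 \<le> t \<Longrightarrow>
           (\<integral>\<omega>. exp (\<i> * of_real (p \<bullet> Z t \<omega>)) \<partial>M) = exp (- of_real t * levy_exponent b Q \<nu> p)"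
    and "0 < lam" and "g \<in> Cb"
    and "\<And>x. u x = (LBINT t:{0..}. exp (- lam * t) * ou_semigroup M Z A B t g x)"
  shows "weak_solution A B b Q \<nu> lam g u \<and>
         (\<forall>v. weak_solution A B b Q \<nu> lam g v \<longrightarrow> v = u)"
proof -
  obtain w :: "'d \<Rightarrow> real^'d" where w: "\<And>i j. Q $ i $ j = (\<Sum>k\<in>UNIV. w k $ i * w k $ j)"
    using psd_sum_of_squares[OF assms(3,4)] by metis
  interpret levy_ou A B b Q \<nu> M Z lam w
    by unfold_locales (use assms w in auto)
  \<comment> \<open>The set integral unfolds to an integral over the whole line with the indicator
    in front, the form in which \<open>resolvent\<close> is defined.\<close>
  have "u = resolvent g"
    using assms(16) by (simp add: fun_eq_iff resolvent_def set_lebesgue_integral_def)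
  then have u: "weak_solution A B b Q \<nu> lam g u"
    using weak_solution_resolvent[OF assms(15)] by simp
  moreover have "v = u" if "weak_solution A B b Q \<nu> lam g v" for v
    using weak_solution_le[OF that u] weak_solution_le[OF u that] by (intro ext antisym)
  ultimately show ?thesis by blast
qed

end
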